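(* Let $H$ be an oriented graph on $h$ vertices. Then $H$ is easy if and only if $V(H)$ can be partitioned into $2$ sets, each of which spans an acyclic directed graph in $H$.
   Context: An oriented graph is a directed graph with no loops in which between any two distinct vertices there is at most one edge. An $n$-vertex tournament $T$ is $\varepsilon$-far from being $H$-free if one must change the direction of at least $\varepsilon n^2$ edges of $T$ in order to obtain a tournament containing no copy of $H$ (a copy of $H$ is a subgraph of $T$ isomorphic to $H$, not necessarily induced). Let $f^*_H(\varepsilon)$ denote the largest quantity such that (for all sufficiently large $n$) every $n$-vertex tournament that is $\varepsilon$-far from being $H$-free contains at least $f^*_H(\varepsilon)n^h$ copies of $H$. $H$ is called easy if there is a constant $c=c(H)$ such that $f^*_H(\varepsilon)\ge \varepsilon^c$ for every sufficiently small $\varepsilon>0$; otherwise $H$ is hard. *)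

theory Defs
  imports Complex_Main "HOL-Library.Extended_Real"
begin

definition oriented_graph :: "'a set \<Rightarrow> ('a \<times> 'a) set \<Rightarrow> bool" where
  "oriented_graph V E \<longleftrightarrow> finite V \<and> E \<subseteq> V \<times> V \<and>
     (\<forall>v. (v, v) \<notin> E) \<and> (\<forall>u v. (u, v) \<in> E \<longrightarrow> (v, u) \<notin> E)"

definition tournament :: "nat \<Rightarrow> (nat \<times> nat) set \<Rightarrow> bool" where
  "tournament n T \<longleftrightarrow> T \<subseteq> {..<n} \<times> {..<n} \<and> (\<forall>v. (v, v) \<notin> T) \<and>
     (\<forall>u<n. \<forall>v<n. u \<noteq> v \<longrightarrow> ((u, v) \<in> T \<longleftrightarrow> (v, u) \<notin> T))"

definition embedding :: "'a set \<Rightarrow> ('a \<times> 'a) set \<Rightarrow> nat \<Rightarrow> (nat \<times> nat) set \<Rightarrow> ('a \<Rightarrow> nat) \<Rightarrow> bool" where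
  "embedding V E n T \<phi> \<longleftrightarrow> \<phi> ` V \<subseteq> {..<n} \<and> inj_on \<phi> V \<and>
     (\<forall>(u, v) \<in> E. (\<phi> u, \<phi> v) \<in> T)"

definition copies :: "'a set \<Rightarrow> ('a \<times> 'a) set \<Rightarrow> nat \<Rightarrow> (nat \<times> nat) set \<Rightarrow> (nat set \<times> (nat \<times> nat) set) set" where
  "copies V E n T = {(\<phi> ` V, (\<lambda>(u, v). (\<phi> u, \<phi> v)) ` E) | \<phi>. embedding V E n T \<phi>}"

definition num_copies :: "'a set \<Rightarrow> ('a \<times> 'a) set \<Rightarrow> nat \<Rightarrow> (nat \<times> nat) set \<Rightarrow> nat" where
  "num_copies V E n T = card (copies V E n T)"

definition H_free :: "'a set \<Rightarrow> ('a \<times> 'a) set \<Rightarrow> nat \<Rightarrow> (nat \<times> nat) set \<Rightarrow> bool" where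
  "H_free V E n T \<longleftrightarrow> copies V E n T = {}"

text \<open>Number of edges whose direction must be changed to turn T into T'.\<close>
definition tdist :: "(nat \<times> nat) set \<Rightarrow> (nat \<times> nat) set \<Rightarrow> nat" where
  "tdist T T' = card (T - T')"

definition eps_far :: "'a set \<Rightarrow> ('a \<times> 'a) set \<Rightarrow> real \<Rightarrow> nat \<Rightarrow> (nat \<times> nat) set \<Rightarrow> bool" where
  "eps_far V E \<epsilon> n T \<longleftrightarrow>
     (\<forall>T'. tournament n T' \<and> H_free V E n T' \<longrightarrow> real (tdist T T') \<ge> \<epsilon> * (real n)^2)"

definition admissible :: "'a set \<Rightarrow> ('a \<times> 'a) set \<Rightarrow> real \<Rightarrow> real \<Rightarrow> bool" where
  "admissible V E \<epsilon> f \<longleftrightarrow> (\<exists>N. \<forall>n\<ge>N. \<forall>T. tournament n T \<and> eps_far V E \<epsilon> n T \<longrightarrow>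
      real (num_copies V E n T) \<ge> f * (real n) ^ card V)"

definition fstar :: "'a set \<Rightarrow> ('a \<times> 'a) set \<Rightarrow> real \<Rightarrow> ereal" where
  "fstar V E \<epsilon> = Sup (ereal ` {f. admissible V E \<epsilon> f})"

definition easy :: "'a set \<Rightarrow> ('a \<times> 'a) set \<Rightarrow> bool" where
  "easy V E \<longleftrightarrow> (\<exists>c::real. \<exists>\<epsilon>0>0. \<forall>\<epsilon>. 0 < \<epsilon> \<and> \<epsilon> < \<epsilon>0 \<longrightarrow> fstar V E \<epsilon> \<ge> ereal (\<epsilon> powr c))"

definition induced_arcs :: "('a \<times> 'a) set \<Rightarrow> 'a set \<Rightarrow> ('a \<times> 'a) set" where
  "induced_arcs E A = E \<inter> (A \<times> A)"

end

theory Submission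
  imports Defs "HOL-Library.FuncSet"
begin

text \<open>If \<open>H\<close> is 2-colourable, a large shattered set of vertices of a tournament \<open>T\<close> yields a copy of \<open>H\<close>. Hence, if \<open>T\<close>
  contains few copies of \<open>H\<close>, a random sample has small VC dimension, and polynomially many vertices approximate
  all neighbourhoods. This gives a partition of \<open>T\<close>, and a much finer one, whose pairs of classes are homogeneous on
  average. Orienting each pair of classes like a pair of randomly chosen representatives, and each class transitively,
  changes few arcs; a copy of \<open>H\<close> in the result would produce many copies of \<open>H\<close> in \<open>T\<close>, inside the fine classes of the
  representatives.

  If \<open>H\<close> is not 2-colourable, the back arcs of every ordering of \<open>H\<close> form a non-bipartite graph. Choose an ordering whose
  back-arc graph is minimal in the homomorphism order. Flip, in a transitive tournament with one part for each
  vertex of \<open>H\<close>, the pairs that are back arcs in one of a dense family of almost disjoint copies of \<open>H\<close>, given by lines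
  \<open>(x, z) + \<lambda>\<^sub>v (y, |y|\<^sup>2)\<close>. By minimality every copy of \<open>H\<close> in the result runs through a cycle of the core, the positions
  along which satisfy a convex equation. So these positions are collinear, which makes the copies rare.\<close>


section \<open>Copies, tournaments and shattering\<close>

text \<open>The obstacle to easiness is quantitative: general regularity partitions would cost
  tower-type bounds. Small VC dimension keeps every net of size polynomial in \<open>N\<close>,
  where \<open>N\<close> has order 1/\<epsilon>. Two scales are needed since sampling
  \<open>2 ^ h\<close> vertices from each of several classes requires all relevant pairs of pieces
  to be nearly homogeneous at once, and the coarse scale gives this only on average. With
  \<open>M\<close> a fixed power of \<open>N\<close>, the expected number of bad pairs of
  representatives drops below 1, while each fine piece still has polynomial density.

  For hardness, the dimension \<open>D\<close> decouples two quantities: for fixed \<open>D\<close>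
  the tournament is \<epsilon>-far with \<epsilon> of order 1/Q^2, whereas copies have density of
  order at most 1/Q^D, so a suitable \<open>D\<close> defeats any exponent. The additional
  coordinate |y|^2 on each line plays the role of a Behrend set: it accompanies a linear relation
  between directions by its quadratic counterpart. Minimality of the ordering is needed because a
  copy of \<open>H\<close> may sit in the tournament in any order; only a map back from the chosen
  back-arc graph makes it meet a prescribed cycle.\<close>

definition embeddings :: "'a set \<Rightarrow> ('a \<times> 'a) set \<Rightarrow> nat \<Rightarrow> (nat \<times> nat) set \<Rightarrow> ('a \<Rightarrow> nat) set" where
  "embeddings V E n T = {\<phi> \<in> V \<rightarrow>\<^sub>E {..<n}. embedding V E n T \<phi>}"

lemma finite_embeddings: "finite V \<Longrightarrow> finite (embeddings V E n T)"
  unfolding embeddings_def by (simp add: finite_PiE)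

lemma embedding_cong:
  assumes "E \<subseteq> V \<times> V" "\<And>v. v \<in> V \<Longrightarrow> \<phi> v = \<psi> v"
  shows "embedding V E n T \<phi> \<longleftrightarrow> embedding V E n T \<psi>"
proof -
  have "\<phi> ` V = \<psi> ` V" "inj_on \<phi> V \<longleftrightarrow> inj_on \<psi> V"
    using assms(2) by (auto simp: inj_on_def)
  moreover have "(\<forall>(u, v) \<in> E. (\<phi> u, \<phi> v) \<in> T) \<longleftrightarrow> (\<forall>(u, v) \<in> E. (\<psi> u, \<psi> v) \<in> T)"
    using assms by (intro ball_cong refl) (auto split: prod.splits)
  ultimately show ?thesis unfolding embedding_def by simp
qed

lemma restrict_mem_embeddings:
  assumes "E \<subseteq> V \<times> V" "embedding V E n T \<phi>"
  shows "restrict \<phi> V \<in> embeddings V E n T"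
proof -
  have "embedding V E n T (restrict \<phi> V)"
    using assms by (subst embedding_cong[of E V _ \<phi>]) auto
  then show ?thesis using assms(2) by (auto simp: embeddings_def embedding_def)
qed

lemma copies_eq_image_embeddings:
  assumes "E \<subseteq> V \<times> V"
  shows "copies V E n T = (\<lambda>\<phi>. (\<phi> ` V, (\<lambda>(u, v). (\<phi> u, \<phi> v)) ` E)) ` embeddings V E n T" (is "_ = ?F ` _")
proof
  show "copies V E n T \<subseteq> ?F ` embeddings V E n T"
  proof
    fix c assume "c \<in> copies V E n T"
    then obtain \<phi> where c: "c = ?F \<phi>" and e: "embedding V E n T \<phi>" unfolding copies_def by auto
    have "(\<lambda>(u, v). (restrict \<phi> V u, restrict \<phi> V v)) ` E = (\<lambda>(u, v). (\<phi> u, \<phi> v)) ` E"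
      using assms by (intro image_cong refl) auto
    then have "c = ?F (restrict \<phi> V)" using c by simp
    then show "c \<in> ?F ` embeddings V E n T" using restrict_mem_embeddings[OF assms e] by (rule image_eqI)
  qed
qed (auto simp: copies_def embeddings_def)

lemma H_free_iff: "H_free V E n T \<longleftrightarrow> (\<nexists>\<phi>. embedding V E n T \<phi>)"
  unfolding H_free_def copies_def by auto

lemma num_copies_le_card_embeddings:
  assumes "finite V" "E \<subseteq> V \<times> V"
  shows "num_copies V E n T \<le> card (embeddings V E n T)"
  unfolding num_copies_def copies_eq_image_embeddings[OF assms(2)]
  by (rule card_image_le) (rule finite_embeddings[OF assms(1)])

text \<open>A copy fixes the image of \<open>V\<close>, and at most h^h maps send \<open>V\<close>
  into a given set of \<open>h = card V\<close> points. A factor depending on \<open>H\<close> only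
  is harmless for easiness.\<close>

lemma card_embeddings_le_num_copies:
  assumes "finite V" "E \<subseteq> V \<times> V"
  shows "card (embeddings V E n T) \<le> card V ^ card V * num_copies V E n T"
proof -
  have fc: "finite (copies V E n T)"
    using assms by (simp add: copies_eq_image_embeddings finite_embeddings)
  have "card {\<phi> \<in> embeddings V E n T. \<phi> ` V = fst c} \<le> card V ^ card V" if "c \<in> copies V E n T" for c
  proof -
    have cc: "finite (fst c)" "card (fst c) = card V"
      using that assms by (auto simp: copies_def embedding_def card_image)
    have "card {\<phi> \<in> embeddings V E n T. \<phi> ` V = fst c} \<le> card (V \<rightarrow>\<^sub>E fst c)"
      using assms cc by (intro card_mono finite_PiE) (auto simp: embeddings_def)
    also have "\<dots> = card V ^ card V" using assms cc by (simp add: card_PiE)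
    finally show ?thesis .
  qed
  moreover have "embeddings V E n T \<subseteq> (\<Union>c\<in>copies V E n T. {\<phi> \<in> embeddings V E n T. \<phi> ` V = fst c})"
    using assms by (auto simp: copies_eq_image_embeddings)
  then have "card (embeddings V E n T) \<le> (\<Sum>c\<in>copies V E n T. card {\<phi> \<in> embeddings V E n T. \<phi> ` V = fst c})"
    using assms by (intro order.trans[OF card_mono card_UN_le] fc) (auto simp: finite_embeddings fc)
  ultimately show ?thesis
    using sum_bounded_above[of "copies V E n T" _ "card V ^ card V"] unfolding num_copies_def
    by (smt (verit, best) mult.commute of_nat_id order.trans)
qed

section \<open>Transitive subtournaments and rankings of finite sets\<close>

lemma tournament_finite: "tournament n T \<Longrightarrow> finite T"
  unfolding tournament_def by (meson finite_SigmaI finite_lessThan finite_subset)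

lemma tournament_total: "tournament n T \<Longrightarrow> u < n \<Longrightarrow> v < n \<Longrightarrow> u \<noteq> v \<Longrightarrow> (u, v) \<in> T \<longleftrightarrow> (v, u) \<notin> T"
  unfolding tournament_def by blast

lemma tournament_irrefl: "tournament n T \<Longrightarrow> (u, u) \<notin> T"
  unfolding tournament_def by blast

text \<open>One of the two neighbourhoods of any vertex of \<open>S\<close> contains at least half
  of the other vertices. The induction continues inside it, and the vertex is put in front of a
  chain of out-neighbours or behind a chain of in-neighbours.\<close>

lemma transitive_subtournament:
  assumes T: "tournament n T" and "finite S" "S \<subseteq> {..<n}" "2 ^ h \<le> card S"
  shows "\<exists>xs. length xs = h \<and> set xs \<subseteq> S \<and> sorted_wrt (\<lambda>u v. (u, v) \<in> T) xs"
  using assms(2-)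
proof (induction h arbitrary: S)
  case 0
  then show ?case by simp
next
  case (Suc h)
  then have "S \<noteq> {}" by auto
  then obtain a where a: "a \<in> S" by blast
  define O1 where "O1 = {v \<in> S. (a, v) \<in> T}"
  define I1 where "I1 = {v \<in> S. (v, a) \<in> T}"
  have fin: "finite O1" "finite I1" using Suc.prems by (auto simp: O1_def I1_def)
  have "S = insert a (O1 \<union> I1)"
    using a Suc.prems(2) tournament_total[OF T] by (auto simp: O1_def I1_def)
  then have "card S \<le> Suc (card O1 + card I1)"
    using card_insert_le_m1[of "Suc (card (O1 \<union> I1))" "O1 \<union> I1" a] card_Un_le[of O1 I1] by simp
  moreover have "O1 \<inter> I1 = {}" 
    using a Suc.prems(2) T unfolding tournament_def O1_def I1_def by blast
  moreover have "(2::nat) ^ h \<ge> 1" by simp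
  ultimately consider "2 ^ h \<le> card O1" | "2 ^ h \<le> card I1"
    using Suc.prems(3) by (simp add: not_le) linarith
  then show ?case
  proof cases
    case 1
    then obtain xs where "length xs = h" "set xs \<subseteq> O1" "sorted_wrt (\<lambda>u v. (u, v) \<in> T) xs"
      using Suc.IH[OF fin(1)] Suc.prems by (auto simp: O1_def)
    then show ?thesis using a by (intro exI[of _ "a # xs"]) (auto simp: O1_def)
  next
    case 2
    then obtain xs where "length xs = h" "set xs \<subseteq> I1" "sorted_wrt (\<lambda>u v. (u, v) \<in> T) xs"
      using Suc.IH[OF fin(2)] Suc.prems by (auto simp: I1_def)
    then show ?thesis using a by (intro exI[of _ "xs @ [a]"]) (auto simp: I1_def sorted_wrt_append)
  qed
qed

lemma sorted_wrt_tournament_distinct: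
  assumes "tournament n T" "sorted_wrt (\<lambda>u v. (u, v) \<in> T) xs"
  shows "distinct xs"
  using assms(2) by (induction xs) (auto simp: tournament_irrefl[OF assms(1)])

definition rank_in :: "'a set \<Rightarrow> ('a \<Rightarrow> nat) \<Rightarrow> 'a \<Rightarrow> nat" where
  "rank_in A f v = card {u \<in> A. f u < f v}"

lemma rank_in_less_card: "finite A \<Longrightarrow> v \<in> A \<Longrightarrow> rank_in A f v < card A"
  unfolding rank_in_def by (rule psubset_card_mono) auto

lemma rank_in_strict_mono: "finite A \<Longrightarrow> u \<in> A \<Longrightarrow> f u < f v \<Longrightarrow> rank_in A f u < rank_in A f v"
  unfolding rank_in_def by (rule psubset_card_mono) auto

lemma rank_in_less_iff:
  assumes "finite A" "u \<in> A" "v \<in> A" "inj_on f A"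
  shows "rank_in A f u < rank_in A f v \<longleftrightarrow> f u < f v"
  using rank_in_strict_mono[OF assms(1), of u f v] rank_in_strict_mono[OF assms(1), of v f u] assms
  by (metis inj_onD less_asym linorder_neqE_nat nat_neq_iff)

lemma inj_on_rank_in:
  assumes "finite A" "inj_on f A"
  shows "inj_on (rank_in A f) A"
  using rank_in_less_iff[OF assms(1) _ _ assms(2)] by (metis inj_onI assms(2) inj_onD less_irrefl linorder_neqE_nat)

lemma bij_betw_rank_in:
  assumes "finite A" "inj_on f A"
  shows "bij_betw (rank_in A f) A {..<card A}"
proof -
  have "rank_in A f ` A = {..<card A}"
    using rank_in_less_card[OF assms(1)] inj_on_rank_in[OF assms]
    by (intro card_subset_eq) (auto simp: card_image)
  then show ?thesis using inj_on_rank_in[OF assms] by (simp add: bij_betw_def)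
qed

text \<open>The number of strict ancestors grows along every arc but may tie. Scaling it by
  \<open>card A\<close> leaves room for the tie-breaking enumeration \<open>e\<close>; passing to
  ranks brings the values back below \<open>card A\<close>.\<close>

lemma acyclic_imp_rank:
  assumes "finite A" "acyclic R" "R \<subseteq> A \<times> A"
  shows "\<exists>r::'a \<Rightarrow> nat. inj_on r A \<and> (\<forall>v\<in>A. r v < card A) \<and> (\<forall>(u, v)\<in>R. r u < r v)"
proof -
  obtain e :: "'a \<Rightarrow> nat" where e: "bij_betw e A {0..<card A}"
    using ex_bij_betw_finite_nat[OF assms(1)] by blast
  define d where "d v = card {u. (u, v) \<in> R\<^sup>+}" for v
  have sub: "{u. (u, v) \<in> R\<^sup>+} \<subseteq> A" for v
    using assms(3) by (auto dest: trancl_subset_Sigma[THEN subsetD, rotated])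
  have d: "d u < d v" if "(u, v) \<in> R" for u v
    unfolding d_def
  proof (rule psubset_card_mono)
    show "finite {u. (u, v) \<in> R\<^sup>+}" using sub assms(1) finite_subset by blast
    have "(u, u) \<notin> R\<^sup>+" using assms(2) by (simp add: acyclic_def)
    then show "{w. (w, u) \<in> R\<^sup>+} \<subset> {u. (u, v) \<in> R\<^sup>+}" using that by (auto intro: trancl_into_trancl)
  qed
  define f where "f v = d v * card A + e v" for v
  have el: "e v < card A" if "v \<in> A" for v using e that by (auto simp: bij_betw_def)
  have "inj_on f A"
  proof (rule inj_onI)
    fix x y assume xy: "x \<in> A" "y \<in> A" "f x = f y"
    have "e x = f x mod card A" "e y = f y mod card A" using el[of x] el[of y] xy(1,2) by (simp_all add: f_def)
    then have "e x = e y" using xy(3) by simp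
    then show "x = y" using xy e by (auto simp: bij_betw_def inj_on_def)
  qed
  moreover have "f u < f v" if "(u, v) \<in> R" for u v
  proof -
    have "f u < (d u + 1) * card A" using el[of u] that assms(3) by (auto simp: f_def)
    also have "\<dots> \<le> d v * card A" using d[OF that] by (intro mult_right_mono) auto
    finally show ?thesis by (simp add: f_def)
  qed
  ultimately show ?thesis
    using assms rank_in_less_card[OF assms(1)] inj_on_rank_in[OF assms(1)] rank_in_strict_mono[OF assms(1)]
    by (intro exI[of _ "rank_in A f"]) fastforce
qed

section \<open>Shattering and the Sauer-Shelah bound\<close>

definition shatters :: "'b set set \<Rightarrow> 'b set \<Rightarrow> bool" where
  "shatters F S \<longleftrightarrow> (\<forall>P\<subseteq>S. \<exists>X\<in>F. X \<inter> S = P)"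

text \<open>Pajor's strengthening of the Sauer-Shelah lemma.\<close>
lemma card_le_card_shattered:
  assumes "finite Q" "F \<subseteq> Pow Q"
  shows "card F \<le> card {S. S \<subseteq> Q \<and> shatters F S}"
  using assms
proof (induction Q arbitrary: F rule: finite_induct)
  case empty
  show ?case
  proof (cases "F = {}")
    case False
    then have "F = {{}}" using empty by auto
    then have "{S. S \<subseteq> {} \<and> shatters F S} = {{}}" by (auto simp: shatters_def)
    then show ?thesis using \<open>F = {{}}\<close> by simp
  qed simp
next
  case (insert q Q)
  \<comment> \<open>\<open>F0\<close> is the trace of \<open>F\<close> on \<open>Q\<close>, and
    \<open>F1\<close> consists of the traces that come from two members of \<open>F\<close>. A set
    shattered by \<open>F1\<close> remains shattered by \<open>F\<close> after \<open>q\<close> is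
    added, which yields a second family of shattered sets, disjoint from those of
    \<open>F0\<close>.\<close>
  define F0 where "F0 = (\<lambda>X. X - {q}) ` F"
  define F1 where "F1 = {X \<in> F. q \<notin> X \<and> insert q X \<in> F}"
  define Sh where "Sh G = {S. S \<subseteq> Q \<and> shatters G S}" for G
  have finF: "finite F" using insert.prems insert.hyps(1) by (meson finite_Pow_iff finite_insert finite_subset)
  have finSh: "finite (Sh G)" for G unfolding Sh_def using insert.hyps(1) by (auto intro: finite_subset[of _ "Pow Q"])
  have F01: "card F = card F0 + card F1"
  proof -
    define A where "A = {X \<in> F. q \<in> X}"
    define B where "B = {X \<in> F. q \<notin> X}"
    have "card F = card A + card B"
      unfolding A_def B_def using finF by (subst card_Un_disjoint[symmetric]) (auto intro: arg_cong[of _ _ card])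
    moreover have "card ((\<lambda>X. X - {q}) ` A) = card A"
      by (intro card_image inj_onI) (auto simp: A_def)
    moreover have "F0 = (\<lambda>X. X - {q}) ` A \<union> B" 
    proof -
      have "F = A \<union> B" by (auto simp: A_def B_def)
      moreover have "(\<lambda>X. X - {q}) ` B = B" by (force simp: B_def)
      ultimately show ?thesis by (simp only: F0_def image_Un)
    qed
    moreover have "F1 = (\<lambda>X. X - {q}) ` A \<inter> B"
    proof (intro set_eqI iffI)
      fix X assume "X \<in> F1"
      then have "X = insert q X - {q}" "insert q X \<in> A" "X \<in> B" by (auto simp: F1_def A_def B_def)
      then show "X \<in> (\<lambda>X. X - {q}) ` A \<inter> B" by blast
    next
      fix X assume "X \<in> (\<lambda>X. X - {q}) ` A \<inter> B"
      then obtain Y where "Y \<in> A" "X = Y - {q}" "X \<in> B" by auto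
      then show "X \<in> F1" by (auto simp: F1_def A_def B_def insert_absorb)
    qed
    ultimately show ?thesis
      using card_Un_Int[of "(\<lambda>X. X - {q}) ` A" B] finF by (simp add: A_def B_def)
  qed
  have "card F0 \<le> card (Sh F0)" "card F1 \<le> card (Sh F1)"
    unfolding Sh_def using insert.prems by (auto intro!: insert.IH simp: F0_def F1_def)
  moreover have "card (insert q ` Sh F1) = card (Sh F1)"
    using insert.hyps(2) by (intro card_image inj_onI) (auto simp: Sh_def)
  moreover have "Sh F0 \<inter> insert q ` Sh F1 = {}" using insert.hyps(2) by (auto simp: Sh_def)
  moreover have "Sh F0 \<union> insert q ` Sh F1 \<subseteq> {S. S \<subseteq> insert q Q \<and> shatters F S}"
  proof (intro subsetI, elim UnE)
    fix S assume S: "S \<in> Sh F0"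
    have "\<exists>X\<in>F. X \<inter> S = P" if "P \<subseteq> S" for P
    proof -
      from that S obtain Y where "Y \<in> F0" "Y \<inter> S = P" unfolding Sh_def shatters_def by blast
      then obtain X where "X \<in> F" "(X - {q}) \<inter> S = P" unfolding F0_def by blast
      moreover have "q \<notin> S" using S insert.hyps(2) by (auto simp: Sh_def)
      ultimately show ?thesis by (intro bexI[of _ X]) auto
    qed
    then have "shatters F S" unfolding shatters_def by blast
    then show "S \<in> {S. S \<subseteq> insert q Q \<and> shatters F S}" using S unfolding Sh_def by blast
  next
    fix S' assume "S' \<in> insert q ` Sh F1"
    then obtain S where S: "S \<in> Sh F1" "S' = insert q S" by blast
    have "\<exists>X\<in>F. X \<inter> S' = P" if P: "P \<subseteq> S'" for P
    proof -
      from S P have "P - {q} \<subseteq> S" by auto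
      then obtain X where X: "X \<in> F1" "X \<inter> S = P - {q}" using S(1) unfolding Sh_def shatters_def by blast
      show ?thesis
      proof (cases "q \<in> P")
        case True
        then show ?thesis using X S(2) by (intro bexI[of _ "insert q X"]) (auto simp: F1_def)
      next
        case False
        then show ?thesis using X S(2) by (intro bexI[of _ X]) (auto simp: F1_def)
      qed
    qed
    then have "shatters F S'" unfolding shatters_def by blast
    then show "S' \<in> {S. S \<subseteq> insert q Q \<and> shatters F S}" using S unfolding Sh_def by blast
  qed
  moreover have "finite {S. S \<subseteq> insert q Q \<and> shatters F S}"
    using insert.hyps(1) by (auto intro: finite_subset[of _ "Pow (insert q Q)"])
  ultimately show ?case
    using F01 card_mono[of "{S. S \<subseteq> insert q Q \<and> shatters F S}" "Sh F0 \<union> insert q ` Sh F1"]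
      card_Un_disjoint[of "Sh F0" "insert q ` Sh F1"] finSh by simp
qed

lemma card_small_subsets_le:
  assumes "finite Q"
  shows "card {S. S \<subseteq> Q \<and> card S \<le> K} \<le> (card Q + 1) ^ K"
proof -
  define G where "G = {..<K} \<rightarrow>\<^sub>E insert None (Some ` Q)"
  have fG: "finite G" unfolding G_def using assms by (intro finite_PiE) auto
  have "{S. S \<subseteq> Q \<and> card S \<le> K} \<subseteq> (\<lambda>f. {x. Some x \<in> f ` {..<K}}) ` G"
  proof
    fix S assume S: "S \<in> {S. S \<subseteq> Q \<and> card S \<le> K}"
    then have "finite S" using assms finite_subset by blast
    then obtain e where e: "bij_betw e {0..<card S} S" using ex_bij_betw_nat_finite by blast
    define f where "f = (\<lambda>i\<in>{..<K}. if i < card S then Some (e i) else None)"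
    have eS: "e i \<in> S" if "i < card S" for i using e that by (auto simp: bij_betw_def)
    have "f \<in> G" unfolding f_def G_def using S eS by (auto simp: subset_iff)
    moreover have "{x. Some x \<in> f ` {..<K}} = S"
    proof -
      have "x \<in> S" if "Some x = f i" "i < K" for x i
        using that eS by (auto simp: f_def split: if_splits)
      moreover have "\<exists>i<K. Some x = f i" if "x \<in> S" for x
      proof -
        from e have "e ` {0..<card S} = S" by (simp add: bij_betw_def)
        with that obtain i where "i < card S" "e i = x" by (metis atLeastLessThan_iff imageE)
        then show ?thesis using S by (intro exI[of _ i]) (auto simp: f_def)
      qed
      ultimately show ?thesis by (auto simp: image_iff Bex_def)
    qed
    ultimately show "S \<in> (\<lambda>f. {x. Some x \<in> f ` {..<K}}) ` G" by force
  qed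
  then have "card {S. S \<subseteq> Q \<and> card S \<le> K} \<le> card G"
    using fG by (meson card_image_le card_mono finite_imageI le_trans)
  also have "\<dots> = (card Q + 1) ^ K"
    using assms by (simp add: G_def card_PiE card_image)
  finally show ?thesis .
qed

text \<open>The crude count of small sets is good enough: what matters later is that the bound is
  polynomial in \<open>card Q\<close> for fixed \<open>K\<close>.\<close>

lemma Sauer_Shelah_weak:
  assumes "finite Q" "F \<subseteq> Pow Q" "(card Q + 1) ^ K < card F"
  shows "\<exists>S\<subseteq>Q. K < card S \<and> shatters F S"
proof (rule ccontr)
  assume "\<not> ?thesis"
  then have "{S. S \<subseteq> Q \<and> shatters F S} \<subseteq> {S. S \<subseteq> Q \<and> card S \<le> K}" by (auto simp: not_less intro: leI)
  then have "card {S. S \<subseteq> Q \<and> shatters F S} \<le> (card Q + 1) ^ K"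
    using assms(1) by (intro order.trans[OF card_mono card_small_subsets_le[OF assms(1), of K]]) auto
  then show False using card_le_card_shattered[OF assms(1,2)] assms(3) by simp
qed

definition out_nbrs :: "(nat \<times> nat) set \<Rightarrow> nat \<Rightarrow> nat set" where
  "out_nbrs T v = {w. (v, w) \<in> T}"

text \<open>If \<open>A \<union> B\<close> is a 2-colouring, the part \<open>B\<close> is placed on a transitive chain inside the shattered
  set \<open>C\<close>; the chain consists of \<open>h\<close> rounds, each of which contains, for every subset \<open>P\<close> of \<open>M\<close> witness
  vertices, a vertex dominated exactly by \<open>P\<close>. This allows prescribing the order of both parts independently of the
  arcs between them.\<close>
lemma shattered_imp_embedding:
  fixes V :: "'a set"
  assumes T: "tournament n T" and H: "oriented_graph V E"
    and AB: "A \<union> B = V" "A \<inter> B = {}" "acyclic (induced_arcs E A)" "acyclic (induced_arcs E B)"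
    and C: "C \<subseteq> {..<n}" "D \<subseteq> {..<n}" "shatters (out_nbrs T ` D) C"
    and K: "L = card V * 2 ^ (2 ^ card V)" "2 ^ L + L \<le> card C"
  shows "\<exists>\<phi>. embedding V E n T \<phi> \<and> \<phi> ` V \<subseteq> C \<union> D"
proof -
  define h where "h = card V"
  \<comment> \<open>Only a transitive set of \<open>h\<close> witnesses will carry \<open>A\<close>,
    and 2^h witnesses guarantee one. Which ones these are is decided after the chain has been fixed,
    so the chain has to anticipate every subset of all \<open>M\<close> witnesses.\<close>
  define M :: nat where "M = 2 ^ h"
  have finV: "finite V" "finite A" "finite B" using H AB by (auto simp: oriented_graph_def)
  have finC: "finite C" using C(1) finite_subset by blast
  have cAB: "card A \<le> h" "card B \<le> h" unfolding h_def using AB finV by (auto intro: card_mono)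
  obtain rA :: "'a \<Rightarrow> nat" where rA: "inj_on rA A" "\<And>v. v \<in> A \<Longrightarrow> rA v < h"
      "\<And>u v. (u, v) \<in> E \<Longrightarrow> u \<in> A \<Longrightarrow> v \<in> A \<Longrightarrow> rA u < rA v"
    using acyclic_imp_rank[OF finV(2) AB(3)] cAB(1) unfolding induced_arcs_def by fastforce
  obtain rB :: "'a \<Rightarrow> nat" where rB: "inj_on rB B" "\<And>v. v \<in> B \<Longrightarrow> rB v < h"
      "\<And>u v. (u, v) \<in> E \<Longrightarrow> u \<in> B \<Longrightarrow> v \<in> B \<Longrightarrow> rB u < rB v"
    using acyclic_imp_rank[OF finV(3) AB(4)] cAB(2) unfolding induced_arcs_def by fastforce
  have L: "L = h * 2 ^ M" using K by (simp add: h_def M_def)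
  obtain cs where cs: "length cs = L" "set cs \<subseteq> C" "sorted_wrt (\<lambda>u v. (u, v) \<in> T) cs"
    using transitive_subtournament[OF T finC C(1), of L] K(2) by auto
  have dcs: "distinct cs" using sorted_wrt_tournament_distinct[OF T cs(3)] .
  obtain e :: "nat set \<Rightarrow> nat" where e: "bij_betw e (Pow {..<M}) {0..<2 ^ M}"
    using ex_bij_betw_finite_nat[of "Pow {..<M}"] by (auto simp: card_Pow)
  define pos where "pos j P = j * 2 ^ M + e P" for j P
  have eP: "e P < 2 ^ M" if "P \<subseteq> {..<M}" for P using e that by (auto simp: bij_betw_def)
  have pos_less: "pos j P < L" if "j < h" "P \<subseteq> {..<M}" for j P
  proof -
    have "pos j P < (j + 1) * 2 ^ M" using eP[OF that(2)] by (simp add: pos_def)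
    also have "\<dots> \<le> L" unfolding L using that(1) by (intro mult_right_mono) auto
    finally show ?thesis .
  qed
  have pos_mono: "pos j P < pos j' P'" if "j < j'" "P \<subseteq> {..<M}" for j P j' P'
  proof -
    have "pos j P < (j + 1) * 2 ^ M" using eP[OF that(2)] by (simp add: pos_def)
    also have "\<dots> \<le> j' * 2 ^ M" using that(1) by (intro mult_right_mono) auto
    finally show ?thesis by (simp add: pos_def)
  qed
  have pos_inj: "P = P'" if "pos j P = pos j' P'" "P \<subseteq> {..<M}" "P' \<subseteq> {..<M}" for j j' P P'
  proof -
    have "e P = pos j P mod 2 ^ M" "e P' = pos j' P' mod 2 ^ M" 
      using eP[OF that(2)] eP[OF that(3)] by (simp_all add: pos_def)
    then show ?thesis using that e by (auto simp: bij_betw_def inj_on_def)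
  qed
  have csn: "cs ! pos j P \<in> set cs" if "j < h" "P \<subseteq> {..<M}" for j P
    using pos_less[OF that] cs(1) by simp
  define R where "R i = {cs ! pos j P | j P. j < h \<and> P \<subseteq> {..<M} \<and> i \<in> P}" for i
  have R_iff: "cs ! pos j P \<in> R i \<longleftrightarrow> i \<in> P" if "j < h" "P \<subseteq> {..<M}" for i j P
  proof
    assume "cs ! pos j P \<in> R i"
    then obtain j' P' where jP: "cs ! pos j P = cs ! pos j' P'" "j' < h" "P' \<subseteq> {..<M}" "i \<in> P'"
      unfolding R_def by blast
    then have "pos j P = pos j' P'"
      using nth_eq_iff_index_eq[OF dcs] pos_less that cs(1) by metis
    then show "i \<in> P" using pos_inj that jP by metis
  next
    assume "i \<in> P"
    then show "cs ! pos j P \<in> R i" unfolding R_def using that by blast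
  qed
  \<comment> \<open>A vertex of \<open>D\<close> with the right trace on the chain might itself lie
    on the chain. Each of the 2^|U| ways of continuing the trace to \<open>U = C - set cs\<close> is
    realised by a different vertex, and there are more than \<open>L\<close> of them, so one avoids
    the chain.\<close>
  have ex: "\<exists>x\<in>D. x \<notin> set cs \<and> out_nbrs T x \<inter> set cs = R i \<inter> set cs" for i
  proof -
    have "R i \<subseteq> set cs" unfolding R_def using csn by blast
    define U where "U = C - set cs"
    have "\<exists>x. \<forall>Q\<in>Pow U. x Q \<in> D \<and> out_nbrs T (x Q) \<inter> C = R i \<union> Q"
    proof (intro bchoice ballI)
      fix Q assume "Q \<in> Pow U"
      then have "R i \<union> Q \<subseteq> C" using \<open>R i \<subseteq> set cs\<close> cs(2) by (auto simp: U_def)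
      then show "\<exists>x. x \<in> D \<and> out_nbrs T x \<inter> C = R i \<union> Q" using C(3) unfolding shatters_def by blast
    qed
    then obtain x where x: "\<And>Q. Q \<subseteq> U \<Longrightarrow> x Q \<in> D" "\<And>Q. Q \<subseteq> U \<Longrightarrow> out_nbrs T (x Q) \<inter> C = R i \<union> Q" by auto
    have "inj_on x (Pow U)"
    proof (rule inj_onI)
      fix Q Q' assume Q: "Q \<in> Pow U" "Q' \<in> Pow U" "x Q = x Q'"
      then have "R i \<union> Q = R i \<union> Q'" using x(2) by (metis PowD)
      moreover have "R i \<inter> U = {}" using \<open>R i \<subseteq> set cs\<close> by (auto simp: U_def)
      ultimately show "Q = Q'" using Q by blast
    qed
    then have "card (x ` Pow U) = 2 ^ card U" using finC by (simp add: card_image card_Pow U_def)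
    moreover have "card U = card C - L" unfolding U_def using cs dcs finC by (simp add: card_Diff_subset distinct_card)
    then have "L \<le> card U" using K(2) less_exp[of L] by linarith
    then have "L < 2 ^ card U" using less_exp[of "card U"] by linarith
    ultimately have "card (set cs) < card (x ` Pow U)" using dcs cs(1) by (simp add: distinct_card)
    then have "\<not> x ` Pow U \<subseteq> set cs" by (meson List.finite_set card_mono not_le)
    then obtain Q where Q: "Q \<subseteq> U" "x Q \<notin> set cs" by blast
    have "out_nbrs T (x Q) \<inter> set cs = out_nbrs T (x Q) \<inter> C \<inter> set cs" using cs(2) by blast
    also have "\<dots> = R i \<inter> set cs" using x(2)[OF Q(1)] Q(1) by (auto simp: U_def)
    finally show ?thesis using x(1)[OF Q(1)] Q(2) by blast
  qed
  then obtain x where x: "\<And>i. x i \<in> D" "\<And>i. x i \<notin> set cs" "\<And>i. out_nbrs T (x i) \<inter> set cs = R i \<inter> set cs"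
    by metis
  have x_arc: "(x i, cs ! pos j P) \<in> T \<longleftrightarrow> i \<in> P" if "j < h" "P \<subseteq> {..<M}" for i j P
    using x(3)[of i] R_iff[OF that] csn[OF that] unfolding out_nbrs_def by blast
  show ?thesis
  proof (cases "h = 0")
    case True
    then have "V = {}" using finV by (simp add: h_def)
    moreover have "E = {}" using H \<open>V = {}\<close> by (auto simp: oriented_graph_def)
    ultimately show ?thesis by (auto simp: embedding_def)
  next
    case False
    have "inj_on x {..<M}"
    proof (rule inj_onI)
      fix i i' assume i: "i \<in> {..<M}" "i' \<in> {..<M}" "x i = x i'"
      have "(x i, cs ! pos 0 {i}) \<in> T" "(x i', cs ! pos 0 {i}) \<in> T \<longleftrightarrow> i' \<in> {i}"
        using x_arc[of 0 "{i}" i] x_arc[of 0 "{i}" i'] False i(1) by simp_all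
      then show "i = i'" unfolding i(3) by blast
    qed
    then have "card (x ` {..<M}) = M" using card_image by fastforce
    then have "2 ^ h \<le> card (x ` {..<M})" unfolding M_def by simp
    then obtain ys where ys: "length ys = h" "set ys \<subseteq> x ` {..<M}" "sorted_wrt (\<lambda>u v. (u, v) \<in> T) ys"
      using transitive_subtournament[OF T _ _ \<open>2 ^ h \<le> card (x ` {..<M})\<close>] x(1) C(2) by blast
    have dys: "distinct ys" using sorted_wrt_tournament_distinct[OF T ys(3)] .
    have "\<exists>a. \<forall>k\<in>{..<h}. a k \<in> {..<M} \<and> ys ! k = x (a k)"
      using ys(1,2) by (intro bchoice ballI) (metis imageE lessThan_iff nth_mem subsetD)
    then obtain a where a: "\<And>k. k < h \<Longrightarrow> a k < M" "\<And>k. k < h \<Longrightarrow> ys ! k = x (a k)" by auto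
    \<comment> \<open>\<open>P w\<close> lists the witnesses that have to dominate the image of
      \<open>w\<close>. Together with the round \<open>rB w\<close> it selects a slot of the chain;
      rounds follow each other in the chain, so arcs inside \<open>B\<close> are correct whatever
      the sets \<open>P w\<close> are.\<close>
    define P where "P w = {a (rA v) | v. v \<in> A \<and> (v, w) \<in> E}" for w
    have PM: "P w \<subseteq> {..<M}" for w unfolding P_def using a(1) rA(2) by blast
    define \<phi> where "\<phi> v = (if v \<in> A then ys ! rA v else cs ! pos (rB v) (P v))" for v
    have a_inj: "k = k'" if "a k = a k'" "k < h" "k' < h" for k k'
      using that a(2) ys(1) dys by (metis nth_eq_iff_index_eq)
    have aP: "a (rA v) \<in> P w \<longleftrightarrow> (v, w) \<in> E" if "v \<in> A" for v w
    proof
      assume "a (rA v) \<in> P w"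
      then obtain v' where v': "a (rA v) = a (rA v')" "v' \<in> A" "(v', w) \<in> E" unfolding P_def by blast
      then have "rA v = rA v'" using a_inj rA(2) that by blast
      then show "(v, w) \<in> E" using v' that rA(1) by (metis inj_onD)
    next
      assume "(v, w) \<in> E"
      then show "a (rA v) \<in> P w" unfolding P_def using that by blast
    qed
    have phiA: "\<phi> v = x (a (rA v))" if "v \<in> A" for v using that a(2) rA(2) by (simp add: \<phi>_def)
    have phiB: "\<phi> v = cs ! pos (rB v) (P v)" "\<phi> v \<in> set cs" if "v \<in> B" for v
      using that AB(2) csn[OF rB(2)[OF that] PM] by (auto simp: \<phi>_def)
    have AB_arc: "(\<phi> v, \<phi> w) \<in> T \<longleftrightarrow> (v, w) \<in> E" if "v \<in> A" "w \<in> B" for v w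
      using x_arc[OF rB(2)[OF that(2)] PM] aP[OF that(1)] phiA[OF that(1)] phiB(1)[OF that(2)] by simp
    have rng: "\<phi> v \<in> C \<union> D" if "v \<in> V" for v
      using that phiA phiB x(1) cs(2) AB(1) by (cases "v \<in> A") auto
    have ltn: "\<phi> v < n" if "v \<in> V" for v using rng[OF that] C by auto
    have ne: "\<phi> v \<noteq> \<phi> w" if "v \<in> A" "w \<in> B" for v w
      using phiA[OF that(1)] phiB(2)[OF that(2)] x(2) by metis
    have "inj_on \<phi> V"
    proof (rule inj_onI)
      fix v w assume vw: "v \<in> V" "w \<in> V" "\<phi> v = \<phi> w"
      consider "v \<in> A" "w \<in> A" | "v \<in> B" "w \<in> B" | "v \<in> A" "w \<in> B" | "v \<in> B" "w \<in> A" using vw AB(1) by blast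
      then show "v = w"
      proof cases
        case 1
        then have "ys ! rA v = ys ! rA w" using vw(3) by (simp add: \<phi>_def)
        then have "rA v = rA w" using nth_eq_iff_index_eq[OF dys] rA(2) 1 ys(1) by metis
        then show ?thesis using 1 rA(1) by (metis inj_onD)
      next
        case 2
        then have "pos (rB v) (P v) = pos (rB w) (P w)"
          using vw(3) phiB(1) nth_eq_iff_index_eq[OF dcs] pos_less[OF rB(2) PM] cs(1) by metis
        moreover have "pos (rB v) (P v) \<noteq> pos (rB w) (P w)" if "rB v \<noteq> rB w"
          using that pos_mono[OF _ PM] by (metis linorder_neqE_nat less_irrefl)
        ultimately have "rB v = rB w" by blast
        then show ?thesis using 2 rB(1) by (metis inj_onD)
      qed (use ne vw(3) in metis)+
    qed
    moreover have "(\<phi> u, \<phi> v) \<in> T" if uv: "(u, v) \<in> E" for u v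
    proof -
      have V: "u \<in> V" "v \<in> V" "(v, u) \<notin> E" using uv H by (auto simp: oriented_graph_def)
      consider "u \<in> A" "v \<in> A" | "u \<in> B" "v \<in> B" | "u \<in> A" "v \<in> B" | "u \<in> B" "v \<in> A" using V AB(1) by blast
      then show ?thesis
      proof cases
        case 1
        then show ?thesis using sorted_wrt_nth_less[OF ys(3)] rA(3)[OF uv 1] rA(2) ys(1) by (simp add: \<phi>_def)
      next
        case 2
        then show ?thesis
          using sorted_wrt_nth_less[OF cs(3) pos_mono[OF rB(3)[OF uv 2] PM]] pos_less[OF rB(2) PM] cs(1) 
          by (simp add: phiB)
      next
        case 3
        then show ?thesis using AB_arc uv by blast
      next
        case 4
        \<comment> \<open>From \<open>A\<close> to \<open>B\<close> the arcs of \<open>H\<close> are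
          reproduced exactly, non-arcs included. Hence an arc from \<open>B\<close> to
          \<open>A\<close> is obtained from the absence of its reverse.\<close>
        then have "(\<phi> v, \<phi> u) \<notin> T" using AB_arc V(3) by blast
        then show ?thesis using tournament_total[OF T ltn[OF V(1)] ltn[OF V(2)]] ne[OF 4(2,1)] by metis
      qed
    qed
    ultimately show ?thesis using rng ltn unfolding embedding_def by (intro exI[of _ \<phi>]) auto
  qed
qed

section \<open>Approximating vertices by a net of neighbourhoods\<close>

lemma card_filter_eq_sum: "finite X \<Longrightarrow> card {x \<in> X. R x} = (\<Sum>x\<in>X. if R x then 1 else 0)"
  by (simp add: sum.If_cases Int_def)

lemma sum_card_swap:
  assumes "finite A" "finite B"
  shows "(\<Sum>a\<in>A. card {b \<in> B. P a b}) = (\<Sum>b\<in>B. card {a \<in> A. P a b})"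
proof -
  have "(\<Sum>a\<in>A. card {b \<in> B. P a b}) = (\<Sum>a\<in>A. \<Sum>b\<in>B. if P a b then 1 else 0)"
    by (intro sum.cong refl card_filter_eq_sum assms)
  also have "\<dots> = (\<Sum>b\<in>B. \<Sum>a\<in>A. if P a b then 1 else 0)" by (rule sum.swap)
  also have "\<dots> = (\<Sum>b\<in>B. card {a \<in> A. P a b})"
    by (intro sum.cong refl card_filter_eq_sum[symmetric] assms)
  finally show ?thesis .
qed

text \<open>This is the probability that independent uniform coordinates meet constraints on
  \<open>J\<close>, with the denominators multiplied out. It is an inequality since
  \<open>U j\<close> may leave \<open>W j\<close>.\<close>

lemma card_PiE_constrained:
  fixes W :: "'i \<Rightarrow> 'x set"
  assumes "finite I" "J \<subseteq> I" "\<And>i. i \<in> I \<Longrightarrow> finite (W i)" "\<And>j. j \<in> J \<Longrightarrow> finite (U j)"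
  shows "card {f \<in> PiE I W. \<forall>j\<in>J. f j \<in> U j} * (\<Prod>j\<in>J. card (W j)) \<le> (\<Prod>i\<in>I. card (W i)) * (\<Prod>j\<in>J. card (U j))"
proof -
  define B where "B i = (if i \<in> J then U i else W i)" for i
  have "card {f \<in> PiE I W. \<forall>j\<in>J. f j \<in> U j} \<le> card (PiE I B)"
    using assms by (intro card_mono finite_PiE) (auto simp: B_def PiE_def Pi_def)
  also have "\<dots> = (\<Prod>i\<in>I. card (B i))" using assms(1) by (rule card_PiE)
  also have "\<dots> = (\<Prod>i\<in>I - J. card (B i)) * (\<Prod>j\<in>J. card (B j))"
    using assms(1,2) by (rule prod.subset_diff[rotated])
  also have "\<dots> = (\<Prod>i\<in>I - J. card (W i)) * (\<Prod>j\<in>J. card (U j))"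
    by (intro arg_cong2[of _ _ _ _ "(*)"] prod.cong) (auto simp: B_def)
  finally have "card {f \<in> PiE I W. \<forall>j\<in>J. f j \<in> U j} * (\<Prod>j\<in>J. card (W j)) \<le>
      (\<Prod>i\<in>I - J. card (W i)) * (\<Prod>j\<in>J. card (U j)) * (\<Prod>j\<in>J. card (W j))"
    by (rule mult_right_mono) simp
  also have "\<dots> = (\<Prod>i\<in>I. card (W i)) * (\<Prod>j\<in>J. card (U j))"
    using prod.subset_diff[OF assms(2,1), of "\<lambda>i. card (W i)"] by (simp add: mult_ac)
  finally show ?thesis .
qed

text \<open>Union bound for a uniformly random map: an embedding inside the image of
  \<open>I\<close> comes with an injective choice of an index for each vertex of \<open>H\<close>,
  and prescribing the values at \<open>card V\<close> distinct indices costs a factor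
  \<open>n\<close> for each.\<close>

lemma card_maps_hitting_embedding:
  assumes V: "finite V" "E \<subseteq> V \<times> V" and I: "finite I"
  shows "card {f \<in> I \<rightarrow>\<^sub>E {..<n}. \<exists>\<phi>. embedding V E n T \<phi> \<and> \<phi> ` V \<subseteq> f ` I} * n ^ card V
    \<le> card I ^ card V * card (embeddings V E n T) * n ^ card I" (is "card ?S * _ \<le> _")
proof -
  define G where "G = {g \<in> V \<rightarrow>\<^sub>E I. inj_on g V}"
  define box where "box g \<phi> = {f \<in> I \<rightarrow>\<^sub>E {..<n}. \<forall>k\<in>g ` V. f k \<in> {\<phi> (inv_into V g k)}}" for g and \<phi> :: "_ \<Rightarrow> nat"
  have fG: "finite G" unfolding G_def using V(1) I by (simp add: finite_PiE)
  have "card G \<le> card (V \<rightarrow>\<^sub>E I)" unfolding G_def using V(1) I by (intro card_mono finite_PiE) auto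
  then have cG: "card G \<le> card I ^ card V" using V(1) by (simp add: card_PiE)
  have fB: "finite (box g \<phi>)" for g \<phi>
    unfolding box_def using I by (simp add: finite_PiE)
  have sub: "?S \<subseteq> (\<Union>(g, \<phi>)\<in>G \<times> embeddings V E n T. box g \<phi>)"
  proof
    fix f assume "f \<in> ?S"
    then obtain \<phi> where f: "f \<in> I \<rightarrow>\<^sub>E {..<n}" and p: "embedding V E n T \<phi>" "\<phi> ` V \<subseteq> f ` I" by blast
    have "\<exists>g. \<forall>v\<in>V. g v \<in> I \<and> f (g v) = \<phi> v" 
    proof (intro bchoice ballI)
      fix v assume "v \<in> V"
      then have "\<phi> v \<in> f ` I" using p(2) by blast
      then show "\<exists>y. y \<in> I \<and> f y = \<phi> v" by auto
    qed
    then obtain g where g: "\<And>v. v \<in> V \<Longrightarrow> g v \<in> I" "\<And>v. v \<in> V \<Longrightarrow> f (g v) = \<phi> v" by blast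
    have inj: "inj_on g V" using p(1) g(2) unfolding embedding_def by (metis inj_on_def)
    then have "restrict g V \<in> G" unfolding G_def using g(1) by (auto simp: inj_on_def)
    moreover have "f \<in> box (restrict g V) (restrict \<phi> V)"
    proof -
      have "inv_into V (restrict g V) (g v) = v" if "v \<in> V" for v
        using inv_into_f_f[of "restrict g V" V v] inj that by (simp add: inj_on_def)
      then show ?thesis unfolding box_def using f g by auto
    qed
    ultimately show "f \<in> (\<Union>(g, \<phi>)\<in>G \<times> embeddings V E n T. box g \<phi>)"
      using restrict_mem_embeddings[OF V(2) p(1)] by blast
  qed
  have box: "card (box g \<phi>) * n ^ card V \<le> n ^ card I" if "g \<in> G" for g \<phi>
  proof -
    have "card (box g \<phi>) * (\<Prod>k\<in>g ` V. card {..<n}) \<le> (\<Prod>i\<in>I. card {..<n}) * (\<Prod>k\<in>g ` V. card {\<phi> (inv_into V g k)})"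
      unfolding box_def using that I by (intro card_PiE_constrained) (auto simp: G_def)
    then show ?thesis using that by (simp add: G_def card_image)
  qed
  have "card ?S \<le> card (\<Union>(g, \<phi>)\<in>G \<times> embeddings V E n T. box g \<phi>)"
    using sub fG fB finite_embeddings[OF V(1)] by (intro card_mono) auto
  also have "\<dots> \<le> (\<Sum>x\<in>G \<times> embeddings V E n T. card (case x of (g, \<phi>) \<Rightarrow> box g \<phi>))"
    using fG finite_embeddings[OF V(1)] by (intro card_UN_le) auto
  finally have "card ?S * n ^ card V \<le> (\<Sum>x\<in>G \<times> embeddings V E n T. card (case x of (g, \<phi>) \<Rightarrow> box g \<phi>)) * n ^ card V"
    by (rule mult_right_mono) simp
  also have "\<dots> = (\<Sum>x\<in>G \<times> embeddings V E n T. card (case x of (g, \<phi>) \<Rightarrow> box g \<phi>) * n ^ card V)"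
    by (rule sum_distrib_right)
  also have "\<dots> \<le> (\<Sum>x\<in>G \<times> embeddings V E n T. n ^ card I)"
    using box by (intro sum_mono) auto
  also have "\<dots> = card G * card (embeddings V E n T) * n ^ card I" by (simp add: card_cartesian_product)
  also have "\<dots> \<le> card I ^ card V * card (embeddings V E n T) * n ^ card I"
    using cG by (intro mult_right_mono) auto
  finally show ?thesis by simp
qed

section \<open>Nets of vertices with respect to out-neighbourhoods\<close>

definition diff_nbrs :: "nat \<Rightarrow> (nat \<times> nat) set \<Rightarrow> nat \<Rightarrow> nat \<Rightarrow> nat set" where
  "diff_nbrs n T u v = {w. w < n \<and> ((u, w) \<in> T \<longleftrightarrow> (v, w) \<notin> T)}"

lemma finite_diff_nbrs: "finite (diff_nbrs n T u v)"
  unfolding diff_nbrs_def by simp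

lemma diff_nbrs_commute: "diff_nbrs n T u v = diff_nbrs n T v u"
  unfolding diff_nbrs_def by blast

lemma diff_nbrs_triangle: "diff_nbrs n T u w \<subseteq> diff_nbrs n T u v \<union> diff_nbrs n T v w"
  unfolding diff_nbrs_def by blast

lemma net_exists:
  fixes V :: "'a set" and N n t q :: nat
  assumes T: "tournament n T" and H: "oriented_graph V E"
    and AB: "A \<union> B = V" "A \<inter> B = {}" "acyclic (induced_arcs E A)" "acyclic (induced_arcs E B)"
    and L: "L = card V * 2 ^ (2 ^ card V)"
    and pos: "n > 0" "N > 0" "t > 0"
    and par1: "4 * N * (q + 1) ^ (2 ^ L + L) \<le> t"
    and par2: "4 * real N * real t ^ 2 * (1 - 1 / real N) ^ q \<le> 1"
    and par3: "4 * N * (t + q) ^ card V * card (embeddings V E n T) \<le> n ^ card V"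
  shows "\<exists>X\<subseteq>{..<n}. card X \<le> t \<and> N * card {v \<in> {..<n}. \<forall>x\<in>X. n < N * card (diff_nbrs n T v x)} \<le> n"
proof (rule ccontr)
  assume contra: "\<not> ?thesis"
  define far where "far u v \<longleftrightarrow> n < N * card (diff_nbrs n T u v)" for u v
  define I where "I = {..<t + q}"
  define \<Omega> where "\<Omega> = I \<rightarrow>\<^sub>E {..<n}"
  define Iso where "Iso f i \<longleftrightarrow> (\<forall>j\<in>{..<t} - {i}. far (f i) (f j))" for i and f :: "nat \<Rightarrow> nat"
  define Emb where "Emb f \<longleftrightarrow> (\<exists>\<phi>. embedding V E n T \<phi> \<and> \<phi> ` V \<subseteq> f ` I)" for f :: "nat \<Rightarrow> nat"
  define Z where "Z f p \<longleftrightarrow> fst p \<noteq> snd p \<and> far (f (fst p)) (f (snd p)) \<and> 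
      (\<forall>l\<in>{t..<t + q}. f l \<notin> diff_nbrs n T (f (fst p)) (f (snd p)))" for p and f :: "nat \<Rightarrow> nat"
  define PP where "PP = {..<t} \<times> {..<t}"
  have finI: "finite I" and fin\<Omega>: "finite \<Omega>" and finPP: "finite PP" and cI: "card I = t + q"
    unfolding I_def \<Omega>_def PP_def by (auto simp: finite_PiE)
  have c\<Omega>: "card \<Omega> = n ^ (t + q)" unfolding \<Omega>_def using cI finI by (simp add: card_PiE)
  \<comment> \<open>Coordinate \<open>i\<close> is resampled with all others fixed. The other
    candidates form a set of at most \<open>t\<close> vertices, which by assumption leaves more than
    n/N vertices far from it.\<close>
  have lower: "n ^ (t + q) \<le> N * card {f \<in> \<Omega>. Iso f i}" if i: "i < t" for i
  proof -
    define I' where "I' = I - {i}"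
    define unc where "unc f = {v \<in> {..<n}. \<forall>j\<in>{..<t} - {i}. far v (f j)}" for f :: "nat \<Rightarrow> nat"
    have iI: "i \<in> I" "I = insert i I'" "i \<notin> I'" using i by (auto simp: I_def I'_def)
    have unc: "n \<le> N * card (unc f)" if "f \<in> I' \<rightarrow>\<^sub>E {..<n}" for f
    proof -
      define X where "X = f ` ({..<t} - {i})"
      have "X \<subseteq> {..<n}" unfolding X_def
        by (intro image_subsetI PiE_mem[OF that]) (auto simp: I'_def I_def)
      moreover have "card X \<le> t" unfolding X_def
        by (rule order.trans[OF card_image_le]) (auto simp: i)
      moreover have "unc f = {v \<in> {..<n}. \<forall>x\<in>X. n < N * card (diff_nbrs n T v x)}"
        unfolding unc_def X_def far_def by auto
      ultimately have "\<not> N * card (unc f) \<le> n" using contra by auto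
      then show ?thesis by simp
    qed
    have "inj_on (\<lambda>(f, v). f(i := v)) (Sigma (I' \<rightarrow>\<^sub>E {..<n}) unc)"
    proof (rule inj_onI, clarify)
      fix f v g w assume *: "f \<in> I' \<rightarrow>\<^sub>E {..<n}" "g \<in> I' \<rightarrow>\<^sub>E {..<n}" "f(i := v) = g(i := w)"
      have "f k = g k" for k
      proof (cases "k = i")
        case True
        then show ?thesis using *(1,2) iI(3) by (metis PiE_arb)
      next
        case False
        then show ?thesis using *(3) by (metis fun_upd_other)
      qed
      moreover have "v = w" using *(3) by (metis fun_upd_same)
      ultimately show "f = g \<and> v = w" by auto
    qed
    then have "card ((\<lambda>(f, v). f(i := v)) ` Sigma (I' \<rightarrow>\<^sub>E {..<n}) unc) = card (Sigma (I' \<rightarrow>\<^sub>E {..<n}) unc)"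
      by (rule card_image)
    also have "\<dots> = (\<Sum>f\<in>I' \<rightarrow>\<^sub>E {..<n}. card (unc f))"
      using finI by (intro card_SigmaI finite_PiE) (auto simp: I'_def unc_def)
    finally have eq: "card ((\<lambda>(f, v). f(i := v)) ` Sigma (I' \<rightarrow>\<^sub>E {..<n}) unc) = (\<Sum>f\<in>I' \<rightarrow>\<^sub>E {..<n}. card (unc f))" .
    have "(\<lambda>(f, v). f(i := v)) ` Sigma (I' \<rightarrow>\<^sub>E {..<n}) unc \<subseteq> {f \<in> \<Omega>. Iso f i}"
    proof clarify
      fix f v assume fv: "f \<in> I' \<rightarrow>\<^sub>E {..<n}" "v \<in> unc f"
      then have "f(i := v) \<in> \<Omega>" using iI(2) by (auto simp: \<Omega>_def unc_def PiE_iff extensional_def)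
      moreover have "Iso (f(i := v)) i" using fv(2) by (simp add: Iso_def unc_def)
      ultimately show "f(i := v) \<in> \<Omega> \<and> Iso (f(i := v)) i" ..
    qed
    then have "(\<Sum>f\<in>I' \<rightarrow>\<^sub>E {..<n}. card (unc f)) \<le> card {f \<in> \<Omega>. Iso f i}"
      unfolding eq[symmetric] using fin\<Omega> by (intro card_mono) auto
    moreover have "n ^ (t + q) \<le> N * (\<Sum>f\<in>I' \<rightarrow>\<^sub>E {..<n}. card (unc f))"
    proof -
      have "Suc (card I') = t + q" unfolding I'_def using card.remove[OF finI iI(1)] cI by simp
      then have "n ^ (t + q) = n ^ Suc (card I')" by (simp only:)
      also have "\<dots> = (\<Sum>f\<in>I' \<rightarrow>\<^sub>E {..<n}. n)"
      proof -
        have "finite I'" using finI by (simp add: I'_def)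
        then show ?thesis by (simp add: card_PiE)
      qed
      also have "\<dots> \<le> (\<Sum>f\<in>I' \<rightarrow>\<^sub>E {..<n}. N * card (unc f))" using unc by (rule sum_mono)
      finally show ?thesis unfolding sum_distrib_left[symmetric] .
    qed
    ultimately show ?thesis using mult_le_mono2 by (meson order.trans)
  qed
  \<comment> \<open>If there is an unseparated far pair or a copy in the sample, the trivial bound
    \<open>t\<close> is used.\<close>
  have upper: "card {i \<in> {..<t}. Iso f i} \<le> (q + 1) ^ (2 ^ L + L) + t * card {p \<in> PP. Z f p} + t * (if Emb f then 1 else 0)"
    if f: "f \<in> \<Omega>" for f
  proof (cases "card {p \<in> PP. Z f p} = 0 \<and> \<not> Emb f")
    case False
    have "card {i \<in> {..<t}. Iso f i} \<le> card {..<t}" by (intro card_mono) auto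
    also have "\<dots> \<le> t * card {p \<in> PP. Z f p} + t * (if Emb f then 1 else 0)" using False by auto
    finally show ?thesis by simp
  next
    case True
    then have noZ: "\<not> Z f p" if "p \<in> PP" for p using that True finPP by (cases p) auto
    define Q where "Q = f ` {t..<t + q}"
    define I0 where "I0 = {i \<in> {..<t}. Iso f i}"
    define F where "F = (\<lambda>i. out_nbrs T (f i) \<inter> Q) ` I0"
    have fin: "finite Q" "F \<subseteq> Pow Q" by (auto simp: Q_def F_def)
    have "inj_on (\<lambda>i. out_nbrs T (f i) \<inter> Q) I0"
    proof (rule inj_onI, rule ccontr)
      fix i j assume ij: "i \<in> I0" "j \<in> I0" "out_nbrs T (f i) \<inter> Q = out_nbrs T (f j) \<inter> Q" "i \<noteq> j"
      then have "far (f i) (f j)" by (auto simp: I0_def Iso_def)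
      moreover have "f l \<notin> diff_nbrs n T (f i) (f j)" if "l \<in> {t..<t + q}" for l
      proof -
        have "f l \<in> Q" using that by (auto simp: Q_def)
        then have "(f i, f l) \<in> T \<longleftrightarrow> (f j, f l) \<in> T" using ij(3) unfolding out_nbrs_def by blast
        then show ?thesis by (auto simp: diff_nbrs_def)
      qed
      ultimately have "Z f (i, j)" using ij(4) by (simp add: Z_def)
      then show False using noZ[of "(i, j)"] ij by (auto simp: PP_def I0_def)
    qed
    then have cF: "card F = card I0" unfolding F_def by (rule card_image)
    have cQ: "card Q \<le> q" unfolding Q_def by (rule order.trans[OF card_image_le]) auto
    have "card F \<le> (card Q + 1) ^ (2 ^ L + L)"
    proof (rule ccontr)
      assume "\<not> ?thesis"
      then obtain S where S: "S \<subseteq> Q" "2 ^ L + L < card S" "shatters F S"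
        using Sauer_Shelah_weak[OF fin, of "2 ^ L + L"] by (auto simp: not_le)
      have "shatters (out_nbrs T ` (f ` {..<t})) S"
        unfolding shatters_def
      proof (intro allI impI)
        fix P assume "P \<subseteq> S"
        then obtain i where "i \<in> I0" "out_nbrs T (f i) \<inter> Q \<inter> S = P" using S(3) unfolding shatters_def F_def by blast
        then show "\<exists>X\<in>out_nbrs T ` f ` {..<t}. X \<inter> S = P"
          using S(1) by (intro bexI[of _ "out_nbrs T (f i)"]) (auto simp: I0_def)
      qed
      moreover have fI: "f ` I \<subseteq> {..<n}" using f by (auto simp: \<Omega>_def)
      have "Q \<subseteq> f ` I" "f ` {..<t} \<subseteq> f ` I" unfolding Q_def I_def by auto
      then have "S \<subseteq> {..<n}" "f ` {..<t} \<subseteq> {..<n}" using S(1) fI by blast+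
      ultimately obtain \<phi> where "embedding V E n T \<phi>" "\<phi> ` V \<subseteq> S \<union> f ` {..<t}"
        using shattered_imp_embedding[OF T H AB _ _ _ L, of S "f ` {..<t}"] S(2) by auto
      moreover have "S \<union> f ` {..<t} \<subseteq> f ` I" using S(1) by (auto simp: Q_def I_def)
      ultimately show False using True unfolding Emb_def by blast
    qed
    also have "\<dots> \<le> (q + 1) ^ (2 ^ L + L)" using cQ by (intro power_mono) auto
    finally show ?thesis using cF by (simp add: I0_def)
  qed
  \<comment> \<open>Once the values of the two candidates are fixed, each of the \<open>q\<close>
    test points has to avoid a set of more than n/N vertices.\<close>
  have Zb: "real (card {f \<in> \<Omega>. Z f p}) \<le> real n ^ (t + q) * (1 - 1 / N) ^ q" if p: "p \<in> PP" for p
  proof (cases "fst p = snd p")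
    case True
    then show ?thesis using pos by (simp add: Z_def)
  next
    case False
    define i j where "i = fst p" and "j = snd p"
    have ij: "i < t" "j < t" "i \<noteq> j" using p False by (auto simp: PP_def i_def j_def)
    define J where "J = insert i (insert j {t..<t + q})"
    define U where "U a b k = (if k = i then {a} else if k = j then {b} else {..<n} - diff_nbrs n T a b)" for a b k
    define Fr where "Fr = {(a, b) \<in> {..<n} \<times> {..<n}. far a b}"
    define box where "box x = {f \<in> \<Omega>. \<forall>k\<in>J. f k \<in> U (fst x) (snd x) k}" for x
    have JI: "J \<subseteq> I" using ij by (auto simp: J_def I_def)
    have cJ: "card J = q + 2" using ij by (simp add: J_def)
    have finFr: "finite Fr" unfolding Fr_def by (auto intro: finite_subset[of _ "{..<n} \<times> {..<n}"])
    have cFr: "card Fr \<le> n * n" unfolding Fr_def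
      by (rule order.trans[OF card_mono[of "{..<n} \<times> {..<n}"]]) (auto simp: card_cartesian_product)
    have boxb: "real (card (box x)) * real n ^ 2 \<le> real n ^ (t + q) * (1 - 1 / N) ^ q" if x: "x \<in> Fr" for x
    proof -
      obtain a b where ab: "x = (a, b)" "a < n" "b < n" "far a b" using x by (auto simp: Fr_def)
      have "card (box x) * (\<Prod>k\<in>J. card {..<n}) \<le> (\<Prod>i\<in>I. card {..<n}) * (\<Prod>k\<in>J. card (U a b k))"
        unfolding box_def \<Omega>_def ab(1) fst_conv snd_conv using JI finI by (intro card_PiE_constrained) (auto simp: U_def)
      moreover have "(\<Prod>k\<in>J. card (U a b k)) = card ({..<n} - diff_nbrs n T a b) ^ q"
      proof -
        have "(\<Prod>k\<in>{t..<t + q}. card (U a b k)) = (\<Prod>k\<in>{t..<t + q}. card ({..<n} - diff_nbrs n T a b))"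
          using ij by (intro prod.cong) (auto simp: U_def)
        then show ?thesis using ij by (simp add: J_def U_def)
      qed
      ultimately have "card (box x) * n ^ (q + 2) \<le> n ^ (t + q) * card ({..<n} - diff_nbrs n T a b) ^ q"
        using cJ cI by simp
      then have 1: "real (card (box x)) * real n ^ (q + 2) \<le> real n ^ (t + q) * real (card ({..<n} - diff_nbrs n T a b)) ^ q"
        by (metis (mono_tags) of_nat_le_iff of_nat_mult of_nat_power)
      have sub: "diff_nbrs n T a b \<subseteq> {..<n}" by (auto simp: diff_nbrs_def)
      then have "card ({..<n} - diff_nbrs n T a b) = n - card (diff_nbrs n T a b)" 
        by (simp add: card_Diff_subset finite_diff_nbrs)
      moreover have "card (diff_nbrs n T a b) \<le> n" using card_mono[OF _ sub] by simp
      ultimately have "real (card ({..<n} - diff_nbrs n T a b)) = real n - real (card (diff_nbrs n T a b))" by (simp add: of_nat_diff)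
      moreover have "real n < real N * real (card (diff_nbrs n T a b))"
        using ab(4) unfolding far_def by (metis of_nat_less_iff of_nat_mult)
      then have "real n / N \<le> real (card (diff_nbrs n T a b))" using pos by (simp add: field_simps)
      ultimately have "real (card ({..<n} - diff_nbrs n T a b)) \<le> real n * (1 - 1 / N)" by (simp add: algebra_simps)
      then have "real (card ({..<n} - diff_nbrs n T a b)) ^ q \<le> (real n * (1 - 1 / N)) ^ q" by (intro power_mono) auto
      then have "real (card (box x)) * real n ^ (q + 2) \<le> real n ^ (t + q) * (real n * (1 - 1 / N)) ^ q"
        using 1 by (meson mult_left_mono of_nat_0_le_iff order_trans zero_le_power)
      then have "(real (card (box x)) * real n ^ 2) * real n ^ q \<le> (real n ^ (t + q) * (1 - 1 / N) ^ q) * real n ^ q"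
        by (simp add: power_mult_distrib power_add power2_eq_square mult_ac)
      then show ?thesis using pos by (simp only: mult_le_cancel_right_pos zero_less_power of_nat_0_less_iff)
    qed
    have "{f \<in> \<Omega>. Z f p} \<subseteq> (\<Union>x\<in>Fr. box x)"
    proof
      fix f assume f: "f \<in> {f \<in> \<Omega>. Z f p}"
      then have fn: "f k < n" if "k \<in> I" for k using that by (auto simp: \<Omega>_def)
      have "(f i, f j) \<in> Fr" using f JI fn by (auto simp: Z_def i_def j_def Fr_def J_def)
      moreover have "f \<in> box (f i, f j)" using f fn ij by (auto simp: box_def J_def U_def Z_def i_def j_def I_def)
      ultimately show "f \<in> (\<Union>x\<in>Fr. box x)" by blast
    qed
    then have "card {f \<in> \<Omega>. Z f p} \<le> (\<Sum>x\<in>Fr. card (box x))"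
      using finFr fin\<Omega> by (intro order.trans[OF card_mono card_UN_le]) (auto simp: box_def)
    then have "real (card {f \<in> \<Omega>. Z f p}) * real n ^ 2 \<le> (\<Sum>x\<in>Fr. real (card (box x)) * real n ^ 2)"
      unfolding sum_distrib_right[symmetric] by (intro mult_right_mono) (simp_all flip: of_nat_sum)
    also have "\<dots> \<le> (\<Sum>x\<in>Fr. real n ^ (t + q) * (1 - 1 / N) ^ q)" using boxb by (rule sum_mono)
    also have "\<dots> = real (card Fr) * (real n ^ (t + q) * (1 - 1 / N) ^ q)" by simp
    also have "\<dots> \<le> real (n * n) * (real n ^ (t + q) * (1 - 1 / N) ^ q)"
      using cFr pos by (intro mult_right_mono) (auto simp del: of_nat_mult)
    finally have "real (card {f \<in> \<Omega>. Z f p}) * real n ^ 2 \<le> (real n ^ (t + q) * (1 - 1 / N) ^ q) * real n ^ 2"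
      by (simp add: power2_eq_square mult_ac)
    then show ?thesis using pos by (simp only: mult_le_cancel_right_pos zero_less_power of_nat_0_less_iff)
  qed
  define W where "W = real n ^ (t + q)"
  have W: "W > 0" using pos by (simp add: W_def)
  have "real t * W / N \<le> (\<Sum>i<t. real (card {f \<in> \<Omega>. Iso f i}))"
  proof -
    have "W / N \<le> real (card {f \<in> \<Omega>. Iso f i})" if "i < t" for i
    proof -
      have "real (n ^ (t + q)) \<le> real (N * card {f \<in> \<Omega>. Iso f i})" using lower[OF that] by (simp only: of_nat_le_iff)
      then show ?thesis using pos by (simp add: W_def field_simps)
    qed
    then show ?thesis using sum_bounded_below[of "{..<t}" "W / N"] by simp
  qed
  also have "\<dots> = (\<Sum>f\<in>\<Omega>. real (card {i \<in> {..<t}. Iso f i}))"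
    using sum_card_swap[OF fin\<Omega>, of "{..<t}" Iso] by (simp flip: of_nat_sum)
  also have "\<dots> \<le> (\<Sum>f\<in>\<Omega>. real ((q + 1) ^ (2 ^ L + L)) + (real t * real (card {p \<in> PP. Z f p}) + real t * (if Emb f then 1 else 0)))"
  proof (rule sum_mono)
    fix f assume "f \<in> \<Omega>"
    from upper[OF this] have "real (card {i \<in> {..<t}. Iso f i}) \<le>
      real ((q + 1) ^ (2 ^ L + L) + t * card {p \<in> PP. Z f p} + t * (if Emb f then 1 else 0))" by (simp only: of_nat_le_iff)
    then show "real (card {i \<in> {..<t}. Iso f i}) \<le> 
      real ((q + 1) ^ (2 ^ L + L)) + (real t * real (card {p \<in> PP. Z f p}) + real t * (if Emb f then 1 else 0))"
      by (cases "Emb f") (simp_all add: algebra_simps)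
  qed
  also have "\<dots> = W * real ((q + 1) ^ (2 ^ L + L)) + (real t * (\<Sum>f\<in>\<Omega>. real (card {p \<in> PP. Z f p})) + real t * real (card {f \<in> \<Omega>. Emb f}))"
  proof -
    have "(\<Sum>f\<in>\<Omega>. (if Emb f then 1 else 0 :: real)) = real (card {f \<in> \<Omega>. Emb f})"
      using fin\<Omega> by (simp add: sum.If_cases Int_def)
    then show ?thesis using c\<Omega> by (simp add: sum.distrib sum_distrib_left[symmetric] W_def)
  qed
  also have "\<dots> \<le> real t * W / (4 * N) + (real t * W / (4 * N) + real t * W / (4 * N))"
  proof (intro add_mono)
    have "real (4 * N * (q + 1) ^ (2 ^ L + L)) \<le> real t" using par1 by (simp only: of_nat_le_iff)
    then have "real ((q + 1) ^ (2 ^ L + L)) \<le> real t / (4 * N)" using pos by (simp add: field_simps)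
    then have "W * real ((q + 1) ^ (2 ^ L + L)) \<le> W * (real t / (4 * N))" using W by (intro mult_left_mono) auto
    then show "W * real ((q + 1) ^ (2 ^ L + L)) \<le> real t * W / (4 * N)" by (simp add: mult_ac)
  next
    have "(\<Sum>f\<in>\<Omega>. real (card {p \<in> PP. Z f p})) = (\<Sum>p\<in>PP. real (card {f \<in> \<Omega>. Z f p}))"
      using sum_card_swap[OF fin\<Omega> finPP, of Z] by (simp flip: of_nat_sum)
    also have "\<dots> \<le> (\<Sum>p\<in>PP. W * (1 - 1 / N) ^ q)" using Zb unfolding W_def by (rule sum_mono)
    also have "\<dots> = W * (real t ^ 2 * (1 - 1 / N) ^ q)" by (simp add: PP_def power2_eq_square)
    also have "\<dots> \<le> W * (1 / (4 * N))" using par2 W pos by (intro mult_left_mono) (auto simp: field_simps)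
    finally show "real t * (\<Sum>f\<in>\<Omega>. real (card {p \<in> PP. Z f p})) \<le> real t * W / (4 * N)"
      using mult_left_mono[of _ _ "real t"] by fastforce
  next
    have "card {f \<in> \<Omega>. Emb f} * n ^ card V \<le> card I ^ card V * card (embeddings V E n T) * n ^ card I"
      unfolding \<Omega>_def Emb_def using H by (intro card_maps_hitting_embedding finI) (auto simp: oriented_graph_def)
    then have "4 * N * card {f \<in> \<Omega>. Emb f} * n ^ card V \<le> (4 * N * (t + q) ^ card V * card (embeddings V E n T)) * n ^ (t + q)"
      using mult_le_mono2[of _ _ "4 * N"] unfolding cI by (simp only: mult.assoc)
    also have "\<dots> \<le> n ^ card V * n ^ (t + q)" using par3 by (rule mult_right_mono) simp
    finally have "4 * N * card {f \<in> \<Omega>. Emb f} * n ^ card V \<le> n ^ (t + q) * n ^ card V" by (simp only: mult.commute)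
    then have "4 * N * card {f \<in> \<Omega>. Emb f} \<le> n ^ (t + q)" using pos by simp
    then have "real (4 * N * card {f \<in> \<Omega>. Emb f}) \<le> real (n ^ (t + q))" by (simp only: of_nat_le_iff)
    then have "real (card {f \<in> \<Omega>. Emb f}) \<le> W / (4 * N)" using pos by (simp add: W_def field_simps)
    then show "real t * real (card {f \<in> \<Omega>. Emb f}) \<le> real t * W / (4 * N)"
      using mult_left_mono[of _ _ "real t"] by fastforce
  qed
  also have "\<dots> < real t * W / N" using pos W by (simp add: field_simps)
  finally show False by simp
qed

section \<open>Homogeneous partitions\<close>

text \<open>One spare power suffices: (N/(k+1))^(k+1) is at most the binomial coefficient of
  \<open>N\<close> over \<open>k + 1\<close>, hence at most 2^N, and its extra factor
  \<open>N\<close> absorbs the constants.\<close>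

lemma power_le_two_power:
  assumes "4 * (k + 1) ^ (k + 1) \<le> N"
  shows "4 * N ^ k \<le> (2::nat) ^ N"
proof -
  have "k + 1 \<le> (k + 1) ^ (k + 1)" by (rule self_le_power) auto
  then have kN: "k + 1 \<le> N" using assms by linarith
  have "real (4 * (k + 1) ^ (k + 1)) * real N ^ k \<le> real N * real N ^ k"
    using assms by (intro mult_right_mono) (simp_all only: of_nat_le_iff, simp)
  also have "\<dots> = (real N / real (k + 1)) ^ (k + 1) * real (k + 1) ^ (k + 1)"
    by (simp add: power_divide)
  also have "\<dots> \<le> real (N choose (k + 1)) * real (k + 1) ^ (k + 1)"
    using binomial_ge_n_over_k_pow_k[OF kN, where 'a = real] by (intro mult_right_mono) auto
  also have "\<dots> \<le> 2 ^ N * real (k + 1) ^ (k + 1)"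
    using binomial_le_pow2[of N "k + 1"] by (intro mult_right_mono) (simp_all flip: of_nat_le_iff)
  finally have le: "real (4 * (k + 1) ^ (k + 1)) * real N ^ k \<le> 2 ^ N * real (k + 1) ^ (k + 1)" .
  define c where "c = real (k + 1) ^ (k + 1)"
  have "(4 * real N ^ k) * c \<le> 2 ^ N * c"
    using le by (simp only: c_def of_nat_mult of_nat_power of_nat_numeral mult_ac)
  moreover have "c > 0" by (simp add: c_def)
  ultimately have "4 * real N ^ k \<le> 2 ^ N" by (simp only: mult_le_cancel_right_pos)
  then show ?thesis by (metis (mono_tags) of_nat_le_iff of_nat_mult of_nat_numeral of_nat_power)
qed

lemma one_minus_inverse_power_le:
  assumes "N > 0"
  shows "(1 - 1 / real N) ^ (N ^ 2) \<le> 1 / 2 ^ N"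
proof -
  have "(1 - 1 / real N) ^ (N ^ 2) \<le> exp (- (1 / real N)) ^ (N ^ 2)"
    using assms exp_ge_add_one_self[of "- (1 / real N)"] by (intro power_mono) (auto simp: field_simps)
  also have "\<dots> = exp (- real N)"
    using assms by (simp add: exp_of_nat_mult[symmetric] power2_eq_square)
  also have "\<dots> = 1 / exp 1 ^ N" by (simp add: exp_minus exp_of_nat_mult[symmetric] inverse_eq_divide)
  also have "\<dots> \<le> 1 / 2 ^ N"
    using exp_ge_add_one_self[of 1] by (intro divide_left_mono power_mono) auto
  finally show ?thesis .
qed

text \<open>With \<open>q = N ^ 2\<close> a far pair stays unseparated with probability at most
  2^(-N), which beats any fixed power of \<open>N\<close>. So \<open>t\<close> may be a power of
  \<open>N\<close> large enough to exceed the polynomial number of traces.\<close>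

lemma net_exists_poly:
  fixes V :: "'a set"
  assumes H: "oriented_graph V E"
    and AB: "A \<union> B = V" "A \<inter> B = {}" "acyclic (induced_arcs E A)" "acyclic (induced_arcs E B)"
  shows "\<exists>a N0. \<forall>N\<ge>N0. \<forall>n T. tournament n T \<longrightarrow> n > 0 \<longrightarrow> N ^ a * card (embeddings V E n T) \<le> n ^ card V \<longrightarrow>
    (\<exists>X\<subseteq>{..<n}. card X \<le> N ^ a \<and> N * card {v \<in> {..<n}. \<forall>x\<in>X. n < N * card (diff_nbrs n T v x)} \<le> n)"
proof -
  define L where "L = card V * 2 ^ (2 ^ card V)"
  define K where "K = 2 ^ L + L"
  \<comment> \<open>\<open>a0\<close> pays for \<open>4 * N * (q + 1) ^ K\<close> by means of
    \<open>q + 1 \<le> N ^ 3\<close>, and \<open>k\<close> is the degree of 4 N t^2 in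
    \<open>N\<close>. The rest of \<open>a\<close> pays for the factor
    \<open>(t + q) ^ card V\<close> in the condition on the number of copies.\<close>
  define a0 where "a0 = 3 * K + 2"
  define a where "a = a0 + (2 + (a0 + 1) * card V)"
  define k where "k = 2 * a0 + 1"
  define N0 where "N0 = 4 * (k + 1) ^ (k + 1)"
  have "\<exists>X\<subseteq>{..<n}. card X \<le> N ^ a \<and> N * card {v \<in> {..<n}. \<forall>x\<in>X. n < N * card (diff_nbrs n T v x)} \<le> n"
    if N: "N \<ge> N0" and T: "tournament n T" and n: "n > 0" and few: "N ^ a * card (embeddings V E n T) \<le> n ^ card V" for N n T
  proof -
    have "4 * 1 \<le> N0" unfolding N0_def by (intro mult_left_mono one_le_power) auto
    then have N4: "N \<ge> 4" using N by linarith
    define t where "t = N ^ a0"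
    define q where "q = N ^ 2"
    have q1: "q + 1 \<le> N ^ 3"
    proof -
      have "N ^ 2 * 2 \<le> N ^ 2 * N" using N4 by (intro mult_left_mono) auto
      moreover have "1 \<le> N ^ 2" using N4 by simp
      ultimately have "N ^ 2 + 1 \<le> N ^ 2 * N" by linarith
      then show ?thesis unfolding q_def by (simp add: power3_eq_cube power2_eq_square)
    qed
    have p1: "4 * N * (q + 1) ^ (2 ^ L + L) \<le> t"
    proof -
      have "4 * N * (q + 1) ^ (2 ^ L + L) \<le> N * N * (N ^ 3) ^ K"
        unfolding K_def using N4 q1 by (intro mult_mono power_mono) auto
      also have "\<dots> = t" by (simp add: t_def a0_def power_mult power_add power2_eq_square)
      finally show ?thesis .
    qed
    have p2: "4 * real N * real t ^ 2 * (1 - 1 / real N) ^ q \<le> 1"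
    proof -
      have "4 * real N * real t ^ 2 * (1 - 1 / real N) ^ q \<le> 4 * real N * real t ^ 2 * (1 / 2 ^ N)"
        unfolding q_def using one_minus_inverse_power_le[of N] N4 by (intro mult_left_mono) auto
      also have "\<dots> = 4 * real N ^ k * (1 / 2 ^ N)"
        by (simp add: t_def k_def power_mult[symmetric] mult_ac)
      also have "\<dots> \<le> 1"
      proof -
        have "real (4 * N ^ k) \<le> real (2 ^ N)" using power_le_two_power[OF N[unfolded N0_def]] by (simp only: of_nat_le_iff)
        then show ?thesis by (simp add: field_simps)
      qed
      finally show ?thesis .
    qed
    have p3: "4 * N * (t + q) ^ card V * card (embeddings V E n T) \<le> n ^ card V"
    proof -
      have "q \<le> t" unfolding q_def t_def using N4 by (intro power_increasing) (auto simp: a0_def)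
      then have "t + q \<le> 2 * t" by simp
      also have "\<dots> \<le> N ^ (a0 + 1)" using N4 by (simp add: t_def)
      finally have "4 * N * (t + q) ^ card V \<le> N * N * (N ^ (a0 + 1)) ^ card V"
        using N4 by (intro mult_mono power_mono) auto
      also have "\<dots> = N ^ (2 + (a0 + 1) * card V)"
        by (simp only: power_mult power_add[of N 2] power2_eq_square)
      also have "\<dots> \<le> N ^ a" using N4 by (intro power_increasing) (auto simp: a_def)
      finally show ?thesis using few mult_le_mono1 order.trans by blast
    qed
    have "t > 0" "N > 0" using N4 by (auto simp: t_def)
    then obtain X where "X \<subseteq> {..<n}" "card X \<le> t" "N * card {v \<in> {..<n}. \<forall>x\<in>X. n < N * card (diff_nbrs n T v x)} \<le> n"
      using net_exists[OF T H AB L_def n _ _ p1 p2 p3] by blast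
    moreover have "t \<le> N ^ a" unfolding t_def using N4 by (intro power_increasing) (auto simp: a_def)
    ultimately show ?thesis by (meson order.trans)
  qed
  then show ?thesis by blast
qed

section \<open>Homogeneity of pairs of classes on average\<close>

lemma card_small_classes_le:
  fixes w :: real
  assumes "finite D" "w \<ge> 0"
  shows "real (card {v \<in> D. real (card {u \<in> D. \<nu> u = \<nu> v}) < w}) \<le> real (card (\<nu> ` D)) * w"
proof -
  define S where "S = {v \<in> D. real (card {u \<in> D. \<nu> u = \<nu> v}) < w}"
  have "S = (\<Union>l\<in>\<nu> ` S. {u \<in> D. \<nu> u = l})" by (auto simp: S_def)
  then have "card S \<le> (\<Sum>l\<in>\<nu> ` S. card {u \<in> D. \<nu> u = l})"
    using card_UN_le[of "\<nu> ` S" "\<lambda>l. {u \<in> D. \<nu> u = l}"] finite_imageI[of S \<nu>] assms(1) by (simp add: S_def)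
  then have "real (card S) \<le> (\<Sum>l\<in>\<nu> ` S. real (card {u \<in> D. \<nu> u = l}))" by (simp flip: of_nat_sum)
  also have "\<dots> \<le> (\<Sum>l\<in>\<nu> ` S. w)" by (intro sum_mono) (auto simp: S_def less_imp_le)
  also have "\<dots> \<le> (\<Sum>l\<in>\<nu> ` D. w)" using assms by (intro sum_mono2) (auto simp: S_def)
  finally show ?thesis by (simp add: S_def)
qed

definition disagree :: "(nat \<times> nat) set \<Rightarrow> nat set \<Rightarrow> nat set \<Rightarrow> nat \<Rightarrow> nat \<Rightarrow> (nat \<times> nat) set" where
  "disagree T A B a b = {(u, v) \<in> A \<times> B. (u, v) \<in> T \<longleftrightarrow> (a, b) \<notin> T}"

text \<open>Passing from (u, v) to (a, v) and on to (a, b) changes the orientation only if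
  \<open>v\<close> distinguishes \<open>u\<close> from \<open>a\<close>, or \<open>a\<close>
  distinguishes \<open>v\<close> from \<open>b\<close>. In the second case the arcs at
  \<open>a\<close> are read backwards, which is possible in a tournament.\<close>

lemma sum_card_disagree_le:
  assumes T: "tournament n T" and AB: "A \<subseteq> {..<n}" "B \<subseteq> {..<n}" "A \<inter> B = {}"
  shows "(\<Sum>a\<in>A. \<Sum>b\<in>B. card (disagree T A B a b)) \<le>
    card B * (\<Sum>a\<in>A. \<Sum>u\<in>A. card (diff_nbrs n T u a \<inter> B)) + card A * (\<Sum>b\<in>B. \<Sum>v\<in>B. card (diff_nbrs n T v b \<inter> A))"
proof -
  have fin: "finite A" "finite B" using AB finite_subset by blast+
  have 1: "card (disagree T A B a b) \<le> (\<Sum>u\<in>A. card (diff_nbrs n T u a \<inter> B)) + card A * card {v \<in> B. a \<in> diff_nbrs n T v b}"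
    if ab: "a \<in> A" "b \<in> B" for a b
  proof -
    have "disagree T A B a b \<subseteq> (SIGMA u:A. diff_nbrs n T u a \<inter> B) \<union> A \<times> {v \<in> B. a \<in> diff_nbrs n T v b}"
    proof
      fix p assume "p \<in> disagree T A B a b"
      then obtain u v where p: "p = (u, v)" "u \<in> A" "v \<in> B" "(u, v) \<in> T \<longleftrightarrow> (a, b) \<notin> T" by (auto simp: disagree_def)
      have n: "a < n" "b < n" "v < n" "a \<noteq> b" "a \<noteq> v" using ab p AB by auto
      show "p \<in> (SIGMA u:A. diff_nbrs n T u a \<inter> B) \<union> A \<times> {v \<in> B. a \<in> diff_nbrs n T v b}"
      proof (cases "(u, v) \<in> T \<longleftrightarrow> (a, v) \<in> T")
        case True
        then have "a \<in> diff_nbrs n T v b"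
          using p(4) n tournament_total[OF T n(1,2)] tournament_total[OF T n(1,3)] by (auto simp: diff_nbrs_def)
        then show ?thesis using p by simp
      next
        case False
        then show ?thesis using p n by (auto simp: diff_nbrs_def)
      qed
    qed
    then have "card (disagree T A B a b) \<le> card ((SIGMA u:A. diff_nbrs n T u a \<inter> B) \<union> A \<times> {v \<in> B. a \<in> diff_nbrs n T v b})"
      using fin by (intro card_mono) auto
    also have "\<dots> \<le> card (SIGMA u:A. diff_nbrs n T u a \<inter> B) + card (A \<times> {v \<in> B. a \<in> diff_nbrs n T v b})" by (rule card_Un_le)
    also have "\<dots> = (\<Sum>u\<in>A. card (diff_nbrs n T u a \<inter> B)) + card A * card {v \<in> B. a \<in> diff_nbrs n T v b}"
      using fin by (simp add: card_cartesian_product)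
    finally show ?thesis .
  qed
  have "(\<Sum>a\<in>A. \<Sum>b\<in>B. card (disagree T A B a b)) \<le>
      (\<Sum>a\<in>A. \<Sum>b\<in>B. (\<Sum>u\<in>A. card (diff_nbrs n T u a \<inter> B)) + card A * card {v \<in> B. a \<in> diff_nbrs n T v b})"
    using 1 by (intro sum_mono)
  also have "\<dots> = card B * (\<Sum>a\<in>A. \<Sum>u\<in>A. card (diff_nbrs n T u a \<inter> B)) +
      card A * (\<Sum>a\<in>A. \<Sum>b\<in>B. card {v \<in> B. a \<in> diff_nbrs n T v b})"
    by (simp add: sum.distrib sum_distrib_left)
  also have "(\<Sum>a\<in>A. \<Sum>b\<in>B. card {v \<in> B. a \<in> diff_nbrs n T v b}) = (\<Sum>b\<in>B. \<Sum>a\<in>A. card {v \<in> B. a \<in> diff_nbrs n T v b})"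
    by (rule sum.swap)
  also have "\<dots> = (\<Sum>b\<in>B. \<Sum>v\<in>B. card {a \<in> A. a \<in> diff_nbrs n T v b})"
    using fin by (intro sum.cong refl sum_card_swap)
  also have "\<dots> = (\<Sum>b\<in>B. \<Sum>v\<in>B. card (diff_nbrs n T v b \<inter> A))"
    by (intro sum.cong refl arg_cong[of _ _ card]) auto
  finally show ?thesis .
qed

lemma sum_card_classes: "finite D \<Longrightarrow> (\<Sum>i\<in>\<kappa> ` D. card {v \<in> D. \<kappa> v = i}) = card D"
  by (subst card_UN_disjoint[symmetric]) (auto intro: arg_cong[of _ _ card])

text \<open>For fixed \<open>i\<close>, \<open>a\<close>, \<open>u\<close> the sets
  \<open>diff_nbrs n T u a \<inter> cls j\<close> are disjoint for different \<open>j\<close>, so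
  their sizes add up to at most \<open>d\<close>. Thus the bound does not depend on the number of
  classes. Each summand is the expected disagreement with a random pair from the two
  classes.\<close>

lemma homogeneity_sum_le:
  fixes d :: real
  assumes T: "tournament n T" and D: "D \<subseteq> {..<n}"
    and d: "\<And>u v. u \<in> D \<Longrightarrow> v \<in> D \<Longrightarrow> \<kappa> u = \<kappa> v \<Longrightarrow> real (card (diff_nbrs n T u v)) \<le> d"
    and cls: "\<And>i. cls i = {v \<in> D. \<kappa> v = i}"
  shows "(\<Sum>i\<in>\<kappa> ` D. \<Sum>j\<in>\<kappa> ` D - {i}. (\<Sum>a\<in>cls i. \<Sum>b\<in>cls j. real (card (disagree T (cls i) (cls j) a b))) /
    (real (card (cls i)) * real (card (cls j)))) \<le> 2 * d * real (card D)"
proof -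
  define I where "I = \<kappa> ` D"
  define P where "P i j = (\<Sum>a\<in>cls i. \<Sum>u\<in>cls i. real (card (diff_nbrs n T u a \<inter> cls j)))" for i j
  have finD: "finite D" using D finite_subset by blast
  then have finI: "finite I" and finc: "finite (cls i)" for i by (simp_all add: I_def cls)
  have ne: "card (cls i) > 0" if "i \<in> I" for i using that finD by (auto simp: cls I_def card_gt_0_iff)
  have 1: "(\<Sum>a\<in>cls i. \<Sum>b\<in>cls j. real (card (disagree T (cls i) (cls j) a b))) / (real (card (cls i)) * real (card (cls j)))
      \<le> P i j / real (card (cls i)) + P j i / real (card (cls j))" if ij: "i \<in> I" "j \<in> I" "i \<noteq> j" for i j
  proof -
    have "(\<Sum>a\<in>cls i. \<Sum>b\<in>cls j. card (disagree T (cls i) (cls j) a b)) \<le>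
      card (cls j) * (\<Sum>a\<in>cls i. \<Sum>u\<in>cls i. card (diff_nbrs n T u a \<inter> cls j)) +
      card (cls i) * (\<Sum>b\<in>cls j. \<Sum>v\<in>cls j. card (diff_nbrs n T v b \<inter> cls i))"
      using D ij by (intro sum_card_disagree_le[OF T]) (auto simp: cls)
    then have "real (\<Sum>a\<in>cls i. \<Sum>b\<in>cls j. card (disagree T (cls i) (cls j) a b)) \<le>
      real (card (cls j) * (\<Sum>a\<in>cls i. \<Sum>u\<in>cls i. card (diff_nbrs n T u a \<inter> cls j)) +
      card (cls i) * (\<Sum>b\<in>cls j. \<Sum>v\<in>cls j. card (diff_nbrs n T v b \<inter> cls i)))" by (simp only: of_nat_le_iff)
    then have "(\<Sum>a\<in>cls i. \<Sum>b\<in>cls j. real (card (disagree T (cls i) (cls j) a b))) \<le>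
      real (card (cls j)) * P i j + real (card (cls i)) * P j i" by (simp add: P_def)
    then show ?thesis using ne[OF ij(1)] ne[OF ij(2)] by (simp add: field_simps)
  qed
  have 2: "(\<Sum>j\<in>I - {i}. P i j / real (card (cls i))) \<le> d * real (card (cls i))" if i: "i \<in> I" for i
  proof -
    have "(\<Sum>j\<in>I - {i}. P i j) = (\<Sum>a\<in>cls i. \<Sum>u\<in>cls i. \<Sum>j\<in>I - {i}. real (card (diff_nbrs n T u a \<inter> cls j)))"
      unfolding P_def by (subst sum.swap, rule sum.cong[OF refl], subst sum.swap, rule refl)
    also have "\<dots> \<le> (\<Sum>a\<in>cls i. \<Sum>u\<in>cls i. d)"
    proof (intro sum_mono)
      fix a u assume au: "a \<in> cls i" "u \<in> cls i"
      have "(\<Sum>j\<in>I - {i}. card (diff_nbrs n T u a \<inter> cls j)) = card (\<Union>j\<in>I - {i}. diff_nbrs n T u a \<inter> cls j)"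
        using finI by (intro card_UN_disjoint[symmetric]) (auto simp: cls finite_diff_nbrs)
      also have "\<dots> \<le> card (diff_nbrs n T u a)" by (intro card_mono finite_diff_nbrs) auto
      finally have "(\<Sum>j\<in>I - {i}. real (card (diff_nbrs n T u a \<inter> cls j))) \<le> real (card (diff_nbrs n T u a))"
        by (simp flip: of_nat_sum)
      also have "\<dots> \<le> d" using au by (intro d) (auto simp: cls)
      finally show "(\<Sum>j\<in>I - {i}. real (card (diff_nbrs n T u a \<inter> cls j))) \<le> d" .
    qed
    also have "\<dots> = d * real (card (cls i)) * real (card (cls i))" by simp
    finally show ?thesis using ne[OF i] by (simp add: sum_divide_distrib[symmetric] field_simps)
  qed
  have "(\<Sum>i\<in>I. \<Sum>j\<in>I - {i}. P j i / real (card (cls j))) = (\<Sum>j\<in>I. \<Sum>i\<in>I - {j}. P j i / real (card (cls j)))"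
  proof -
    have "(\<Sum>i\<in>I. \<Sum>j\<in>I - {i}. P j i / real (card (cls j))) = (\<Sum>i\<in>I. \<Sum>j\<in>{j \<in> I. j \<noteq> i}. P j i / real (card (cls j)))"
      by (intro sum.cong refl) auto
    also have "\<dots> = (\<Sum>j\<in>I. \<Sum>i\<in>{i \<in> I. j \<noteq> i}. P j i / real (card (cls j)))" using finI by (intro sum.swap_restrict)
    also have "\<dots> = (\<Sum>j\<in>I. \<Sum>i\<in>I - {j}. P j i / real (card (cls j)))" by (intro sum.cong refl) auto
    finally show ?thesis .
  qed
  then have "(\<Sum>i\<in>I. \<Sum>j\<in>I - {i}. P i j / real (card (cls i)) + P j i / real (card (cls j))) =
      2 * (\<Sum>i\<in>I. \<Sum>j\<in>I - {i}. P i j / real (card (cls i)))" by (simp add: sum.distrib)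
  also have "\<dots> \<le> 2 * (\<Sum>i\<in>I. d * real (card (cls i)))" using 2 by (intro mult_left_mono sum_mono) auto
  also have "\<dots> = 2 * d * real (card D)"
    using sum_card_classes[OF finD, of \<kappa>] unfolding I_def cls by (simp add: sum_distrib_left[symmetric] flip: of_nat_sum)
  finally have *: "(\<Sum>i\<in>I. \<Sum>j\<in>I - {i}. P i j / real (card (cls i)) + P j i / real (card (cls j))) \<le> 2 * d * real (card D)" .
  have "(\<Sum>i\<in>I. \<Sum>j\<in>I - {i}. (\<Sum>a\<in>cls i. \<Sum>b\<in>cls j. real (card (disagree T (cls i) (cls j) a b))) /
    (real (card (cls i)) * real (card (cls j)))) \<le> (\<Sum>i\<in>I. \<Sum>j\<in>I - {i}. P i j / real (card (cls i)) + P j i / real (card (cls j)))"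
    using 1 by (intro sum_mono) auto
  then show ?thesis using * unfolding I_def by linarith
qed

section \<open>Random representatives of the classes\<close>

lemma card_PiE_pair_le:
  fixes W :: "'i \<Rightarrow> 'x set"
  assumes "finite I" "i \<in> I" "j \<in> I" "i \<noteq> j" "\<And>k. k \<in> I \<Longrightarrow> finite (W k)"
  shows "card {f \<in> PiE I W. f i = a \<and> f j = b} * (card (W i) * card (W j)) \<le> (\<Prod>k\<in>I. card (W k))"
  using card_PiE_constrained[of I "{i, j}" W "\<lambda>k. if k = i then {a} else {b}"] assms by auto

lemma sum_PiE_pair_le:
  fixes W :: "'i \<Rightarrow> 'x set" and F :: "'x \<Rightarrow> 'x \<Rightarrow> real"
  assumes I: "finite I" "i \<in> I" "j \<in> I" "i \<noteq> j"
    and W: "\<And>k. k \<in> I \<Longrightarrow> finite (W k)" "\<And>k. k \<in> I \<Longrightarrow> W k \<noteq> {}"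
    and F: "\<And>a b. F a b \<ge> 0"
  shows "(\<Sum>f\<in>PiE I W. F (f i) (f j)) \<le>
    real (card (PiE I W)) * ((\<Sum>a\<in>W i. \<Sum>b\<in>W j. F a b) / (real (card (W i)) * real (card (W j))))"
proof -
  define c where "c = real (card (W i)) * real (card (W j))"
  have c: "c > 0" unfolding c_def using I W by (simp add: card_gt_0_iff)
  have fin: "finite (PiE I W)" using I(1) W(1) by (rule finite_PiE)
  have "(\<Sum>f\<in>PiE I W. F (f i) (f j)) = (\<Sum>p\<in>W i \<times> W j. \<Sum>f\<in>{f \<in> PiE I W. (f i, f j) = p}. F (f i) (f j))"
    using fin W I by (intro sum.group[symmetric]) auto
  also have "\<dots> = (\<Sum>p\<in>W i \<times> W j. real (card {f \<in> PiE I W. (f i, f j) = p}) * F (fst p) (snd p))"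
    by (intro sum.cong refl) auto
  also have "\<dots> \<le> (\<Sum>p\<in>W i \<times> W j. real (card (PiE I W)) / c * F (fst p) (snd p))"
  proof (intro sum_mono mult_right_mono F)
    fix p assume "p \<in> W i \<times> W j"
    have "card {f \<in> PiE I W. (f i, f j) = p} * (card (W i) * card (W j)) \<le> card (PiE I W)"
      using card_PiE_pair_le[of I i j W "fst p" "snd p"] I W by (cases p) (simp add: card_PiE)
    then have "real (card {f \<in> PiE I W. (f i, f j) = p}) * c \<le> real (card (PiE I W))"
      by (simp only: c_def of_nat_mult[symmetric] of_nat_le_iff)
    then show "real (card {f \<in> PiE I W. (f i, f j) = p}) \<le> real (card (PiE I W)) / c"
      using c by (simp add: field_simps)
  qed
  also have "\<dots> = real (card (PiE I W)) / c * (\<Sum>p\<in>W i \<times> W j. F (fst p) (snd p))" by (rule sum_distrib_left[symmetric])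
  also have "(\<Sum>p\<in>W i \<times> W j. F (fst p) (snd p)) = (\<Sum>a\<in>W i. \<Sum>b\<in>W j. F a b)"
    by (simp add: sum.cartesian_product split_def)
  finally show ?thesis by (simp add: c_def)
qed

text \<open>First moment method for independent uniform representatives: two coordinates together
  are uniform on the product of their classes.\<close>

lemma ex_representatives:
  fixes W :: "'i \<Rightarrow> 'x set" and F :: "'i \<Rightarrow> 'i \<Rightarrow> 'x \<Rightarrow> 'x \<Rightarrow> real"
  assumes I: "finite I" and W: "\<And>k. k \<in> I \<Longrightarrow> finite (W k)" "\<And>k. k \<in> I \<Longrightarrow> W k \<noteq> {}"
    and F: "\<And>i j a b. F i j a b \<ge> 0"
  shows "\<exists>f\<in>PiE I W. (\<Sum>i\<in>I. \<Sum>j\<in>I - {i}. F i j (f i) (f j)) \<le>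
    (\<Sum>i\<in>I. \<Sum>j\<in>I - {i}. (\<Sum>a\<in>W i. \<Sum>b\<in>W j. F i j a b) / (real (card (W i)) * real (card (W j))))" (is "\<exists>f\<in>_. ?S f \<le> ?R")
proof (rule ccontr)
  assume "\<not> ?thesis"
  then have *: "\<And>f. f \<in> PiE I W \<Longrightarrow> ?R < ?S f" by (auto simp: not_le)
  have fin: "finite (PiE I W)" using I W(1) by (rule finite_PiE)
  have ne: "PiE I W \<noteq> {}" using W(2) by (simp add: PiE_eq_empty_iff)
  have "(\<Sum>f\<in>PiE I W. ?R) < (\<Sum>f\<in>PiE I W. ?S f)" by (rule sum_strict_mono[OF fin ne *])
  also have "\<dots> = (\<Sum>i\<in>I. \<Sum>j\<in>I - {i}. \<Sum>f\<in>PiE I W. F i j (f i) (f j))"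
    by (subst sum.swap, rule sum.cong[OF refl], rule sum.swap)
  also have "\<dots> \<le> (\<Sum>i\<in>I. \<Sum>j\<in>I - {i}. real (card (PiE I W)) * ((\<Sum>a\<in>W i. \<Sum>b\<in>W j. F i j a b) / (real (card (W i)) * real (card (W j)))))"
    using I W F by (intro sum_mono sum_PiE_pair_le) auto
  also have "\<dots> = (\<Sum>f\<in>PiE I W. ?R)" by (simp add: sum_distrib_left)
  finally show False by simp
qed

text \<open>Union bound over at most |I|^2 ordered pairs of coordinates, each bad with probability
  at most \<gamma>.\<close>

lemma card_good_tuples_ge:
  fixes W :: "'i \<Rightarrow> 'x set" and bad :: "'i \<Rightarrow> 'i \<Rightarrow> 'x \<Rightarrow> 'x \<Rightarrow> bool" and \<gamma> :: real
  assumes I: "finite I" and W: "\<And>k. k \<in> I \<Longrightarrow> finite (W k)" "\<And>k. k \<in> I \<Longrightarrow> W k \<noteq> {}"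
    and bad: "\<And>i j. i \<in> I \<Longrightarrow> j \<in> I \<Longrightarrow> i \<noteq> j \<Longrightarrow>
       real (card {(a, b) \<in> W i \<times> W j. bad i j a b}) \<le> \<gamma> * (real (card (W i)) * real (card (W j)))"
    and \<gamma>: "\<gamma> \<ge> 0" "real (card I) ^ 2 * \<gamma> \<le> 1 / 2"
  shows "real (card (PiE I W)) / 2 \<le> real (card {f \<in> PiE I W. \<forall>i\<in>I. \<forall>j\<in>I - {i}. \<not> bad i j (f i) (f j)})"
proof -
  define \<Omega> where "\<Omega> = PiE I W"
  define G where "G = {f \<in> \<Omega>. \<forall>i\<in>I. \<forall>j\<in>I - {i}. \<not> bad i j (f i) (f j)}"
  have fin: "finite \<Omega>" unfolding \<Omega>_def using I W(1) by (rule finite_PiE)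
  have "\<Omega> - G \<subseteq> (\<Union>i\<in>I. \<Union>j\<in>I - {i}. {f \<in> \<Omega>. bad i j (f i) (f j)})" by (auto simp: G_def)
  then have "card (\<Omega> - G) \<le> card (\<Union>i\<in>I. \<Union>j\<in>I - {i}. {f \<in> \<Omega>. bad i j (f i) (f j)})"
    using I fin by (intro card_mono) auto
  also have "\<dots> \<le> (\<Sum>i\<in>I. card (\<Union>j\<in>I - {i}. {f \<in> \<Omega>. bad i j (f i) (f j)}))" using I by (rule card_UN_le)
  also have "\<dots> \<le> (\<Sum>i\<in>I. \<Sum>j\<in>I - {i}. card {f \<in> \<Omega>. bad i j (f i) (f j)})" using I by (intro sum_mono card_UN_le) auto
  finally have "real (card (\<Omega> - G)) \<le> (\<Sum>i\<in>I. \<Sum>j\<in>I - {i}. real (card {f \<in> \<Omega>. bad i j (f i) (f j)}))"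
    by (simp flip: of_nat_sum)
  also have "\<dots> \<le> (\<Sum>i\<in>I. \<Sum>j\<in>I - {i}. real (card \<Omega>) * \<gamma>)"
  proof (intro sum_mono)
    fix i j assume ij: "i \<in> I" "j \<in> I - {i}"
    have fW: "finite (W i)" "finite (W j)" "card (W i) > 0" "card (W j) > 0" using ij W by (auto simp: card_gt_0_iff)
    have "real (card {f \<in> \<Omega>. bad i j (f i) (f j)}) = (\<Sum>f\<in>\<Omega>. if bad i j (f i) (f j) then 1 else 0)"
      using fin by (simp add: sum.If_cases Int_def)
    also have "\<dots> \<le> real (card \<Omega>) * ((\<Sum>a\<in>W i. \<Sum>b\<in>W j. if bad i j a b then 1 else 0) / (real (card (W i)) * real (card (W j))))"
      unfolding \<Omega>_def using I W ij by (intro sum_PiE_pair_le) auto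
    also have "(\<Sum>a\<in>W i. \<Sum>b\<in>W j. if bad i j a b then 1 else 0 :: real) = (\<Sum>p\<in>W i \<times> W j. if bad i j (fst p) (snd p) then 1 else 0)"
      by (simp add: sum.cartesian_product split_def)
    also have "\<dots> = real (card {(a, b) \<in> W i \<times> W j. bad i j a b})"
      using fW by (simp add: sum.If_cases Int_def split_def mem_Times_iff conj_assoc)
    also have "real (card \<Omega>) * (\<dots> / (real (card (W i)) * real (card (W j)))) \<le> real (card \<Omega>) * \<gamma>"
      using bad[of i j] ij fW by (intro mult_left_mono) (auto simp: field_simps)
    finally show "real (card {f \<in> \<Omega>. bad i j (f i) (f j)}) \<le> real (card \<Omega>) * \<gamma>" .
  qed
  also have "\<dots> \<le> (\<Sum>i\<in>I. \<Sum>j\<in>I. real (card \<Omega>) * \<gamma>)" using I \<gamma> by (intro sum_mono sum_mono2) auto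
  also have "\<dots> = real (card \<Omega>) * (real (card I) ^ 2 * \<gamma>)" by (simp add: power2_eq_square)
  also have "\<dots> \<le> real (card \<Omega>) * (1 / 2)" using \<gamma> by (intro mult_left_mono) auto
  finally have "real (card (\<Omega> - G)) \<le> real (card \<Omega>) / 2" by simp
  moreover have "card \<Omega> = card (\<Omega> - G) + card G"
    using fin by (subst card_Un_disjoint[symmetric]) (auto simp: G_def intro: arg_cong[of _ _ card])
  ultimately show ?thesis by (simp add: G_def \<Omega>_def)
qed

text \<open>\<open>\<pi>\<close> projects the blow-up to its classes, and \<open>z\<close> supplies
  2^h vertices of \<open>T\<close> for each class met by the copy \<open>\<phi>\<close>. A class is
  transitive in the blow-up, but \<open>T\<close> is arbitrary on a sample, so a transitive chain of
  \<open>h\<close> vertices is first taken from each sample. Placing \<open>v\<close> at the rank of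
  \<open>\<phi> v\<close> in its chain then respects the orders of all classes
  simultaneously.\<close>

lemma embedding_from_blowup:
  fixes V :: "'a set" and \<pi> :: "nat \<Rightarrow> 'i"
  assumes T: "tournament n T" and H: "oriented_graph V E"
    and \<phi>: "inj_on \<phi> V" "\<And>u v. (u, v) \<in> E \<Longrightarrow> \<pi> (\<phi> u) = \<pi> (\<phi> v) \<Longrightarrow> \<phi> u < \<phi> v"
      "\<And>u v. (u, v) \<in> E \<Longrightarrow> \<pi> (\<phi> u) \<noteq> \<pi> (\<phi> v) \<Longrightarrow> R (\<pi> (\<phi> u)) (\<pi> (\<phi> v))"
    and J: "J = \<pi> ` \<phi> ` V" "I = J \<times> {..<(2::nat) ^ card V}"
    and z: "\<And>p. p \<in> I \<Longrightarrow> z p < n" "inj_on z I"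
      "\<And>p p'. p \<in> I \<Longrightarrow> p' \<in> I \<Longrightarrow> fst p \<noteq> fst p' \<Longrightarrow> R (fst p) (fst p') \<Longrightarrow> (z p, z p') \<in> T"
  shows "\<exists>\<psi>. embedding V E n T \<psi> \<and> \<psi> ` V \<subseteq> z ` I"
proof -
  define h where "h = card V"
  have finV: "finite V" using H by (auto simp: oriented_graph_def)
  have "\<exists>xs. length xs = h \<and> set xs \<subseteq> z ` ({i} \<times> {..<(2::nat) ^ h}) \<and> sorted_wrt (\<lambda>u v. (u, v) \<in> T) xs" if i: "i \<in> J" for i
  proof (rule transitive_subtournament[OF T])
    have sub: "{i} \<times> {..<(2::nat) ^ h} \<subseteq> I" using i by (auto simp: J h_def)
    then show "z ` ({i} \<times> {..<2 ^ h}) \<subseteq> {..<n}" using z(1) by auto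
    have "card (z ` ({i} \<times> {..<2 ^ h})) = card ({i} \<times> {..<(2::nat) ^ h})"
      using inj_on_subset[OF z(2) sub] by (rule card_image)
    then show "2 ^ h \<le> card (z ` ({i} \<times> {..<2 ^ h}))" by (simp add: card_cartesian_product)
  qed simp
  then obtain ch where ch: "\<And>i. i \<in> J \<Longrightarrow> length (ch i) = h" "\<And>i. i \<in> J \<Longrightarrow> set (ch i) \<subseteq> z ` ({i} \<times> {..<2 ^ h})"
    "\<And>i. i \<in> J \<Longrightarrow> sorted_wrt (\<lambda>u v. (u, v) \<in> T) (ch i)" by metis
  define \<psi> where "\<psi> v = ch (\<pi> (\<phi> v)) ! rank_in V \<phi> v" for v
  have rk: "rank_in V \<phi> v < h" if "v \<in> V" for v unfolding h_def using finV that by (rule rank_in_less_card)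
  have \<psi>_z: "\<exists>l<2 ^ h. \<psi> v = z (\<pi> (\<phi> v), l)" if v: "v \<in> V" for v
  proof -
    have iJ: "\<pi> (\<phi> v) \<in> J" using v by (simp add: J)
    then have "\<psi> v \<in> set (ch (\<pi> (\<phi> v)))" unfolding \<psi>_def using ch(1) rk[OF v] by simp
    then show ?thesis using ch(2)[OF iJ] by auto
  qed
  then obtain l where l: "\<And>v. v \<in> V \<Longrightarrow> l v < 2 ^ h" "\<And>v. v \<in> V \<Longrightarrow> \<psi> v = z (\<pi> (\<phi> v), l v)" by metis
  have lI: "(\<pi> (\<phi> v), l v) \<in> I" if "v \<in> V" for v using l(1)[OF that] that by (auto simp: J h_def)
  have "inj_on \<psi> V"
  proof (rule inj_onI)
    fix u v assume uv: "u \<in> V" "v \<in> V" "\<psi> u = \<psi> v"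
    then have "(\<pi> (\<phi> u), l u) = (\<pi> (\<phi> v), l v)" using z(2) lI l(2) by (metis inj_onD)
    then have eq: "\<pi> (\<phi> u) = \<pi> (\<phi> v)" by simp
    have iJ: "\<pi> (\<phi> u) \<in> J" using uv by (simp add: J)
    have "distinct (ch (\<pi> (\<phi> u)))" using sorted_wrt_tournament_distinct[OF T ch(3)[OF iJ]] .
    then have "rank_in V \<phi> u = rank_in V \<phi> v"
      using uv(3) rk uv(1,2) ch(1)[OF iJ] unfolding \<psi>_def eq by (simp add: nth_eq_iff_index_eq)
    then show "u = v" using inj_on_rank_in[OF finV \<phi>(1)] uv by (metis inj_onD)
  qed
  moreover have "(\<psi> u, \<psi> v) \<in> T" if uv: "(u, v) \<in> E" for u v
  proof -
    have V: "u \<in> V" "v \<in> V" using uv H by (auto simp: oriented_graph_def)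
    show ?thesis
    proof (cases "\<pi> (\<phi> u) = \<pi> (\<phi> v)")
      case True
      have iJ: "\<pi> (\<phi> v) \<in> J" using V by (simp add: J)
      have "rank_in V \<phi> u < rank_in V \<phi> v" using \<phi>(2)[OF uv True] finV V(1) by (intro rank_in_strict_mono)
      then show ?thesis unfolding \<psi>_def True
        using sorted_wrt_nth_less[OF ch(3)[OF iJ]] rk[OF V(2)] ch(1)[OF iJ] by simp
    next
      case False
      then show ?thesis using z(3)[OF lI[OF V(1)] lI[OF V(2)]] \<phi>(3)[OF uv] l(2) V by simp
    qed
  qed
  moreover have "\<psi> ` V \<subseteq> z ` I" using l(2) lI by auto
  ultimately show ?thesis using z(1) unfolding embedding_def by (intro exI[of _ \<psi>]) auto
qed

text \<open>A coarse class consists of vertices assigned to the same point of \<open>X\<close> and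
  lying in the same interval of length about n/N. The intervals cap the class sizes, so that few
  arcs lie inside classes. The exceptional vertices are those far from one of the nets and those in
  small fine or small coarse classes, at most n/N of each of these four kinds.\<close>

lemma ex_regular_partition:
  fixes N M n a :: nat
  assumes n: "n \<ge> N" "n > 0" and N: "N > 0" "N \<le> M"
    and X: "X \<subseteq> {..<n}" "card X \<le> N ^ a" "N * card {v \<in> {..<n}. \<forall>x\<in>X. n < N * card (diff_nbrs n T v x)} \<le> n"
    and Y: "Y \<subseteq> {..<n}" "card Y \<le> M ^ a" "M * card {v \<in> {..<n}. \<forall>y\<in>Y. n < M * card (diff_nbrs n T v y)} \<le> n"
  shows "\<exists>D (\<kappa> :: nat \<Rightarrow> nat \<times> nat) (\<nu> :: nat \<Rightarrow> (nat \<times> nat) \<times> nat). D \<subseteq> {..<n} \<and> real (card ({..<n} - D)) \<le> 4 * real n / N \<and>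
    (\<forall>u\<in>D. \<forall>v\<in>D. \<kappa> u = \<kappa> v \<longrightarrow> real (card (diff_nbrs n T u v)) \<le> 2 * real n / N) \<and>
    (\<forall>u\<in>D. \<forall>v\<in>D. \<nu> u = \<nu> v \<longrightarrow> real (card (diff_nbrs n T u v)) \<le> 2 * real n / M) \<and>
    (\<forall>u\<in>D. \<forall>v\<in>D. \<nu> u = \<nu> v \<longrightarrow> \<kappa> u = \<kappa> v) \<and>
    (\<forall>v\<in>D. real n / N ^ (a + 2) \<le> real (card {u \<in> D. \<kappa> u = \<kappa> v})) \<and>
    (\<forall>v\<in>D. real (card {u \<in> D. \<kappa> u = \<kappa> v}) \<le> 2 * real n / N) \<and>
    (\<forall>v\<in>D. real n / (N ^ (a + 2) * M ^ a) \<le> real (card {u \<in> D. \<nu> u = \<nu> v}))"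
proof -
  have M: "M > 0" using N by simp
  have close: "real (card (diff_nbrs n T u v)) \<le> 2 * real n / K"
    if "\<not> n < K * card (diff_nbrs n T u x)" "\<not> n < K * card (diff_nbrs n T v x)" "K > 0" for u v x K
  proof -
    have "card (diff_nbrs n T u v) \<le> card (diff_nbrs n T u x \<union> diff_nbrs n T x v)"
      by (intro card_mono diff_nbrs_triangle) (simp add: finite_diff_nbrs)
    also have "\<dots> \<le> card (diff_nbrs n T u x) + card (diff_nbrs n T v x)"
      using card_Un_le[of "diff_nbrs n T u x" "diff_nbrs n T x v"] by (simp add: diff_nbrs_commute)
    finally have "K * card (diff_nbrs n T u v) \<le> K * (card (diff_nbrs n T u x) + card (diff_nbrs n T v x))"
      by (rule mult_le_mono2)
    also have "\<dots> \<le> 2 * n" using that by (simp add: distrib_left)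
    finally have "real (K * card (diff_nbrs n T u v)) \<le> real (2 * n)" by (simp only: of_nat_le_iff)
    then show ?thesis using that(3) by (simp add: field_simps)
  qed
  define near where "near K x v \<longleftrightarrow> \<not> n < K * card (diff_nbrs n T v x)" for K x v
  define c where "c v = (SOME x. x \<in> X \<and> near N x v)" for v
  define c' where "c' v = (SOME y. y \<in> Y \<and> near M y v)" for v
  define D0 where "D0 = {v \<in> {..<n}. (\<exists>x\<in>X. near N x v) \<and> (\<exists>y\<in>Y. near M y v)}"
  have c: "c v \<in> X" "near N (c v) v" if "v \<in> D0" for v
    using someI_ex[of "\<lambda>x. x \<in> X \<and> near N x v"] that by (auto simp: c_def D0_def)
  have c': "c' v \<in> Y" "near M (c' v) v" if "v \<in> D0" for v
    using someI_ex[of "\<lambda>y. y \<in> Y \<and> near M y v"] that by (auto simp: c'_def D0_def)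
  define L where "L = n div N + 1"
  define \<kappa> where "\<kappa> v = (c v, v div L)" for v
  define \<nu> where "\<nu> v = (\<kappa> v, c' v)" for v
  have finX: "finite X" "finite Y" using X(1) Y(1) finite_subset by blast+
  have finD0: "finite D0" by (simp add: D0_def)
  have blk: "v div L < N" if "v < n" for v
  proof -
    have "n < N * L" unfolding L_def using N(1) by (metis Suc_eq_plus1 dividend_less_times_div mult_Suc_right)
    then show ?thesis using that by (intro less_mult_imp_div_less) (simp add: mult.commute)
  qed
  have Lle: "real L \<le> 2 * real n / N"
  proof -
    have "real (n div N * N) \<le> real n" using div_times_less_eq_dividend[of n N] by (simp only: of_nat_le_iff)
    then have "real (n div N) \<le> real n / N" using N by (simp add: field_simps)
    moreover have "1 \<le> real n / N" using n N by (simp add: field_simps)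
    ultimately show ?thesis by (simp add: L_def)
  qed
  \<comment> \<open>There are at most N^(a+1) M^a fine and N^(a+1) coarse classes; each threshold is
    \<open>n\<close> divided by this number and by a further \<open>N\<close>. Fine classes are
    cleaned first: afterwards a coarse class is kept or dropped together with all its fine classes,
    so their lower bound survives.\<close>
  define w where "w = real n / (N ^ (a + 2) * M ^ a)"
  define w' where "w' = real n / N ^ (a + 2)"
  define D1 where "D1 = {v \<in> D0. w \<le> real (card {u \<in> D0. \<nu> u = \<nu> v})}"
  define D where "D = {v \<in> D1. w' \<le> real (card {u \<in> D1. \<kappa> u = \<kappa> v})}"
  have ck: "card (\<kappa> ` D1) \<le> N ^ (a + 1)"
  proof -
    have "card (\<kappa> ` D1) \<le> card (X \<times> {..<N})"
      using finX c(1) blk by (intro card_mono) (auto simp: \<kappa>_def D1_def D0_def)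
    also have "\<dots> \<le> N ^ a * N" using X(2) by (simp add: card_cartesian_product)
    finally show ?thesis by (simp add: mult.commute)
  qed
  have cn: "card (\<nu> ` D0) \<le> N ^ (a + 1) * M ^ a"
  proof -
    have "card (\<nu> ` D0) \<le> card ((X \<times> {..<N}) \<times> Y)"
      using finX c(1) c'(1) blk by (intro card_mono) (auto simp: \<kappa>_def \<nu>_def D0_def)
    also have "\<dots> \<le> (N ^ a * N) * M ^ a" using X(2) Y(2) by (simp add: card_cartesian_product mult_le_mono)
    finally show ?thesis by (simp add: mult.commute)
  qed
  have sub: "D \<subseteq> D1" "D1 \<subseteq> D0" "D0 \<subseteq> {..<n}" by (auto simp: D_def D1_def D0_def)
  have nuk: "\<nu> u = \<nu> v \<Longrightarrow> \<kappa> u = \<kappa> v" for u v by (simp add: \<nu>_def)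
  have "real (card ({..<n} - D)) \<le> 4 * real n / N"
  proof -
    define U where "U K Z = {v \<in> {..<n}. \<forall>x\<in>Z. n < K * card (diff_nbrs n T v x)}" for K Z
    have U: "real (card (U K Z)) \<le> real n / N" if "K * card (U K Z) \<le> n" "N \<le> K" for K Z
    proof -
      have "N * card (U K Z) \<le> K * card (U K Z)" using that(2) by (rule mult_right_mono) simp
      also have "\<dots> \<le> n" by (rule that)
      finally have "real (N * card (U K Z)) \<le> real n" by (simp only: of_nat_le_iff)
      then show ?thesis using N by (simp add: field_simps)
    qed
    have "{..<n} - D \<subseteq> (U N X \<union> U M Y) \<union> ((D0 - D1) \<union> (D1 - D))" by (auto simp: D0_def U_def near_def)
    then have "card ({..<n} - D) \<le> card ((U N X \<union> U M Y) \<union> ((D0 - D1) \<union> (D1 - D)))"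
      using finD0 sub by (intro card_mono) (auto simp: U_def intro: finite_subset)
    also have "\<dots> \<le> (card (U N X) + card (U M Y)) + (card (D0 - D1) + card (D1 - D))"
      by (meson add_mono card_Un_le order.trans)
    finally have 1: "real (card ({..<n} - D)) \<le> (real (card (U N X)) + real (card (U M Y))) + (real (card (D0 - D1)) + real (card (D1 - D)))"
      by (simp flip: of_nat_add)
    have "D0 - D1 = {v \<in> D0. real (card {u \<in> D0. \<nu> u = \<nu> v}) < w}" by (auto simp: D1_def)
    then have "real (card (D0 - D1)) \<le> real (card (\<nu> ` D0)) * w"
      using card_small_classes_le[OF finD0, of w \<nu>] by (simp add: w_def)
    also have "\<dots> \<le> real (N ^ (a + 1) * M ^ a) * w" using cn by (intro mult_right_mono) (simp_all only: of_nat_le_iff, simp add: w_def)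
    also have "\<dots> = real n / N" using N M by (simp add: w_def)
    finally have 2: "real (card (D0 - D1)) \<le> real n / N" .
    have "D1 - D = {v \<in> D1. real (card {u \<in> D1. \<kappa> u = \<kappa> v}) < w'}" by (auto simp: D_def)
    moreover have "finite D1" using sub finD0 finite_subset by blast
    ultimately have "real (card (D1 - D)) \<le> real (card (\<kappa> ` D1)) * w'"
      using card_small_classes_le[of D1 w' \<kappa>] by (simp add: w'_def)
    also have "\<dots> \<le> real (N ^ (a + 1)) * w'" using ck by (intro mult_right_mono) (simp_all only: of_nat_le_iff, simp add: w'_def)
    also have "\<dots> = real n / N" using N by (simp add: w'_def)
    finally have 3: "real (card (D1 - D)) \<le> real n / N" .
    show ?thesis using 1 2 3 U[of N X] U[of M Y] X(3) Y(3) N(2) unfolding U_def by simp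
  qed
  moreover have "real (card (diff_nbrs n T u v)) \<le> 2 * real n / N" if "u \<in> D" "v \<in> D" "\<kappa> u = \<kappa> v" for u v
    using close[of N u "c v" v] c(2)[of u] c(2)[of v] that sub N unfolding near_def \<kappa>_def by auto
  moreover have "real (card (diff_nbrs n T u v)) \<le> 2 * real n / M" if "u \<in> D" "v \<in> D" "\<nu> u = \<nu> v" for u v
    using close[of M u "c' v" v] c'(2)[of u] c'(2)[of v] that sub M unfolding near_def \<nu>_def by auto
  moreover have "w' \<le> real (card {u \<in> D. \<kappa> u = \<kappa> v})" if "v \<in> D" for v
  proof -
    have "{u \<in> D. \<kappa> u = \<kappa> v} = {u \<in> D1. \<kappa> u = \<kappa> v}" using that by (auto simp: D_def)
    then show ?thesis using that by (simp add: D_def)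
  qed
  moreover have "w \<le> real (card {u \<in> D. \<nu> u = \<nu> v})" if "v \<in> D" for v
  proof -
    have "{u \<in> D. \<nu> u = \<nu> v} = {u \<in> D0. \<nu> u = \<nu> v}"
    proof (intro set_eqI iffI)
      fix u assume "u \<in> {u \<in> D0. \<nu> u = \<nu> v}"
      then have u: "u \<in> D0" "\<nu> u = \<nu> v" by auto
      then have "u \<in> D1" using that by (simp add: D_def D1_def)
      moreover have "\<kappa> u = \<kappa> v" using nuk[OF u(2)] .
      ultimately show "u \<in> {u \<in> D. \<nu> u = \<nu> v}" using that u by (simp add: D_def)
    qed (use sub in auto)
    then show ?thesis using that by (simp add: D_def D1_def)
  qed
  moreover have "real (card {u \<in> D. \<kappa> u = \<kappa> v}) \<le> 2 * real n / N" for v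
  proof -
    have "{u \<in> D. \<kappa> u = \<kappa> v} \<subseteq> {(v div L) * L..<(v div L) * L + L}"
    proof
      fix u assume "u \<in> {u \<in> D. \<kappa> u = \<kappa> v}"
      then have "u = (v div L) * L + u mod L" using div_mult_mod_eq[of u L] by (simp add: \<kappa>_def)
      moreover have "u mod L < L" by (simp add: L_def)
      ultimately show "u \<in> {(v div L) * L..<(v div L) * L + L}" by (metis atLeastLessThan_iff le_add1 nat_add_left_cancel_less)
    qed
    then have "card {u \<in> D. \<kappa> u = \<kappa> v} \<le> card {(v div L) * L..<(v div L) * L + L}" by (intro card_mono) auto
    then have "real (card {u \<in> D. \<kappa> u = \<kappa> v}) \<le> real L" by simp
    then show ?thesis using Lle by simp
  qed
  ultimately show ?thesis using order.trans[OF order.trans[OF sub(1,2)] sub(3)] nuk unfolding w_def w'_def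
    by - (rule exI[of _ D], rule exI[of _ \<kappa>], rule exI[of _ \<nu>], intro conjI ballI impI; blast)
qed

text \<open>A single choice of representatives must achieve two things: a small total disagreement
  between the coarse classes, and no inhomogeneous pair among the fine classes of the
  representatives. Both enter one functional \<open>F\<close> whose expectation is below 1. A choice
  with value below 1 has no bad pair, since each would contribute 1.\<close>

lemma ex_close_blowup:
  fixes N M n G :: nat and \<kappa> :: "nat \<Rightarrow> 'k" and \<nu> :: "nat \<Rightarrow> 'l" and w' :: real
  assumes T: "tournament n T" and n: "n > 0" and N: "N \<ge> 5" "M > 0" and G: "G > 0"
    and D: "D \<subseteq> {..<n}" "real (card ({..<n} - D)) \<le> 4 * real n / N"
    and dk: "\<forall>u\<in>D. \<forall>v\<in>D. \<kappa> u = \<kappa> v \<longrightarrow> real (card (diff_nbrs n T u v)) \<le> 2 * real n / N"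
    and dn: "\<forall>u\<in>D. \<forall>v\<in>D. \<nu> u = \<nu> v \<longrightarrow> real (card (diff_nbrs n T u v)) \<le> 2 * real n / M"
    and nk: "\<forall>u\<in>D. \<forall>v\<in>D. \<nu> u = \<nu> v \<longrightarrow> \<kappa> u = \<kappa> v"
    and w': "w' > 0" "\<forall>v\<in>D. w' \<le> real (card {u \<in> D. \<kappa> u = \<kappa> v})"
    and up: "\<forall>v\<in>D. real (card {u \<in> D. \<kappa> u = \<kappa> v}) \<le> 2 * real n / N"
    and M: "32 * real G ^ 2 * real n ^ 2 \<le> M * w' ^ 2"
    and W: "\<And>a. W a = {u \<in> D. \<nu> u = \<nu> a}"
  shows "\<exists>x \<pi>. (\<forall>i\<in>\<kappa> ` D. x i \<in> D \<and> \<kappa> (x i) = i) \<and> (\<forall>v<n. \<pi> v \<in> \<kappa> ` D) \<and>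
    (\<forall>i\<in>\<kappa> ` D. \<forall>j\<in>\<kappa> ` D - {i}. real (card (disagree T (W (x i)) (W (x j)) (x i) (x j))) \<le>
        1 / (2 * real G ^ 2) * (real (card (W (x i))) * real (card (W (x j))))) \<and>
    real (card {(u, v) \<in> T. \<not> (if \<pi> u = \<pi> v then u < v else (x (\<pi> u), x (\<pi> v)) \<in> T)}) \<le> 26 * real n ^ 2 / N"
proof -
  note dk = dk[rule_format] and dn = dn[rule_format] and nk = nk[rule_format]
    and w' = w'(1) w'(2)[rule_format] and up = up[rule_format]
  define I where "I = \<kappa> ` D"
  \<comment> \<open>This is the proportion of wrong arcs per pair that the union bound over pairs of
    at most \<open>G\<close> sampled vertices tolerates.\<close>
  define \<gamma> where "\<gamma> = 1 / (2 * real G ^ 2)"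
  define cls where "cls i = {u \<in> D. \<kappa> u = i}" for i
  define bad where "bad a b \<longleftrightarrow> \<gamma> * (real (card (W a)) * real (card (W b))) < real (card (disagree T (W a) (W b) a b))" for a b
  have \<gamma>: "\<gamma> > 0" using G by (simp add: \<gamma>_def)
  have finD: "finite D" using D(1) finite_subset by blast
  then have finI: "finite I" and finc: "finite (cls i)" and finW: "finite (W a)" for i a by (simp_all add: I_def cls_def W)
  have cardD: "real (card D) \<le> real n" using card_mono[OF _ D(1)] by simp
  have clsI: "cls i \<noteq> {}" "w' \<le> real (card (cls i))" "real (card (cls i)) \<le> 2 * real n / N" if "i \<in> I" for i
    using that w'(2) up by (auto simp: I_def cls_def)
  have coarse: "(\<Sum>i\<in>I. \<Sum>j\<in>I - {i}. (\<Sum>a\<in>cls i. \<Sum>b\<in>cls j. real (card (disagree T (cls i) (cls j) a b))) /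
      (real (card (cls i)) * real (card (cls j)))) \<le> 4 * real n ^ 2 / N"
  proof -
    have "(\<Sum>i\<in>I. \<Sum>j\<in>I - {i}. (\<Sum>a\<in>cls i. \<Sum>b\<in>cls j. real (card (disagree T (cls i) (cls j) a b))) /
      (real (card (cls i)) * real (card (cls j)))) \<le> 2 * (2 * real n / N) * real (card D)"
      unfolding I_def by (rule homogeneity_sum_le[OF T D(1) dk]) (auto simp: cls_def)
    also have "\<dots> \<le> 2 * (2 * real n / N) * real n" using cardD by (intro mult_left_mono) auto
    finally show ?thesis by (simp add: power2_eq_square)
  qed
  define Bad where "Bad = {(a, b) \<in> D \<times> D. \<nu> a \<noteq> \<nu> b \<and> bad a b}"
  have finBad: "finite Bad" unfolding Bad_def using finD by (auto intro: finite_subset[of _ "D \<times> D"])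
  have cardBad: "real (card Bad) \<le> 4 * real n ^ 2 / (M * \<gamma>)"
  proof -
    define P where "P = \<nu> ` D"
    define pc where "pc p = {u \<in> D. \<nu> u = p}" for p
    have finP: "finite P" "finite (pc p)" for p using finD by (auto simp: P_def pc_def)
    have "(\<Sum>p\<in>P. \<Sum>q\<in>P - {p}. (\<Sum>a\<in>pc p. \<Sum>b\<in>pc q. real (card (disagree T (pc p) (pc q) a b))) /
      (real (card (pc p)) * real (card (pc q)))) \<le> 2 * (2 * real n / M) * real (card D)"
      unfolding P_def by (rule homogeneity_sum_le[OF T D(1) dn]) (auto simp: pc_def)
    also have "\<dots> \<le> 2 * (2 * real n / M) * real n" using cardD by (intro mult_left_mono) auto
    finally have 1: "(\<Sum>p\<in>P. \<Sum>q\<in>P - {p}. (\<Sum>a\<in>pc p. \<Sum>b\<in>pc q. real (card (disagree T (pc p) (pc q) a b))) /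
      (real (card (pc p)) * real (card (pc q)))) \<le> 4 * real n ^ 2 / M" by (simp add: power2_eq_square)
    have "Bad \<subseteq> (\<Union>p\<in>P. \<Union>q\<in>P - {p}. {x \<in> pc p \<times> pc q. bad (fst x) (snd x)})"
      by (auto simp: Bad_def P_def pc_def)
    then have "card Bad \<le> card (\<Union>p\<in>P. \<Union>q\<in>P - {p}. {x \<in> pc p \<times> pc q. bad (fst x) (snd x)})"
      using finP by (intro card_mono) auto
    also have "\<dots> \<le> (\<Sum>p\<in>P. card (\<Union>q\<in>P - {p}. {x \<in> pc p \<times> pc q. bad (fst x) (snd x)}))"
      using finP(1) by (rule card_UN_le)
    also have "\<dots> \<le> (\<Sum>p\<in>P. \<Sum>q\<in>P - {p}. card {x \<in> pc p \<times> pc q. bad (fst x) (snd x)})"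
      using finP(1) by (intro sum_mono card_UN_le) auto
    finally have "real (card Bad) * \<gamma> \<le> (\<Sum>p\<in>P. \<Sum>q\<in>P - {p}. real (card {x \<in> pc p \<times> pc q. bad (fst x) (snd x)})) * \<gamma>"
      using \<gamma> by (intro mult_right_mono) (auto simp flip: of_nat_sum)
    also have "\<dots> = (\<Sum>p\<in>P. \<Sum>q\<in>P - {p}. real (card {x \<in> pc p \<times> pc q. bad (fst x) (snd x)}) * \<gamma>)"
      by (simp only: sum_distrib_right)
    also have "\<dots> \<le> (\<Sum>p\<in>P. \<Sum>q\<in>P - {p}. (\<Sum>a\<in>pc p. \<Sum>b\<in>pc q. real (card (disagree T (pc p) (pc q) a b))) /
      (real (card (pc p)) * real (card (pc q))))"
    proof (intro sum_mono)
      fix p q assume pq: "p \<in> P" "q \<in> P - {p}"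
      define c where "c = real (card (pc p)) * real (card (pc q))"
      have "pc p \<noteq> {}" "pc q \<noteq> {}" using pq by (auto simp: P_def pc_def)
      then have "card (pc p) > 0" "card (pc q) > 0" using finP by (simp_all add: card_gt_0_iff)
      then have c: "c > 0" by (simp add: c_def)
      have "real (card {x \<in> pc p \<times> pc q. bad (fst x) (snd x)}) * (\<gamma> * c) = (\<Sum>x\<in>{x \<in> pc p \<times> pc q. bad (fst x) (snd x)}. \<gamma> * c)"
        by simp
      also have "\<dots> \<le> (\<Sum>x\<in>{x \<in> pc p \<times> pc q. bad (fst x) (snd x)}. real (card (disagree T (pc p) (pc q) (fst x) (snd x))))"
      proof (rule sum_mono)
        fix x assume x: "x \<in> {x \<in> pc p \<times> pc q. bad (fst x) (snd x)}"
        then have "W (fst x) = pc p" "W (snd x) = pc q" by (auto simp: W pc_def)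
        then show "\<gamma> * c \<le> real (card (disagree T (pc p) (pc q) (fst x) (snd x)))" using x by (simp add: bad_def c_def)
      qed
      also have "\<dots> \<le> (\<Sum>x\<in>pc p \<times> pc q. real (card (disagree T (pc p) (pc q) (fst x) (snd x))))"
        using finP by (intro sum_mono2) auto
      also have "\<dots> = (\<Sum>a\<in>pc p. \<Sum>b\<in>pc q. real (card (disagree T (pc p) (pc q) a b)))"
        by (simp add: sum.cartesian_product split_def)
      finally show "real (card {x \<in> pc p \<times> pc q. bad (fst x) (snd x)}) * \<gamma> \<le>
        (\<Sum>a\<in>pc p. \<Sum>b\<in>pc q. real (card (disagree T (pc p) (pc q) a b))) / (real (card (pc p)) * real (card (pc q)))"
        using c unfolding c_def[symmetric] by (simp add: field_simps)
    qed
    finally have "real (card Bad) * \<gamma> \<le> 4 * real n ^ 2 / M" using 1 by linarith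
    then show ?thesis using \<gamma> N(2) by (simp add: field_simps)
  qed
  \<comment> \<open>The first term is scaled to have total expectation at most 1/4. So has the
    second by the lower bound on \<open>M\<close>: a given pair of vertices from different coarse
    classes is chosen with probability at most 1/w'^2, and the fine scale leaves few bad
    pairs.\<close>
  define F where "F i j a b = real (card (disagree T (cls i) (cls j) a b)) * (N / (16 * real n ^ 2)) + (if bad a b then 1 else 0)" for i j a b
  have avg: "(\<Sum>i\<in>I. \<Sum>j\<in>I - {i}. (\<Sum>a\<in>cls i. \<Sum>b\<in>cls j. F i j a b) / (real (card (cls i)) * real (card (cls j)))) < 1"
  proof -
    have "(\<Sum>i\<in>I. \<Sum>j\<in>I - {i}. (\<Sum>a\<in>cls i. \<Sum>b\<in>cls j. if bad a b then 1 else 0 :: real) / (real (card (cls i)) * real (card (cls j))))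
      \<le> (\<Sum>i\<in>I. \<Sum>j\<in>I - {i}. real (card {x \<in> cls i \<times> cls j. bad (fst x) (snd x)}) / w' ^ 2)"
    proof (intro sum_mono)
      fix i j assume ij: "i \<in> I" "j \<in> I - {i}"
      have "(\<Sum>a\<in>cls i. \<Sum>b\<in>cls j. if bad a b then 1 else 0 :: real) = (\<Sum>x\<in>cls i \<times> cls j. if bad (fst x) (snd x) then 1 else 0)"
        by (simp add: sum.cartesian_product split_def)
      also have "\<dots> = real (card {x \<in> cls i \<times> cls j. bad (fst x) (snd x)})"
        using finc by (simp add: sum.If_cases Int_def mem_Times_iff conj_assoc)
      finally have "(\<Sum>a\<in>cls i. \<Sum>b\<in>cls j. if bad a b then 1 else 0 :: real) / (real (card (cls i)) * real (card (cls j))) =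
        real (card {x \<in> cls i \<times> cls j. bad (fst x) (snd x)}) / (real (card (cls i)) * real (card (cls j)))" by simp
      also have "\<dots> \<le> real (card {x \<in> cls i \<times> cls j. bad (fst x) (snd x)}) / w' ^ 2"
        unfolding power2_eq_square using w'(1) clsI(2)[of i] clsI(2)[of j] ij
        by (intro divide_left_mono mult_mono mult_pos_pos) auto
      finally show "(\<Sum>a\<in>cls i. \<Sum>b\<in>cls j. if bad a b then 1 else 0 :: real) / (real (card (cls i)) * real (card (cls j))) \<le>
        real (card {x \<in> cls i \<times> cls j. bad (fst x) (snd x)}) / w' ^ 2" .
    qed
    also have "\<dots> = (\<Sum>i\<in>I. \<Sum>j\<in>I - {i}. real (card {x \<in> cls i \<times> cls j. bad (fst x) (snd x)})) / w' ^ 2"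
      by (simp only: sum_divide_distrib)
    also have "(\<Sum>i\<in>I. \<Sum>j\<in>I - {i}. real (card {x \<in> cls i \<times> cls j. bad (fst x) (snd x)})) \<le> real (card Bad)"
    proof -
      have "(\<Sum>i\<in>I. \<Sum>j\<in>I - {i}. card {x \<in> cls i \<times> cls j. bad (fst x) (snd x)}) =
          (\<Sum>p\<in>(SIGMA i:I. I - {i}). card {x \<in> cls (fst p) \<times> cls (snd p). bad (fst x) (snd x)})"
        using finI by (subst sum.Sigma) (auto simp: split_def)
      also have "\<dots> = card (\<Union>p\<in>(SIGMA i:I. I - {i}). {x \<in> cls (fst p) \<times> cls (snd p). bad (fst x) (snd x)})"
        using finI finc by (intro card_UN_disjoint[symmetric]) (auto simp: cls_def)
      also have "\<dots> \<le> card Bad"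
      proof (intro card_mono finBad subsetI)
        fix e assume "e \<in> (\<Union>p\<in>(SIGMA i:I. I - {i}). {x \<in> cls (fst p) \<times> cls (snd p). bad (fst x) (snd x)})"
        then obtain p where p: "p \<in> (SIGMA i:I. I - {i})" "e \<in> {x \<in> cls (fst p) \<times> cls (snd p). bad (fst x) (snd x)}" by blast
        obtain i j a b where "p = (i, j)" and e: "e = (a, b)" by (cases p, cases e)
        then have e: "e = (a, b)" "a \<in> cls i" "b \<in> cls j" "i \<noteq> j" "bad a b" using p by auto
        then have ab: "a \<in> D" "b \<in> D" "\<kappa> a \<noteq> \<kappa> b" by (auto simp: cls_def)
        then have "\<nu> a \<noteq> \<nu> b" using nk by blast
        then show "e \<in> Bad" using e ab by (simp add: Bad_def)
      qed
      finally show ?thesis by (simp flip: of_nat_sum)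
    qed
    also have "real (card Bad) / w' ^ 2 \<le> 4 * real n ^ 2 / (M * \<gamma>) / w' ^ 2"
      using cardBad by (intro divide_right_mono) auto
    also have "\<dots> = (32 * real G ^ 2 * real n ^ 2) / (M * w' ^ 2) / 4" using G by (simp add: \<gamma>_def)
    also have "\<dots> \<le> 1 / 4"
    proof (rule divide_right_mono)
      have "M * w' ^ 2 > 0" using N w'(1) by simp
      then show "32 * real G ^ 2 * real n ^ 2 / (M * w' ^ 2) \<le> 1" using M by (simp only: divide_le_eq_1_pos)
    qed simp
    finally have 2: "(\<Sum>i\<in>I. \<Sum>j\<in>I - {i}. (\<Sum>a\<in>cls i. \<Sum>b\<in>cls j. if bad a b then 1 else 0 :: real) / (real (card (cls i)) * real (card (cls j)))) \<le> 1 / 4"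
      by (meson divide_right_mono order.trans zero_le_power2)
    have "(\<Sum>i\<in>I. \<Sum>j\<in>I - {i}. (\<Sum>a\<in>cls i. \<Sum>b\<in>cls j. F i j a b) / (real (card (cls i)) * real (card (cls j)))) =
      (\<Sum>i\<in>I. \<Sum>j\<in>I - {i}. (\<Sum>a\<in>cls i. \<Sum>b\<in>cls j. real (card (disagree T (cls i) (cls j) a b))) /
      (real (card (cls i)) * real (card (cls j)))) * (N / (16 * real n ^ 2)) +
      (\<Sum>i\<in>I. \<Sum>j\<in>I - {i}. (\<Sum>a\<in>cls i. \<Sum>b\<in>cls j. if bad a b then 1 else 0 :: real) / (real (card (cls i)) * real (card (cls j))))"
      unfolding F_def by (simp only: sum.distrib add_divide_distrib sum_distrib_right times_divide_eq_left sum_divide_distrib)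
    also have "\<dots> \<le> 4 * real n ^ 2 / N * (N / (16 * real n ^ 2)) + 1 / 4"
      using coarse 2 by (intro add_mono mult_right_mono) auto
    also have "\<dots> < 1" using n N by simp
    finally show ?thesis .
  qed
  have "\<exists>f\<in>PiE I cls. (\<Sum>i\<in>I. \<Sum>j\<in>I - {i}. F i j (f i) (f j)) \<le>
    (\<Sum>i\<in>I. \<Sum>j\<in>I - {i}. (\<Sum>a\<in>cls i. \<Sum>b\<in>cls j. F i j a b) / (real (card (cls i)) * real (card (cls j))))"
    using finI finc clsI(1) by (intro ex_representatives) (auto simp: F_def)
  then obtain x where x: "x \<in> PiE I cls" and "(\<Sum>i\<in>I. \<Sum>j\<in>I - {i}. F i j (x i) (x j)) < 1" using avg by (meson le_less_trans)
  then have Fx: "(\<Sum>p\<in>(SIGMA i:I. I - {i}). F (fst p) (snd p) (x (fst p)) (x (snd p))) < 1"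
    using finI by (subst (asm) sum.Sigma) (auto simp: split_def)
  have F0: "F i j a b \<ge> 0" for i j a b by (simp add: F_def)
  have finS: "finite (SIGMA i:I. I - {i})" using finI by auto
  have xi: "x i \<in> D" "\<kappa> (x i) = i" if "i \<in> I" for i using x that by (auto simp: cls_def PiE_iff)
  have good: "\<not> bad (x i) (x j)" if "i \<in> I" "j \<in> I - {i}" for i j
  proof
    assume "bad (x i) (x j)"
    then have "1 \<le> F (fst (i, j)) (snd (i, j)) (x (fst (i, j))) (x (snd (i, j)))" by (simp add: F_def)
    also have "\<dots> \<le> (\<Sum>p\<in>(SIGMA i:I. I - {i}). F (fst p) (snd p) (x (fst p)) (x (snd p)))"
      using that F0 by (intro member_le_sum finS) auto
    finally show False using Fx by simp
  qed
  have dis: "(\<Sum>p\<in>(SIGMA i:I. I - {i}). real (card (disagree T (cls (fst p)) (cls (snd p)) (x (fst p)) (x (snd p))))) \<le> 16 * real n ^ 2 / N"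
  proof -
    have "(\<Sum>p\<in>(SIGMA i:I. I - {i}). real (card (disagree T (cls (fst p)) (cls (snd p)) (x (fst p)) (x (snd p)))) * (N / (16 * real n ^ 2)))
      \<le> (\<Sum>p\<in>(SIGMA i:I. I - {i}). F (fst p) (snd p) (x (fst p)) (x (snd p)))"
      by (intro sum_mono) (simp add: F_def)
    then have "(\<Sum>p\<in>(SIGMA i:I. I - {i}). real (card (disagree T (cls (fst p)) (cls (snd p)) (x (fst p)) (x (snd p))))) * (N / (16 * real n ^ 2)) \<le> 1"
      using Fx unfolding sum_distrib_right by linarith
    then show ?thesis using n N by (simp add: field_simps)
  qed
  have "D \<noteq> {}"
  proof
    assume "D = {}"
    then have "real n \<le> 4 * real n / N" using D(2) by simp
    moreover have "4 * real n / N < real n" using n N by (simp add: field_simps)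
    ultimately show False by simp
  qed
  \<comment> \<open>Vertices outside \<open>D\<close> join an arbitrary class; all their arcs are
    counted as changed.\<close>
  then obtain i0 where i0: "i0 \<in> I" by (auto simp: I_def)
  define \<pi> where "\<pi> v = (if v \<in> D then \<kappa> v else i0)" for v
  have \<pi>I: "\<pi> v \<in> I" for v using i0 by (simp add: \<pi>_def I_def)
  define Z where "Z = {(u, v) \<in> T. \<not> (if \<pi> u = \<pi> v then u < v else (x (\<pi> u), x (\<pi> v)) \<in> T)}"
  define B where "B = {..<n} - D"
  have "real (card Z) \<le> 26 * real n ^ 2 / N"
  proof -
    have Zsub: "Z \<subseteq> (B \<times> {..<n} \<union> {..<n} \<times> B) \<union> ((\<Union>i\<in>I. cls i \<times> cls i) \<union>
      (\<Union>p\<in>(SIGMA i:I. I - {i}). disagree T (cls (fst p)) (cls (snd p)) (x (fst p)) (x (snd p))))" (is "_ \<subseteq> ?Z1 \<union> (?Z2 \<union> ?Z3)")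
    proof
      fix e assume e: "e \<in> Z"
      obtain u v where uv: "e = (u, v)" by (cases e)
      have un: "u < n" "v < n" "(u, v) \<in> T" using e uv T unfolding Z_def tournament_def by auto
      consider "u \<in> B \<or> v \<in> B" | "u \<in> D" "v \<in> D" "\<kappa> u = \<kappa> v" | "u \<in> D" "v \<in> D" "\<kappa> u \<noteq> \<kappa> v"
        using un D by (auto simp: B_def)
      then show "e \<in> ?Z1 \<union> (?Z2 \<union> ?Z3)"
      proof cases
        case 1
        then show ?thesis using un uv by (auto simp: B_def)
      next
        case 2
        then have "e \<in> cls (\<kappa> u) \<times> cls (\<kappa> u)" "\<kappa> u \<in> I" by (auto simp: uv cls_def I_def)
        then show ?thesis by blast
      next
        case 3
        then have "(x (\<kappa> u), x (\<kappa> v)) \<notin> T" using e by (auto simp: uv Z_def \<pi>_def)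
        then have "e \<in> disagree T (cls (fst (\<kappa> u, \<kappa> v))) (cls (snd (\<kappa> u, \<kappa> v))) (x (fst (\<kappa> u, \<kappa> v))) (x (snd (\<kappa> u, \<kappa> v)))"
          using 3 un by (simp add: disagree_def cls_def uv)
        moreover have "(\<kappa> u, \<kappa> v) \<in> (SIGMA i:I. I - {i})" using 3 by (auto simp: I_def)
        ultimately show ?thesis by blast
      qed
    qed
    have findis: "finite (disagree T A B' a b)" if "finite A" "finite B'" for A B' a b
      unfolding disagree_def using that by (auto intro: finite_subset[of _ "A \<times> B'"])
    have "card Z \<le> card (?Z1 \<union> (?Z2 \<union> ?Z3))"
      using finI finc finS by (intro card_mono[OF _ Zsub] finite_UnI finite_UN_I findis) (auto simp: B_def)
    also have "\<dots> \<le> (card (B \<times> {..<n}) + card ({..<n} \<times> B)) + (card ?Z2 + card ?Z3)"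
      by (meson add_mono card_Un_le order.trans)
    also have "\<dots> \<le> (card B * n + n * card B) + ((\<Sum>i\<in>I. card (cls i \<times> cls i)) +
       (\<Sum>p\<in>(SIGMA i:I. I - {i}). card (disagree T (cls (fst p)) (cls (snd p)) (x (fst p)) (x (snd p)))))"
      by (intro add_mono card_UN_le finI finS) (simp_all add: card_cartesian_product)
    finally have "real (card Z) \<le> real ((card B * n + n * card B) + ((\<Sum>i\<in>I. card (cls i \<times> cls i)) +
       (\<Sum>p\<in>(SIGMA i:I. I - {i}). card (disagree T (cls (fst p)) (cls (snd p)) (x (fst p)) (x (snd p))))))"
      by (simp only: of_nat_le_iff)
    then have 1: "real (card Z) \<le> 2 * (real (card B) * real n) + ((\<Sum>i\<in>I. real (card (cls i)) * real (card (cls i))) +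
       (\<Sum>p\<in>(SIGMA i:I. I - {i}). real (card (disagree T (cls (fst p)) (cls (snd p)) (x (fst p)) (x (snd p))))))"
      by (simp add: card_cartesian_product mult.commute[of "real n"])
    have 2: "real (card B) * real n \<le> (4 * real n / N) * real n" using D(2) unfolding B_def by (rule mult_right_mono) simp
    have "(\<Sum>i\<in>I. real (card (cls i)) * real (card (cls i))) \<le> (\<Sum>i\<in>I. real (card (cls i)) * (2 * real n / N))"
      using clsI(3) by (intro sum_mono mult_left_mono) auto
    also have "\<dots> = (\<Sum>i\<in>I. real (card (cls i))) * (2 * real n / N)" by (simp only: sum_distrib_right)
    also have "(\<Sum>i\<in>I. real (card (cls i))) = real (card D)"
      using sum_card_classes[OF finD, of \<kappa>] by (simp add: cls_def I_def flip: of_nat_sum)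
    also have "real (card D) * (2 * real n / N) \<le> real n * (2 * real n / N)" using cardD by (intro mult_right_mono) auto
    finally have 3: "(\<Sum>i\<in>I. real (card (cls i)) * real (card (cls i))) \<le> real n * (2 * real n / N)" .
    \<comment> \<open>26 = 8 + 2 + 16: arcs at exceptional vertices, arcs inside coarse classes, and
      arcs that disagree with the representatives of their classes.\<close>
    have "real (card Z) \<le> 2 * ((4 * real n / N) * real n) + (real n * (2 * real n / N) + 16 * real n ^ 2 / N)"
      using 1 2 3 dis by linarith
    also have "\<dots> = 26 * real n ^ 2 / N" using N by (simp add: field_simps power2_eq_square)
    finally show ?thesis .
  qed
  moreover have "real (card (disagree T (W (x i)) (W (x j)) (x i) (x j))) \<le>
        1 / (2 * real G ^ 2) * (real (card (W (x i))) * real (card (W (x j))))" if "i \<in> I" "j \<in> I - {i}" for i j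
    using good[OF that] unfolding bad_def \<gamma>_def by simp
  ultimately show ?thesis using xi \<pi>I unfolding Z_def I_def[symmetric]
    by - (rule exI[of _ x], rule exI[of _ \<pi>], intro conjI ballI allI impI; blast)
qed

section \<open>Two-colourable oriented graphs are easy\<close>

text \<open>If \<open>T'\<close>, the blow-up of the tournament on the representatives \<open>x i\<close>, contained \<open>H\<close>, then so would
  most samples of \<open>2 ^ h\<close> vertices from each of the pieces \<open>W (x i)\<close>.\<close>
lemma few_embeddings_imp_close_H_free:
  fixes V :: "'a set"
  assumes H: "oriented_graph V E"
    and AB: "A \<union> B = V" "A \<inter> B = {}" "acyclic (induced_arcs E A)" "acyclic (induced_arcs E B)"
  shows "\<exists>b N1. \<forall>N\<ge>N1. \<exists>n0. \<forall>n\<ge>n0. \<forall>T. tournament n T \<longrightarrow> N ^ b * card (embeddings V E n T) < n ^ card V \<longrightarrow>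
    (\<exists>T'. tournament n T' \<and> H_free V E n T' \<and> real (tdist T T') \<le> 26 * real n ^ 2 / N)"
proof -
  define h where "h = card V"
  \<comment> \<open>A copy meets at most \<open>h\<close> classes and 2^h vertices are sampled from
    each; the added 1 keeps \<open>G\<close> positive for \<open>h = 0\<close>.\<close>
  define G where "G = h * 2 ^ h + 1"
  have finV: "finite V" and EV: "E \<subseteq> V \<times> V" using H by (auto simp: oriented_graph_def)
  obtain a N0 where net: "\<And>N n T. N \<ge> N0 \<Longrightarrow> tournament n T \<Longrightarrow> n > 0 \<Longrightarrow> N ^ a * card (embeddings V E n T) \<le> n ^ h \<Longrightarrow>
    \<exists>X\<subseteq>{..<n}. card X \<le> N ^ a \<and> N * card {v \<in> {..<n}. \<forall>x\<in>X. n < N * card (diff_nbrs n T v x)} \<le> n"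
    using net_exists_poly[OF H AB] unfolding h_def by meson
  \<comment> \<open>\<open>M = N ^ e\<close> has to dominate
    \<open>32 * G ^ 2 * N ^ (2 * (a + 2))\<close>, where the constant is at most
    \<open>N ^ 3\<close>. Fine pieces have at least n/N^s vertices. In \<open>b\<close>, the part
    \<open>1 + h + s * G\<close> pays for the final comparison, namely the factor 2, the choices of
    indices and one factor N^s for each sampled vertex; \<open>a\<close> and \<open>e * a\<close>
    pay for the nets at the scales \<open>N\<close> and \<open>M\<close>.\<close>
  define e where "e = 2 * a + 7"
  define s where "s = a + 2 + e * a"
  define b where "b = 1 + h + s * G + a + e * a"
  define N1 where "N1 = N0 + G + 32"
  have "\<exists>T'. tournament n T' \<and> H_free V E n T' \<and> real (tdist T T') \<le> 26 * real n ^ 2 / N"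
    if N: "N \<ge> N1" and n: "n \<ge> 2 * G ^ 2 * N ^ s + N" and T: "tournament n T"
      and few: "N ^ b * card (embeddings V E n T) < n ^ h" for N n T
  proof -
    define M where "M = N ^ e"
    have N_bounds: "N \<ge> N0" "N \<ge> G" "N \<ge> 32" "N > 0" using N by (auto simp: N1_def)
    have NM: "N \<le> M" unfolding M_def using N_bounds by (intro self_le_power) (auto simp: e_def)
    have n0: "n > 0" "n \<ge> N" using n N_bounds by auto
    have G0: "G > 0" by (simp add: G_def)
    have pw: "N ^ k * card (embeddings V E n T) \<le> n ^ h" if "k \<le> b" for k
    proof -
      have "N ^ k \<le> N ^ b" using that N_bounds by (intro power_increasing) auto
      then have "N ^ k * card (embeddings V E n T) \<le> N ^ b * card (embeddings V E n T)" by (rule mult_le_mono1)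
      then show ?thesis using few by linarith
    qed
    have "N ^ a * card (embeddings V E n T) \<le> n ^ h" by (rule pw) (simp add: b_def)
    then obtain X where X: "X \<subseteq> {..<n}" "card X \<le> N ^ a" "N * card {v \<in> {..<n}. \<forall>x\<in>X. n < N * card (diff_nbrs n T v x)} \<le> n"
      using net[OF N_bounds(1) T n0(1)] by blast
    have "M ^ a * card (embeddings V E n T) \<le> n ^ h"
      using pw[of "e * a"] by (simp add: M_def power_mult b_def)
    then obtain Y where Y: "Y \<subseteq> {..<n}" "card Y \<le> M ^ a" "M * card {v \<in> {..<n}. \<forall>x\<in>Y. n < M * card (diff_nbrs n T v x)} \<le> n"
      using net[OF _ T n0(1), of M] NM N_bounds(1) by auto
    obtain D and \<kappa> :: "nat \<Rightarrow> nat \<times> nat" and \<nu> :: "nat \<Rightarrow> (nat \<times> nat) \<times> nat" where D: "D \<subseteq> {..<n}" "real (card ({..<n} - D)) \<le> 4 * real n / N"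
      and P: "\<forall>u\<in>D. \<forall>v\<in>D. \<kappa> u = \<kappa> v \<longrightarrow> real (card (diff_nbrs n T u v)) \<le> 2 * real n / N"
        "\<forall>u\<in>D. \<forall>v\<in>D. \<nu> u = \<nu> v \<longrightarrow> real (card (diff_nbrs n T u v)) \<le> 2 * real n / M"
        "\<forall>u\<in>D. \<forall>v\<in>D. \<nu> u = \<nu> v \<longrightarrow> \<kappa> u = \<kappa> v"
        "\<forall>v\<in>D. real n / N ^ (a + 2) \<le> real (card {u \<in> D. \<kappa> u = \<kappa> v})"
        "\<forall>v\<in>D. real (card {u \<in> D. \<kappa> u = \<kappa> v}) \<le> 2 * real n / N"
        "\<forall>v\<in>D. real n / (N ^ (a + 2) * M ^ a) \<le> real (card {u \<in> D. \<nu> u = \<nu> v})"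
      using ex_regular_partition[OF n0(2,1) N_bounds(4) NM X Y] by (elim exE conjE) (rule that)
    define W where "W a = {u \<in> D. \<nu> u = \<nu> a}" for a
    have M_large: "32 * real G ^ 2 * real n ^ 2 \<le> M * (real n / N ^ (a + 2)) ^ 2"
    proof -
      have "32 * G ^ 2 \<le> N * N ^ 2" using N_bounds by (intro mult_mono power_mono) auto
      then have "32 * G ^ 2 * N ^ (2 * (a + 2)) \<le> N * N ^ 2 * N ^ (2 * (a + 2))" by (rule mult_le_mono1)
      also have "\<dots> = M" by (simp add: M_def e_def power_add[symmetric] add.commute flip: power_Suc)
      finally have "real (32 * G ^ 2 * N ^ (2 * (a + 2))) \<le> real M" by (simp only: of_nat_le_iff)
      then have "32 * real G ^ 2 * real N ^ (2 * (a + 2)) * real n ^ 2 \<le> real M * real n ^ 2"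
        by (intro mult_right_mono) simp_all
      moreover have "(real N ^ (a + 2)) ^ 2 = real N ^ (2 * (a + 2))" by (simp only: power_mult[symmetric] mult.commute)
      ultimately show ?thesis using N_bounds(4) by (simp add: power_divide field_simps)
    qed
    have "N \<ge> 5" "M > 0" "real n / N ^ (a + 2) > 0" using N_bounds NM n0 by simp_all
    obtain x \<pi> where x: "\<forall>i\<in>\<kappa> ` D. x i \<in> D \<and> \<kappa> (x i) = i"
      and \<pi>: "\<forall>v<n. \<pi> v \<in> \<kappa> ` D"
      and homog: "\<forall>i\<in>\<kappa> ` D. \<forall>j\<in>\<kappa> ` D - {i}. real (card (disagree T (W (x i)) (W (x j)) (x i) (x j))) \<le>
        1 / (2 * real G ^ 2) * (real (card (W (x i))) * real (card (W (x j))))"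
      and dist: "real (card {(u, v) \<in> T. \<not> (if \<pi> u = \<pi> v then u < v else (x (\<pi> u), x (\<pi> v)) \<in> T)}) \<le> 26 * real n ^ 2 / N"
      using ex_close_blowup[OF T n0(1) \<open>N \<ge> 5\<close> \<open>M > 0\<close> G0 D P(1-3) \<open>real n / N ^ (a + 2) > 0\<close> P(4,5) M_large W_def]
      by (elim exE conjE) (rule that)
    note P = P[rule_format] and homog = homog[rule_format] and \<pi> = \<pi>[rule_format]
    have x: "x i \<in> D" "\<kappa> (x i) = i" if "i \<in> \<kappa> ` D" for i using x that by blast+
    define T' where "T' = {(u, v) \<in> {..<n} \<times> {..<n}. if \<pi> u = \<pi> v then u < v else (x (\<pi> u), x (\<pi> v)) \<in> T}"
    have "tournament n T'"
      unfolding tournament_def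
    proof (intro conjI allI impI)
      fix u v assume uv: "u < n" "v < n" "u \<noteq> v"
      show "(u, v) \<in> T' \<longleftrightarrow> (v, u) \<notin> T'"
      proof (cases "\<pi> u = \<pi> v")
        case True
        then show ?thesis using uv by (auto simp: T'_def)
      next
        case False
        then have "x (\<pi> u) \<noteq> x (\<pi> v)" using x(2)[OF \<pi>[OF uv(1)]] x(2)[OF \<pi>[OF uv(2)]] by metis
        moreover have "x (\<pi> u) < n" "x (\<pi> v) < n" using x(1)[OF \<pi>] uv D(1) by auto
        moreover have "(u, v) \<in> T' \<longleftrightarrow> (x (\<pi> u), x (\<pi> v)) \<in> T" "(v, u) \<in> T' \<longleftrightarrow> (x (\<pi> v), x (\<pi> u)) \<in> T"
          using False False[symmetric] uv by (simp_all add: T'_def)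
        ultimately show ?thesis using tournament_total[OF T] by blast
      qed
    qed (auto simp: T'_def)
    moreover have "real (tdist T T') \<le> 26 * real n ^ 2 / N"
    proof -
      have "T \<subseteq> {..<n} \<times> {..<n}" using T by (simp add: tournament_def)
      then have "T - T' = {(u, v) \<in> T. \<not> (if \<pi> u = \<pi> v then u < v else (x (\<pi> u), x (\<pi> v)) \<in> T)}"
        by (auto simp: T'_def)
      then show ?thesis using dist by (simp add: tdist_def)
    qed
    moreover have "H_free V E n T'"
      unfolding H_free_iff
    proof
      assume "\<exists>\<phi>. embedding V E n T' \<phi>"
      then obtain \<phi> where \<phi>: "\<phi> ` V \<subseteq> {..<n}" "inj_on \<phi> V" "\<And>u v. (u, v) \<in> E \<Longrightarrow> (\<phi> u, \<phi> v) \<in> T'"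
        unfolding embedding_def by blast
      define J where "J = \<pi> ` \<phi> ` V"
      define I where "I = J \<times> {..<(2::nat) ^ h}"
      define Wt where "Wt p = W (x (fst p))" for p :: "(nat \<times> nat) \<times> nat"
      \<comment> \<open>Coincidences count as bad because the sample must be injective. Within one
        piece their proportion is the reciprocal of its size; the term
        \<open>2 * G ^ 2 * N ^ s\<close> in the lower bound on \<open>n\<close> makes this at most
        1/(2 G^2).\<close>
      define bad where "bad p p' u v \<longleftrightarrow> u = v \<or> fst p \<noteq> fst p' \<and> ((u, v) \<in> T \<longleftrightarrow> (x (fst p), x (fst p')) \<notin> T)"
        for p p' :: "(nat \<times> nat) \<times> nat" and u v
      have JD: "J \<subseteq> \<kappa> ` D" using \<phi>(1) \<pi> by (auto simp: J_def)
      have finD: "finite D" using D(1) finite_subset by blast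
      have finI: "finite I" using finV by (simp add: I_def J_def)
      have cI: "card I \<le> h * 2 ^ h" "card I \<le> G"
      proof -
        have "card J \<le> h" unfolding J_def h_def using finV by (meson card_image_le finite_imageI order.trans)
        then show "card I \<le> h * 2 ^ h" by (simp add: I_def card_cartesian_product)
        then show "card I \<le> G" by (simp add: G_def)
      qed
      define w where "w = real n / N ^ s"
      have weq: "w = real n / (N ^ (a + 2) * M ^ a)" by (simp add: w_def s_def M_def power_add power_mult)
      have w: "w \<ge> 2 * real G ^ 2" "w > 0"
      proof -
        have "real (2 * G ^ 2 * N ^ s) \<le> real n" using n by (simp only: of_nat_le_iff)
        then show "w \<ge> 2 * real G ^ 2" using N_bounds(4) by (simp add: w_def field_simps)
        show "w > 0" using n0 N_bounds(4) by (simp add: w_def)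
      qed
      have Wt: "finite (Wt p)" "w \<le> real (card (Wt p))" "Wt p \<subseteq> {..<n}" "Wt p \<noteq> {}" if "p \<in> I" for p
      proof -
        have "fst p \<in> J" using that by (auto simp: I_def)
        then have "x (fst p) \<in> D" using JD x(1) by blast
        then show "finite (Wt p)" "w \<le> real (card (Wt p))" "Wt p \<subseteq> {..<n}" "Wt p \<noteq> {}"
          using P(6) finD D(1) by (auto simp: Wt_def W_def weq)
      qed
      define \<gamma> where "\<gamma> = 1 / (2 * real G ^ 2)"
      have "real (card (PiE I Wt)) / 2 \<le> real (card {f \<in> PiE I Wt. \<forall>i\<in>I. \<forall>j\<in>I - {i}. \<not> bad i j (f i) (f j)})"
      proof (rule card_good_tuples_ge[where \<gamma> = \<gamma>])
        fix p p' assume p: "p \<in> I" "p' \<in> I" "p \<noteq> p'"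
        show "real (card {(u, v) \<in> Wt p \<times> Wt p'. bad p p' u v}) \<le> \<gamma> * (real (card (Wt p)) * real (card (Wt p')))"
        proof (cases "fst p = fst p'")
          case True
          then have eq: "Wt p' = Wt p" by (simp add: Wt_def)
          have "{(u, v) \<in> Wt p \<times> Wt p'. bad p p' u v} = (\<lambda>u. (u, u)) ` Wt p"
            using True eq by (auto simp: bad_def)
          then have "card {(u, v) \<in> Wt p \<times> Wt p'. bad p p' u v} \<le> card (Wt p)"
            using Wt(1)[OF p(1)] by (simp add: card_image_le)
          moreover have "1 \<le> \<gamma> * real (card (Wt p))"
            using w(1) Wt(2)[OF p(1)] G0 by (simp add: \<gamma>_def field_simps)
          then have "real (card (Wt p)) * 1 \<le> real (card (Wt p)) * (\<gamma> * real (card (Wt p)))" by (intro mult_left_mono) auto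
          ultimately show ?thesis unfolding eq by (simp add: mult_ac)
        next
          case False
          have "fst p \<in> J" "fst p' \<in> J" using p by (auto simp: I_def)
          then have fp: "fst p \<in> \<kappa> ` D" "fst p' \<in> \<kappa> ` D - {fst p}" using JD False by auto
          have "u \<noteq> v" if "u \<in> Wt p" "v \<in> Wt p'" for u v
          proof
            assume "u = v"
            then have "\<nu> (x (fst p)) = \<nu> (x (fst p'))" using that by (simp add: Wt_def W_def)
            moreover have "x (fst p) \<in> D" "x (fst p') \<in> D" using x(1) fp by blast+
            ultimately have "\<kappa> (x (fst p)) = \<kappa> (x (fst p'))" by (intro P(3))
            then show False using x(2)[of "fst p"] x(2)[of "fst p'"] fp False by simp
          qed
          then have "{(u, v) \<in> Wt p \<times> Wt p'. bad p p' u v} = disagree T (Wt p) (Wt p') (x (fst p)) (x (fst p'))"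
            using False by (auto simp: bad_def disagree_def)
          then show ?thesis using homog[OF fp] by (simp add: Wt_def \<gamma>_def)
        qed
      next
        have "real (card I) ^ 2 \<le> real G ^ 2" using cI(2) by (intro power_mono) auto
        then show "real (card I) ^ 2 * \<gamma> \<le> 1 / 2" using G0 by (simp add: \<gamma>_def field_simps)
      qed (use finI Wt in \<open>auto simp: \<gamma>_def\<close>)
      also have "\<dots> \<le> real (card {f \<in> I \<rightarrow>\<^sub>E {..<n}. \<exists>\<psi>. embedding V E n T \<psi> \<and> \<psi> ` V \<subseteq> f ` I})"
      proof (intro of_nat_mono card_mono)
        show "{f \<in> PiE I Wt. \<forall>i\<in>I. \<forall>j\<in>I - {i}. \<not> bad i j (f i) (f j)} \<subseteq>
          {f \<in> I \<rightarrow>\<^sub>E {..<n}. \<exists>\<psi>. embedding V E n T \<psi> \<and> \<psi> ` V \<subseteq> f ` I}"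
        proof clarify
          fix f assume f: "f \<in> PiE I Wt" "\<forall>i\<in>I. \<forall>j\<in>I - {i}. \<not> bad i j (f i) (f j)"
          have fn: "f p < n" if "p \<in> I" for p using f(1) Wt(3)[OF that] that by (auto simp: PiE_iff)
          have "\<exists>\<psi>. embedding V E n T \<psi> \<and> \<psi> ` V \<subseteq> f ` I"
          proof (rule embedding_from_blowup[OF T H \<phi>(2), where \<pi> = \<pi> and R = "\<lambda>i j. (x i, x j) \<in> T" and J = J])
            show "inj_on f I" using f(2) unfolding inj_on_def bad_def by blast
            show "(f p, f p') \<in> T" if "p \<in> I" "p' \<in> I" "fst p \<noteq> fst p'" "(x (fst p), x (fst p')) \<in> T" for p p'
              using f(2) that unfolding bad_def by blast
          qed (use \<phi>(3) fn in \<open>auto simp: T'_def J_def I_def h_def split: if_splits\<close>)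
          then show "f \<in> I \<rightarrow>\<^sub>E {..<n} \<and> (\<exists>\<psi>. embedding V E n T \<psi> \<and> \<psi> ` V \<subseteq> f ` I)"
            using f(1) fn by (auto simp: PiE_iff)
        qed
      qed (use finI in \<open>simp add: finite_PiE\<close>)
      finally have 1: "real (card (PiE I Wt)) / 2 \<le> real (card {f \<in> I \<rightarrow>\<^sub>E {..<n}. \<exists>\<psi>. embedding V E n T \<psi> \<and> \<psi> ` V \<subseteq> f ` I})" (is "_ \<le> real (card ?S)") .
      \<comment> \<open>At least half of the samples contain an embedding, so there are at least
        (n/N^s)^|I| / 2 such maps. The union bound for random maps limits their number in terms of
        the number of embeddings, and the two bounds together contradict \<open>few\<close>.\<close>
      have "w ^ card I = (\<Prod>p\<in>I. w)" by simp
      also have "\<dots> \<le> (\<Prod>p\<in>I. real (card (Wt p)))" using Wt w by (intro prod_mono) auto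
      also have "\<dots> = real (card (PiE I Wt))" using finI by (simp add: card_PiE)
      finally have "w ^ card I \<le> 2 * real (card ?S)" using 1 by simp
      then have "w ^ card I * real n ^ h \<le> 2 * (real (card ?S) * real n ^ h)" by (simp add: mult_right_mono flip: mult.assoc)
      also have "card ?S * n ^ h \<le> card I ^ h * card (embeddings V E n T) * n ^ card I"
        unfolding h_def by (rule card_maps_hitting_embedding[OF finV EV finI])
      then have "real (card ?S * n ^ h) \<le> real (card I ^ h * card (embeddings V E n T) * n ^ card I)" by (simp only: of_nat_le_iff)
      then have "2 * (real (card ?S) * real n ^ h) \<le> 2 * (real (card I) ^ h * real (card (embeddings V E n T)) * real n ^ card I)"
        by simp
      finally have "w ^ card I * real n ^ h * real N ^ (s * card I) \<le>
        2 * (real (card I) ^ h * real (card (embeddings V E n T)) * real n ^ card I) * real N ^ (s * card I)"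
        by (rule mult_right_mono) simp
      moreover have "w ^ card I * real N ^ (s * card I) = real n ^ card I"
        using N_bounds(4) by (simp add: w_def power_divide power_mult)
      then have "w ^ card I * real n ^ h * real N ^ (s * card I) = real n ^ card I * real n ^ h" by (metis mult.assoc mult.commute)
      ultimately have "real n ^ card I * real n ^ h \<le>
        real n ^ card I * (2 * real (card I) ^ h * real N ^ (s * card I) * real (card (embeddings V E n T)))"
        by (simp only: mult_ac)
      then have "real n ^ h \<le> 2 * real (card I) ^ h * real N ^ (s * card I) * real (card (embeddings V E n T))"
        using n0(1) by (simp only: mult_le_cancel_left_pos zero_less_power of_nat_0_less_iff)
      also have "\<dots> \<le> real N * real N ^ h * real N ^ (s * G) * real (card (embeddings V E n T))"
        using N_bounds cI(2) by (intro mult_right_mono mult_mono power_mono power_increasing) auto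
      also have "\<dots> = real (N ^ (1 + h + s * G) * card (embeddings V E n T))" by (simp add: power_add)
      also have "\<dots> \<le> real (N ^ b * card (embeddings V E n T))"
        using N_bounds by (intro of_nat_mono mult_le_mono1 power_increasing) (auto simp: b_def)
      also have "\<dots> < real (n ^ h)" using few by (simp only: of_nat_less_iff)
      finally show False by simp
    qed
    ultimately show ?thesis by blast
  qed
  note main = this
  show ?thesis unfolding h_def[symmetric]
  proof (rule exI[of _ b], rule exI[of _ N1], rule allI, rule impI)
    fix N assume N: "N1 \<le> N"
    show "\<exists>n0. \<forall>n\<ge>n0. \<forall>T. tournament n T \<longrightarrow> N ^ b * card (embeddings V E n T) < n ^ h \<longrightarrow>
      (\<exists>T'. tournament n T' \<and> H_free V E n T' \<and> real (tdist T T') \<le> 26 * real n ^ 2 / N)"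
      using main[OF N] by (intro exI[of _ "2 * G ^ 2 * N ^ s + N"] allI impI)
  qed
qed

lemma two_colorable_imp_easy:
  fixes V :: "'a set"
  assumes H: "oriented_graph V E"
    and AB: "A \<union> B = V" "A \<inter> B = {}" "acyclic (induced_arcs E A)" "acyclic (induced_arcs E B)"
  shows "easy V E"
proof -
  define h where "h = card V"
  have finV: "finite V" and EV: "E \<subseteq> V \<times> V" using H by (auto simp: oriented_graph_def)
  obtain b N1 where key: "\<And>N. N \<ge> N1 \<Longrightarrow> \<exists>n0. \<forall>n\<ge>n0. \<forall>T. tournament n T \<longrightarrow> N ^ b * card (embeddings V E n T) < n ^ h \<longrightarrow>
    (\<exists>T'. tournament n T' \<and> H_free V E n T' \<and> real (tdist T T') \<le> 26 * real n ^ 2 / N)"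
    using few_embeddings_imp_close_H_free[OF H AB] unfolding h_def by meson
  \<comment> \<open>\<open>N\<close> is at most 1/\<epsilon>^2, which gives the exponent
    \<open>b * 2\<close>, and h^h is at most 1/\<epsilon>^h. The summands of \<open>K\<close> ensure
    \<open>h \<le> 1 / \<epsilon>\<close>, \<open>28 / \<epsilon> \<le> 1 / \<epsilon> ^ 2\<close>
    and \<open>N1 \<le> N\<close>; the 27 in \<open>N\<close> lies above the 26 of the distance
    bound, so that a close \<open>H\<close>-free tournament contradicts farness strictly.\<close>
  define c where "c = b * 2 + h"
  define K where "K = h + 28 + N1"
  have "fstar V E \<epsilon> \<ge> ereal (\<epsilon> powr real c)" if \<epsilon>: "0 < \<epsilon>" "\<epsilon> < 1 / K" for \<epsilon>
  proof -
    define N where "N = nat \<lceil>27 / \<epsilon>\<rceil>"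
    have K: "real K \<ge> 28" by (simp add: K_def)
    then have K: "real K \<ge> 28" "real K \<le> 1 / \<epsilon>" "\<epsilon> < 1"
    proof -
      have "1 / real K \<le> 1 / 1" using K by (intro divide_left_mono) auto
      then show "\<epsilon> < 1" using \<epsilon>(2) by simp
      have "\<epsilon> * real K < 1" using \<epsilon>(2) K by (simp add: pos_less_divide_eq)
      then show "real K \<le> 1 / \<epsilon>" using \<epsilon>(1) by (simp add: pos_le_divide_eq mult.commute)
    qed (rule K)
    have N: "27 / \<epsilon> \<le> real N" "real N \<le> 27 / \<epsilon> + 1"
    proof -
      have "0 \<le> 27 / \<epsilon>" using \<epsilon>(1) by simp
      then show "27 / \<epsilon> \<le> real N" "real N \<le> 27 / \<epsilon> + 1" unfolding N_def by linarith+
    qed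
    have Nle: "real N \<le> (1 / \<epsilon>) ^ 2"
    proof -
      have "1 \<le> 1 / \<epsilon>" using \<epsilon>(1) K(3) by simp
      then have "real N \<le> 28 * (1 / \<epsilon>)" using N(2) by simp
      also have "\<dots> \<le> (1 / \<epsilon>) * (1 / \<epsilon>)" using K \<epsilon> by (intro mult_right_mono) auto
      finally show ?thesis by (simp add: power2_eq_square)
    qed
    have "real N1 \<le> 1 / \<epsilon>" using K(2) by (simp add: K_def)
    also have "\<dots> \<le> 27 / \<epsilon>" using \<epsilon>(1) by (intro divide_right_mono) auto
    finally have "N \<ge> N1" using N(1) by linarith
    then obtain n0 where n0: "\<And>n T. n \<ge> n0 \<Longrightarrow> tournament n T \<Longrightarrow> N ^ b * card (embeddings V E n T) < n ^ h \<Longrightarrow>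
      \<exists>T'. tournament n T' \<and> H_free V E n T' \<and> real (tdist T T') \<le> 26 * real n ^ 2 / N" using key by meson
    have "admissible V E \<epsilon> (\<epsilon> powr real c)"
      unfolding admissible_def
    proof (intro exI[of _ "n0 + 1"] allI impI, elim conjE)
      fix n T assume n: "n \<ge> n0 + 1" and T: "tournament n T" and far: "eps_far V E \<epsilon> n T"
      have "\<not> N ^ b * card (embeddings V E n T) < n ^ h"
      proof
        assume "N ^ b * card (embeddings V E n T) < n ^ h"
        then obtain T' where T': "tournament n T'" "H_free V E n T'" "real (tdist T T') \<le> 26 * real n ^ 2 / N"
          using n0[OF _ T] n by auto
        then have "\<epsilon> * real n ^ 2 \<le> 26 * real n ^ 2 / N" using far unfolding eps_far_def by force
        moreover have "26 * real n ^ 2 / N < \<epsilon> * real n ^ 2"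
        proof -
          have "27 \<le> \<epsilon> * N" using N(1) \<epsilon>(1) by (simp add: field_simps)
          moreover have "real N > 0" using N(1) divide_pos_pos[of 27 \<epsilon>] \<epsilon>(1) by linarith
          ultimately have "26 / real N < \<epsilon>" by (simp add: field_simps)
          then have "26 / real N * real n ^ 2 < \<epsilon> * real n ^ 2" using n by (intro mult_strict_right_mono) auto
          then show ?thesis by simp
        qed
        ultimately show False by simp
      qed
      then have "n ^ h \<le> N ^ b * card (embeddings V E n T)" by simp
      also have "\<dots> \<le> N ^ b * (h ^ h * num_copies V E n T)"
        unfolding h_def by (intro mult_le_mono2 card_embeddings_le_num_copies finV EV)
      finally have "real (n ^ h) \<le> real (N ^ b * (h ^ h * num_copies V E n T))" by (simp only: of_nat_le_iff)
      then have 1: "real n ^ h \<le> real N ^ b * (real h ^ h * real (num_copies V E n T))" by simp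
      have "real N ^ b * (real h ^ h * real (num_copies V E n T)) \<le> ((1 / \<epsilon>) ^ 2) ^ b * ((1 / \<epsilon>) ^ h * real (num_copies V E n T))"
        using Nle K \<epsilon> by (intro mult_mono power_mono mult_right_mono) (auto simp: K_def)
      also have "\<dots> = (1 / \<epsilon>) ^ c * real (num_copies V E n T)" by (simp add: c_def power_add power_mult[symmetric] mult.commute)
      finally have "real n ^ h \<le> (1 / \<epsilon>) ^ c * real (num_copies V E n T)" using 1 by linarith
      then have "\<epsilon> ^ c * real n ^ h \<le> \<epsilon> ^ c * ((1 / \<epsilon>) ^ c * real (num_copies V E n T))"
        using \<epsilon>(1) by (intro mult_left_mono) auto
      also have "\<dots> = real (num_copies V E n T)" using \<epsilon>(1) by (simp add: power_divide)
      finally show "\<epsilon> powr real c * real n ^ card V \<le> real (num_copies V E n T)"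
        using \<epsilon>(1) by (simp add: powr_realpow h_def)
    qed
    then show ?thesis unfolding fstar_def by (intro Sup_upper) auto
  qed
  moreover have "1 / real K > 0" by (simp add: K_def)
  ultimately show ?thesis unfolding easy_def by (intro exI[of _ "real c"] exI[of _ "1 / real K"]) auto
qed

section \<open>Cycles in the core of the back-arc graph\<close>

definition back_arcs :: "('a \<times> 'a) set \<Rightarrow> ('a \<Rightarrow> nat) \<Rightarrow> ('a \<times> 'a) set" where
  "back_arcs E p = {(u, v) \<in> E. p v < p u}"

text \<open>Greedy colouring: a vertex with at most one neighbour is removed, the rest is coloured,
  and the vertex receives the colour opposite to that of its neighbour.\<close>

lemma ex_two_coloring_if_degenerate:
  assumes "finite R" "\<And>a b. adj a b \<Longrightarrow> adj b a" "\<And>a. \<not> adj a a"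
    and "\<And>S. S \<subseteq> R \<Longrightarrow> S \<noteq> {} \<Longrightarrow> \<exists>v\<in>S. card {w \<in> S. adj v w} \<le> 1"
  shows "\<exists>c::'a \<Rightarrow> bool. \<forall>a\<in>R. \<forall>b\<in>R. adj a b \<longrightarrow> c a \<noteq> c b"
  using assms(1,4)
proof (induction R rule: finite_psubset_induct)
  case (psubset R)
  show ?case
  proof (cases "R = {}")
    case False
    then obtain v where v: "v \<in> R" "card {w \<in> R. adj v w} \<le> 1" using psubset.prems[of R] by auto
    have "R - {v} \<subset> R" using v by blast
    then have "\<exists>c::'a \<Rightarrow> bool. \<forall>a\<in>R - {v}. \<forall>b\<in>R - {v}. adj a b \<longrightarrow> c a \<noteq> c b"
    proof (rule psubset.IH)
      fix S assume "S \<subseteq> R - {v}" "S \<noteq> {}"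
      then show "\<exists>v\<in>S. card {w \<in> S. adj v w} \<le> 1" by (intro psubset.prems) auto
    qed
    then obtain c :: "'a \<Rightarrow> bool" where c: "\<And>a b. a \<in> R - {v} \<Longrightarrow> b \<in> R - {v} \<Longrightarrow> adj a b \<Longrightarrow> c a \<noteq> c b" by blast
    have "finite {w \<in> R. adj v w}" using psubset.hyps(1) by simp
    then have "\<forall>a\<in>{w \<in> R. adj v w}. \<forall>b\<in>{w \<in> R. adj v w}. a = b" using v(2) by (simp only: card_le_Suc0_iff_eq One_nat_def)
    then obtain s where s: "{w \<in> R. adj v w} \<subseteq> {s}" by (cases "{w \<in> R. adj v w} = {}") blast+
    define c' where "c' = c(v := \<not> c s)"
    have "c' a \<noteq> c' b" if ab: "a \<in> R" "b \<in> R" "adj a b" for a b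
    proof -
      have "a \<noteq> b" using ab(3) assms(3) by blast
      consider "a = v" | "b = v" | "a \<noteq> v" "b \<noteq> v" by blast
      then show ?thesis
      proof cases
        case 1
        then have "b = s" using s ab by blast
        then show ?thesis using 1 \<open>a \<noteq> b\<close> by (simp add: c'_def)
      next
        case 2
        then have "a = s" using s ab assms(2) by blast
        then show ?thesis using 2 \<open>a \<noteq> b\<close> by (simp add: c'_def)
      next
        case 3
        then show ?thesis using c[of a b] ab by (simp add: c'_def)
      qed
    qed
    then show ?thesis by blast
  qed simp
qed

text \<open>Some subset must have minimum degree at least 2. The first vertex of a longest path in
  it has all its neighbours on the path, and one beyond the second vertex closes a cycle. A cycle of
  any parity serves, since it is only used through a convex equation.\<close>

lemma ex_cycle_if_not_two_colorable:
  assumes fin: "finite R" and sym: "\<And>a b. adj a b \<Longrightarrow> adj b a" and irr: "\<And>a. \<not> adj a a"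
    and nc: "\<nexists>c::'a \<Rightarrow> bool. \<forall>a\<in>R. \<forall>b\<in>R. adj a b \<longrightarrow> c a \<noteq> c b"
  shows "\<exists>cs. 3 \<le> length cs \<and> distinct cs \<and> set cs \<subseteq> R \<and>
    (\<forall>i. Suc i < length cs \<longrightarrow> adj (cs ! i) (cs ! Suc i)) \<and> adj (cs ! 0) (cs ! (length cs - 1))"
proof -
  have "\<not> (\<forall>S. S \<subseteq> R \<longrightarrow> S \<noteq> {} \<longrightarrow> (\<exists>v\<in>S. card {w \<in> S. adj v w} \<le> 1))"
    using ex_two_coloring_if_degenerate[of R adj, OF fin sym irr] nc by blast
  then obtain S where S: "S \<subseteq> R" "S \<noteq> {}" "\<And>v. v \<in> S \<Longrightarrow> \<not> card {w \<in> S. adj v w} \<le> 1" by blast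
  define Path where "Path xs \<longleftrightarrow> xs \<noteq> [] \<and> distinct xs \<and> set xs \<subseteq> S \<and> (\<forall>i. Suc i < length xs \<longrightarrow> adj (xs ! i) (xs ! Suc i))" for xs
  obtain s where s: "s \<in> S" using S(2) by blast
  have finS: "finite S" using S(1) fin finite_subset by blast
  have "Path [s]" using s by (simp add: Path_def)
  moreover have "length xs < Suc (card S)" if "Path xs" for xs
    using that card_mono[OF finS, of "set xs"] by (simp add: Path_def distinct_card)
  ultimately obtain xs where xs: "Path xs" "\<And>ys. Path ys \<Longrightarrow> length ys \<le> length xs"
    using ex_has_greatest_nat[of Path "[s]" length "Suc (card S)"] by (metis less_imp_le)
  define x0 where "x0 = xs ! 0"
  have ne: "0 < length xs" using xs(1) by (simp add: Path_def)
  have x0: "x0 \<in> S" using xs(1) ne nth_mem[OF ne] by (auto simp: Path_def x0_def)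
  have nb: "w \<in> set xs" if w: "w \<in> S" "adj x0 w" for w
  proof (rule ccontr)
    assume "w \<notin> set xs"
    moreover have "adj ((w # xs) ! i) ((w # xs) ! Suc i)" if "Suc i < length (w # xs)" for i
      using that xs(1) sym[OF w(2)] by (cases i) (auto simp: Path_def x0_def)
    ultimately have "Path (w # xs)" using xs(1) w by (simp add: Path_def)
    then show False using xs(2) by fastforce
  qed
  have "\<not> {w \<in> S. adj x0 w} \<subseteq> {xs ! 1}"
  proof
    assume "{w \<in> S. adj x0 w} \<subseteq> {xs ! 1}"
    then have "card {w \<in> S. adj x0 w} \<le> card {xs ! 1}" by (intro card_mono) auto
    then show False using S(3)[OF x0] by simp
  qed
  then obtain w where w: "w \<in> S" "adj x0 w" "w \<noteq> xs ! 1" by blast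
  then obtain j where j: "j < length xs" "w = xs ! j" using nb by (metis in_set_conv_nth)
  have "j \<noteq> 0" using w irr j(2) by (metis x0_def)
  then have j2: "2 \<le> j" using w(3) j(2) by (cases j) (auto, metis One_nat_def Suc_lessI Suc_leI neq0_conv numeral_2_eq_2)
  define cs where "cs = take (Suc j) xs"
  have len: "length cs = Suc j" using j by (simp add: cs_def)
  have "3 \<le> length cs" using len j2 by simp
  moreover have "distinct cs" using xs(1) by (simp add: cs_def Path_def)
  moreover have "set cs \<subseteq> R" using xs(1) S(1) set_take_subset[of "Suc j" xs] unfolding cs_def Path_def by blast
  moreover have "adj (cs ! i) (cs ! Suc i)" if "Suc i < length cs" for i
    using that xs(1) j(1) len by (simp add: cs_def Path_def)
  moreover have "adj (cs ! 0) (cs ! (length cs - 1))" using w j len by (simp add: cs_def x0_def)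
  ultimately show ?thesis by blast
qed

text \<open>\<open>p\<close> is chosen so that its back arcs are minimal with respect to homomorphisms, and \<open>\<rho>\<close> retracts them onto
  their core. Minimality yields a homomorphism \<open>\<theta>\<close> back from \<open>back_arcs E p\<close> to \<open>back_arcs E \<phi>\<close>, and
  \<open>\<rho> \<circ> \<tau> \<circ> \<theta>\<close> is then an automorphism of the core; the core is not bipartite, so it contains a cycle.\<close>
lemma ex_rigid_cycle:
  fixes V :: "'a set"
  assumes H: "oriented_graph V E"
    and nc: "\<nexists>A B. A \<union> B = V \<and> A \<inter> B = {} \<and> acyclic (induced_arcs E A) \<and> acyclic (induced_arcs E B)"
  shows "\<exists>p \<rho> (cs :: 'a list). inj_on p V \<and> 3 \<le> length cs \<and> distinct cs \<and>
    (\<forall>\<phi> \<tau>. inj_on \<phi> V \<longrightarrow> \<tau> ` V \<subseteq> V \<longrightarrow> (\<forall>(u, v)\<in>back_arcs E \<phi>. (\<tau> u, \<tau> v) \<in> back_arcs E p) \<longrightarrow>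
      (\<exists>us. length us = length cs \<and> set us \<subseteq> V \<and> (\<forall>i<length cs. \<rho> (\<tau> (us ! i)) = cs ! i) \<and>
        (\<forall>i. Suc i < length us \<longrightarrow> (us ! i, us ! Suc i) \<in> back_arcs E \<phi> \<or> (us ! Suc i, us ! i) \<in> back_arcs E \<phi>) \<and>
        ((us ! 0, us ! (length us - 1)) \<in> back_arcs E \<phi> \<or> (us ! (length us - 1), us ! 0) \<in> back_arcs E \<phi>)))"
proof -
  have finV: "finite V" and EV: "E \<subseteq> V \<times> V" using H by (auto simp: oriented_graph_def)
  have finE: "finite E" using finV EV finite_subset by blast
  define hom where "hom f B B' \<longleftrightarrow> f ` V \<subseteq> V \<and> (\<forall>u v. (u, v) \<in> B \<longrightarrow> (f u, f v) \<in> B')"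
    for f :: "'a \<Rightarrow> 'a" and B B' :: "('a \<times> 'a) set"
  have hom_comp: "hom (g \<circ> f) B B''" if "hom f B B'" "hom g B' B''" for f g B B' B''
    using that unfolding hom_def by (auto simp: image_subset_iff)
  define BB where "BB = {back_arcs E p | p. inj_on p V}"
  have finBB: "finite BB" by (rule finite_subset[of _ "Pow E"]) (auto simp: BB_def back_arcs_def finE)
  \<comment> \<open>Minimality is measured by a count: if \<open>back_arcs E p\<close> has the
    smallest down-set, every back-arc graph that maps to it has the same down-set, and so receives a
    homomorphism from it.\<close>
  define down where "down B = {B' \<in> BB. \<exists>f. hom f B' B}" for B
  obtain e :: "'a \<Rightarrow> nat" where "inj_on e V" using finite_imp_inj_to_nat_seg[OF finV] by blast
  then have "\<exists>p::'a \<Rightarrow> nat. inj_on p V \<and> (\<forall>q. inj_on q V \<longrightarrow> card (down (back_arcs E p)) \<le> card (down (back_arcs E q)))"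
    using ex_has_least_nat[of "\<lambda>p. inj_on p V" e "\<lambda>p. card (down (back_arcs E p))"] by blast
  then obtain p :: "'a \<Rightarrow> nat" where p: "inj_on p V" "\<And>q. inj_on q V \<Longrightarrow> card (down (back_arcs E p)) \<le> card (down (back_arcs E q))" by blast
  define B where "B = back_arcs E p"
  have BV: "B \<subseteq> V \<times> V" "B \<subseteq> E" using EV by (auto simp: B_def back_arcs_def)
  have minimal: "\<exists>\<theta>. hom \<theta> B (back_arcs E q)" if q: "inj_on q V" "hom f (back_arcs E q) B" for q f
  proof -
    have "down (back_arcs E q) \<subseteq> down B" using q(2) hom_comp unfolding down_def by blast
    then have "down (back_arcs E q) = down B"
      using p(2)[OF q(1)] finBB by (intro card_seteq) (auto simp: down_def B_def)
    moreover have "B \<in> down B" unfolding down_def BB_def B_def using p(1) by (auto intro!: exI[of _ id] simp: hom_def)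
    ultimately show ?thesis unfolding down_def by blast
  qed
  \<comment> \<open>The image of an endomorphism with the fewest vertices is the core: no further
    endomorphism can shrink it.\<close>
  have "\<exists>\<rho>. hom \<rho> B B \<and> (\<forall>f. hom f B B \<longrightarrow> card (\<rho> ` V) \<le> card (f ` V))"
    using ex_has_least_nat[of "\<lambda>f. hom f B B" id "\<lambda>f. card (f ` V)"] by (auto simp: hom_def)
  then obtain \<rho> where \<rho>: "hom \<rho> B B" "\<And>f. hom f B B \<Longrightarrow> card (\<rho> ` V) \<le> card (f ` V)" by blast
  define R where "R = \<rho> ` V"
  define K where "K = B \<inter> R \<times> R"
  have RV: "R \<subseteq> V" using \<rho>(1) by (auto simp: hom_def R_def)
  have finR: "finite R" using finV by (simp add: R_def)
  define adj where "adj a b \<longleftrightarrow> (a, b) \<in> K \<or> (b, a) \<in> K" for a b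
  \<comment> \<open>A proper 2-colouring of the core, pulled back along \<open>\<rho>\<close>,
    leaves no back arc inside a colour class. Then \<open>p\<close> increases along the arcs of both
    classes, so both are acyclic, contrary to \<open>nc\<close>.\<close>
  have "\<nexists>c::'a \<Rightarrow> bool. \<forall>a\<in>R. \<forall>b\<in>R. adj a b \<longrightarrow> c a \<noteq> c b"
  proof
    assume "\<exists>c::'a \<Rightarrow> bool. \<forall>a\<in>R. \<forall>b\<in>R. adj a b \<longrightarrow> c a \<noteq> c b"
    then obtain c :: "'a \<Rightarrow> bool" where c: "\<And>a b. a \<in> R \<Longrightarrow> b \<in> R \<Longrightarrow> adj a b \<Longrightarrow> c a \<noteq> c b" by blast
    have acyc: "acyclic (induced_arcs E {v \<in> V. c (\<rho> v) = t})" for t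
    proof -
      have "p u < p v" if uv: "(u, v) \<in> induced_arcs E {v \<in> V. c (\<rho> v) = t}" for u v
      proof (rule ccontr)
        assume "\<not> p u < p v"
        moreover have uvV: "u \<in> V" "v \<in> V" "(u, v) \<in> E" "c (\<rho> u) = c (\<rho> v)" using uv by (auto simp: induced_arcs_def)
        moreover have "p u \<noteq> p v" using p(1) uvV H by (auto simp: oriented_graph_def inj_on_def)
        ultimately have "(u, v) \<in> B" by (simp add: B_def back_arcs_def)
        then have "(\<rho> u, \<rho> v) \<in> K" using \<rho>(1) uvV by (simp add: K_def hom_def R_def)
        then show False using c[of "\<rho> u" "\<rho> v"] uvV by (simp add: adj_def R_def)
      qed
      then have "acyclic ((induced_arcs E {v \<in> V. c (\<rho> v) = t})\<inverse>)" by (intro acyclicI_order[where f = p]) auto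
      then show ?thesis by (simp only: acyclic_converse)
    qed
    have "{v \<in> V. c (\<rho> v) = True} \<union> {v \<in> V. c (\<rho> v) = False} = V" "{v \<in> V. c (\<rho> v) = True} \<inter> {v \<in> V. c (\<rho> v) = False} = {}" by auto
    then show False using nc acyc by blast
  qed
  moreover have "\<not> adj a a" for a using H BV by (auto simp: adj_def K_def oriented_graph_def)
  ultimately obtain cs where cs: "3 \<le> length cs" "distinct cs" "set cs \<subseteq> R"
    "\<And>i. Suc i < length cs \<Longrightarrow> adj (cs ! i) (cs ! Suc i)" "adj (cs ! 0) (cs ! (length cs - 1))"
    using ex_cycle_if_not_two_colorable[of R adj] finR unfolding adj_def by blast
  have "\<exists>us. length us = length cs \<and> set us \<subseteq> V \<and> (\<forall>i<length cs. \<rho> (\<tau> (us ! i)) = cs ! i) \<and>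
        (\<forall>i. Suc i < length us \<longrightarrow> (us ! i, us ! Suc i) \<in> back_arcs E \<phi> \<or> (us ! Suc i, us ! i) \<in> back_arcs E \<phi>) \<and>
        ((us ! 0, us ! (length us - 1)) \<in> back_arcs E \<phi> \<or> (us ! (length us - 1), us ! 0) \<in> back_arcs E \<phi>)"
    if \<phi>: "inj_on \<phi> V" and \<tau>: "\<tau> ` V \<subseteq> V" "\<forall>(u, v)\<in>back_arcs E \<phi>. (\<tau> u, \<tau> v) \<in> B" for \<phi> \<tau>
  proof -
    have h\<tau>: "hom \<tau> (back_arcs E \<phi>) B" using \<tau> by (auto simp: hom_def)
    then obtain \<theta> where \<theta>: "hom \<theta> B (back_arcs E \<phi>)" using minimal[OF \<phi>] by blast
    define g where "g = \<rho> \<circ> \<tau> \<circ> \<theta>"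
    have hg: "hom g B B" unfolding g_def using hom_comp \<theta> h\<tau> \<rho>(1) by metis
    have gR: "g ` R \<subseteq> R" using \<theta> h\<tau> RV unfolding g_def R_def hom_def by (auto simp: image_subset_iff)
    have "card R \<le> card ((g \<circ> \<rho>) ` V)" unfolding R_def by (rule \<rho>(2)[OF hom_comp[OF \<rho>(1) hg]])
    then have "card R \<le> card (g ` R)" by (simp add: R_def image_comp)
    then have gR: "g ` R = R" using gR finR by (intro card_seteq)
    then have inj: "inj_on g R" using finR by (intro eq_card_imp_inj_on) auto
    define gi where "gi = inv_into R g"
    have gi: "gi a \<in> R" "g (gi a) = a" if "a \<in> R" for a
      using that gR by (auto simp: gi_def inv_into_into f_inv_into_f)
    \<comment> \<open>An injective endomorphism of a finite graph is also onto the arcs, so its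
      inverse preserves arcs. The cycle is therefore pulled back inside the core by
      \<open>gi\<close> and then carried over to \<open>\<phi>\<close> by \<open>\<theta>\<close>;
      going back by \<open>\<rho> \<circ> \<tau>\<close> restores it pointwise.\<close>
    have K_pull: "(gi a, gi b) \<in> K" if ab: "(a, b) \<in> K" for a b
    proof -
      define G where "G = (\<lambda>(a, b). (g a, g b))"
      have "finite K" unfolding K_def using finR by simp
      moreover have "G ` K \<subseteq> K" using hg gR by (auto simp: G_def K_def hom_def)
      moreover have "inj_on G K" using inj by (auto simp: inj_on_def G_def K_def)
      ultimately have "G ` K = K" by (rule endo_inj_surj)
      then obtain a' b' where a': "(a', b') \<in> K" "g a' = a" "g b' = b" using ab unfolding G_def by force
      then have "gi a = a'" "gi b = b'" using inj by (auto simp: gi_def K_def)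
      then show ?thesis using a' by simp
    qed
    define us where "us = map (\<theta> \<circ> gi) cs"
    have csR: "cs ! i \<in> R" if "i < length cs" for i using that cs(3) nth_mem by blast
    have adj_us: "(\<theta> (gi a), \<theta> (gi b)) \<in> back_arcs E \<phi> \<or> (\<theta> (gi b), \<theta> (gi a)) \<in> back_arcs E \<phi>" if "adj a b" for a b
      using that K_pull \<theta> unfolding adj_def hom_def K_def by blast
    have "set us \<subseteq> V"
    proof
      fix u assume "u \<in> set us"
      then obtain a where a: "a \<in> set cs" "u = \<theta> (gi a)" by (auto simp: us_def)
      then have "gi a \<in> V" using gi(1) cs(3) RV by blast
      then show "u \<in> V" using \<theta> a(2) unfolding hom_def by blast
    qed
    moreover have "\<rho> (\<tau> (us ! i)) = cs ! i" if "i < length cs" for i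
      using gi(2)[OF csR[OF that]] that by (simp add: us_def g_def)
    moreover have "length us = length cs" by (simp add: us_def)
    moreover have "(us ! i, us ! Suc i) \<in> back_arcs E \<phi> \<or> (us ! Suc i, us ! i) \<in> back_arcs E \<phi>" if "Suc i < length us" for i
      using adj_us[OF cs(4)[of i]] that by (simp add: us_def)
    moreover have "(us ! 0, us ! (length us - 1)) \<in> back_arcs E \<phi> \<or> (us ! (length us - 1), us ! 0) \<in> back_arcs E \<phi>"
    proof -
      have "0 < length cs" using cs(1) by linarith
      then show ?thesis using adj_us[OF cs(5)] by (simp add: us_def)
    qed
    ultimately show ?thesis by blast
  qed
  note key = this[unfolded B_def]
  show ?thesis
    by (rule exI[of _ p], rule exI[of _ \<rho>], rule exI[of _ cs], intro conjI allI impI p(1) cs(1,2)) (rule key)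
qed

text \<open>Strict convexity of \<open>y \<mapsto> |y|\<^sup>2\<close>.\<close>
lemma convex_combination_rigid:
  fixes \<mu> :: "nat \<Rightarrow> int" and y :: "nat \<Rightarrow> nat \<Rightarrow> int"
  assumes \<mu>: "\<And>i. i < k \<Longrightarrow> \<mu> i > 0"
    and lin: "\<And>d. d < D \<Longrightarrow> (\<Sum>i<k. \<mu> i * y i d) = (\<Sum>i<k. \<mu> i) * y' d"
    and quad: "(\<Sum>i<k. \<mu> i * (\<Sum>d<D. (y i d)\<^sup>2)) = (\<Sum>i<k. \<mu> i) * (\<Sum>d<D. (y' d)\<^sup>2)"
    and "i < k" "d < D"
  shows "y i d = y' d"
proof -
  \<comment> \<open>This is the weighted variance about \<open>y'\<close>. Expanding it with
    \<open>lin\<close> and \<open>quad\<close> gives S - 2S + S = 0, and positive weights make every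
    term vanish.\<close>
  have "(\<Sum>i<k. \<mu> i * (\<Sum>d<D. (y i d - y' d)\<^sup>2)) =
    (\<Sum>i<k. \<mu> i * (\<Sum>d<D. (y i d)\<^sup>2)) - 2 * (\<Sum>i<k. \<Sum>d<D. y' d * (\<mu> i * y i d)) + (\<Sum>i<k. \<mu> i * (\<Sum>d<D. (y' d)\<^sup>2))"
    by (simp add: power2_diff sum.distrib sum_subtractf sum_distrib_left algebra_simps)
  also have "(\<Sum>i<k. \<Sum>d<D. y' d * (\<mu> i * y i d)) = (\<Sum>d<D. y' d * (\<Sum>i<k. \<mu> i * y i d))"
    by (subst sum.swap) (simp add: sum_distrib_left)
  also have "\<dots> = (\<Sum>d<D. y' d * ((\<Sum>i<k. \<mu> i) * y' d))" using lin by (intro sum.cong refl) auto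
  also have "\<dots> = (\<Sum>i<k. \<mu> i) * (\<Sum>d<D. (y' d)\<^sup>2)" by (simp add: sum_distrib_left power2_eq_square mult_ac)
  also have "(\<Sum>i<k. \<mu> i * (\<Sum>d<D. (y' d)\<^sup>2)) = (\<Sum>i<k. \<mu> i) * (\<Sum>d<D. (y' d)\<^sup>2)" by (simp only: sum_distrib_right)
  finally have "(\<Sum>i<k. \<mu> i * (\<Sum>d<D. (y i d - y' d)\<^sup>2)) = 0" using quad by simp
  moreover have "0 \<le> \<mu> i * (\<Sum>d<D. (y i d - y' d)\<^sup>2)" if "i \<in> {..<k}" for i
    using \<mu>[of i] that by (intro mult_nonneg_nonneg sum_nonneg) auto
  ultimately have "\<mu> i * (\<Sum>d<D. (y i d - y' d)\<^sup>2) = 0" using assms(4) by (subst (asm) sum_nonneg_eq_0_iff) auto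
  then have "(\<Sum>d<D. (y i d - y' d)\<^sup>2) = 0" using \<mu>[OF assms(4)] by simp
  then show ?thesis using assms(5) by (subst (asm) sum_nonneg_eq_0_iff) auto
qed

section \<open>A Ruzsa-Szemeredi type tournament\<close>

text \<open>Every clique \<open>(x, z, y)\<close> contributes one copy of \<open>H\<close>, whose vertex \<open>v\<close> sits at the point
  \<open>(x, z) + lam v * (y, |y|\<^sup>2)\<close> of the part belonging to \<open>v\<close>. The third component of a vertex is an index
  in the blow-up.\<close>
locale rs_tournament =
  fixes V :: "'a set" and E :: "('a \<times> 'a) set" and p lam :: "'a \<Rightarrow> nat" and Lam D Q b :: nat
  assumes H: "oriented_graph V E" and V_ne: "V \<noteq> {}" and p_inj: "inj_on p V" and lam_inj: "inj_on lam V"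
    and lam_le: "\<And>v. v \<in> V \<Longrightarrow> lam v \<le> Lam" and params: "D > 0" "Q > 0" "b > 0"
begin

definition "r = rank_in V p"
definition "vecs = {..<D} \<rightarrow>\<^sub>E {..<Q}"
text \<open>\<open>z\<close> ranges as far as |y|^2 can reach. Hence the box \<open>points\<close>,
  which contains all positions on the lines, exceeds the range of (x, z) only by a factor depending
  on \<open>Lam\<close> and \<open>D\<close>.\<close>

definition "cliques = vecs \<times> {..<D * Q ^ 2} \<times> vecs"
definition nrm :: "(nat \<Rightarrow> nat) \<Rightarrow> nat" where "nrm y = (\<Sum>d<D. (y d)\<^sup>2)"
definition pt :: "'a \<Rightarrow> (nat \<Rightarrow> nat) \<times> nat \<times> (nat \<Rightarrow> nat) \<Rightarrow> (nat \<Rightarrow> nat) \<times> nat" where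
  "pt v \<kappa> = (\<lambda>d\<in>{..<D}. fst \<kappa> d + lam v * snd (snd \<kappa>) d, fst (snd \<kappa>) + lam v * nrm (snd (snd \<kappa>)))"
definition "points = ({..<D} \<rightarrow>\<^sub>E {..<(Lam + 1) * Q}) \<times> {..<(Lam + 1) * (D * Q ^ 2)}"
definition "m = card points"
definition "e = (SOME e. bij_betw e points {0..<m})"
definition "n = card V * m * b"
text \<open>A mixed-radix code of part, position and blow-up index. As the part is the leading digit
  and is numbered by \<open>r\<close>, vertices of different types compare like the
  \<open>p\<close>-values of their types.\<close>

definition "enc v P j = (r v * m + e P) * b + j"
definition "ty w = inv_into V r (w div b div m)"
definition "ps w = inv_into points e (w div b mod m)"
definition "flip w w' \<longleftrightarrow> ((ty w, ty w') \<in> back_arcs E p \<or> (ty w', ty w) \<in> back_arcs E p) \<and>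
  (\<exists>\<kappa>\<in>cliques. ps w = pt (ty w) \<kappa> \<and> ps w' = pt (ty w') \<kappa>)"
definition "T = {(w, w'). w < n \<and> w' < n \<and> w \<noteq> w' \<and> (if flip w w' then w' < w else w < w')}"

section \<open>Coordinates of vertices and lines\<close>

lemma finV: "finite V" and EV: "E \<subseteq> V \<times> V"
  using H by (auto simp: oriented_graph_def)

lemma fin_points: "finite points" and fin_cliques: "finite cliques"
  by (auto simp: points_def cliques_def vecs_def finite_PiE)

lemma card_cliques: "card cliques = Q ^ D * (D * Q ^ 2 * Q ^ D)"
  by (simp add: cliques_def vecs_def card_cartesian_product card_PiE)

lemma m_eq: "m = ((Lam + 1) * Q) ^ D * ((Lam + 1) * (D * Q ^ 2))"
  unfolding m_def points_def by (simp add: card_cartesian_product card_PiE)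

lemma m_pos: "m > 0" and n_pos: "n > 0"
  using params V_ne finV by (auto simp: m_eq n_def card_gt_0_iff)

lemma e_bij: "bij_betw e points {0..<m}"
  unfolding e_def m_def by (rule someI_ex[OF ex_bij_betw_finite_nat[OF fin_points]])

lemma e_less: "P \<in> points \<Longrightarrow> e P < m"
  using e_bij by (auto simp: bij_betw_def)

lemma r_bij: "bij_betw r V {..<card V}"
  unfolding r_def by (rule bij_betw_rank_in[OF finV p_inj])

lemma r_less_iff: "u \<in> V \<Longrightarrow> v \<in> V \<Longrightarrow> r u < r v \<longleftrightarrow> p u < p v"
  unfolding r_def by (rule rank_in_less_iff[OF finV _ _ p_inj])

lemma enc_div: "j < b \<Longrightarrow> enc v P j div b = r v * m + e P" and enc_mod: "j < b \<Longrightarrow> enc v P j mod b = j"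
  by (simp_all add: enc_def)

lemma ty_enc: "v \<in> V \<Longrightarrow> P \<in> points \<Longrightarrow> j < b \<Longrightarrow> ty (enc v P j) = v"
  using r_bij e_less[of P] unfolding ty_def by (simp add: enc_div bij_betw_def)

lemma ps_enc: "v \<in> V \<Longrightarrow> P \<in> points \<Longrightarrow> j < b \<Longrightarrow> ps (enc v P j) = P"
  using e_bij e_less[of P] unfolding ps_def by (simp add: enc_div bij_betw_def)

lemma enc_less: "v \<in> V \<Longrightarrow> P \<in> points \<Longrightarrow> j < b \<Longrightarrow> enc v P j < n"
proof -
  assume v: "v \<in> V" "P \<in> points" "j < b"
  have "r v < card V" using bij_betwE[OF r_bij] v(1) by blast
  then have "r v + 1 \<le> card V" by simp
  then have "(r v + 1) * m \<le> card V * m" by (rule mult_right_mono) simp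
  then have "r v * m + e P + 1 \<le> card V * m" using e_less[OF v(2)] by simp
  then have "(r v * m + e P + 1) * b \<le> card V * m * b" by (rule mult_right_mono) simp
  then show ?thesis using v(3) by (simp add: enc_def n_def)
qed

lemma div_less: "w < n \<Longrightarrow> w div b div m < card V"
  unfolding n_def using params m_pos by (simp add: less_mult_imp_div_less mult.assoc)

lemma ty_in: "w < n \<Longrightarrow> ty w \<in> V" and r_ty: "w < n \<Longrightarrow> r (ty w) = w div b div m"
proof -
  assume "w < n"
  then have "w div b div m \<in> r ` V" using div_less r_bij by (auto simp: bij_betw_def)
  then show "ty w \<in> V" "r (ty w) = w div b div m" unfolding ty_def by (rule inv_into_into, rule f_inv_into_f)
qed

lemma ps_in: "ps w \<in> points" and e_ps: "e (ps w) = w div b mod m"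
proof -
  have "w div b mod m \<in> e ` points" using e_bij m_pos by (auto simp: bij_betw_def)
  then show "ps w \<in> points" "e (ps w) = w div b mod m" unfolding ps_def by (rule inv_into_into, rule f_inv_into_f)
qed

lemma enc_ty_ps: "w < n \<Longrightarrow> enc (ty w) (ps w) (w mod b) = w"
  by (simp add: enc_def r_ty e_ps)

lemma ty_mono: "w \<le> w' \<Longrightarrow> w' < n \<Longrightarrow> r (ty w) \<le> r (ty w')"
  using r_ty[of w] r_ty[of w'] by (simp add: div_le_mono)

lemma pt_in:
  assumes "v \<in> V" "\<kappa> \<in> cliques"
  shows "pt v \<kappa> \<in> points"
proof -
  obtain x z y where \<kappa>: "\<kappa> = (x, z, y)" "x \<in> vecs" "z < D * Q ^ 2" "y \<in> vecs" using assms(2) by (auto simp: cliques_def)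
  have xd: "x d < Q" "y d < Q" if "d < D" for d using \<kappa> that by (auto simp: vecs_def)
  have "x d + lam v * y d < (Lam + 1) * Q" if "d < D" for d
  proof -
    have "lam v * y d \<le> Lam * Q" using lam_le[OF assms(1)] xd(2)[OF that] by (intro mult_le_mono) auto
    then show ?thesis using xd(1)[OF that] by simp
  qed
  moreover have "nrm y \<le> D * Q ^ 2"
  proof -
    have "nrm y \<le> (\<Sum>d<D. Q ^ 2)" unfolding nrm_def using xd(2) by (intro sum_mono power_mono) (auto simp: less_imp_le)
    then show ?thesis by simp
  qed
  then have "lam v * nrm y \<le> Lam * (D * Q ^ 2)" using lam_le[OF assms(1)] by (intro mult_le_mono)
  then have "z + lam v * nrm y < (Lam + 1) * (D * Q ^ 2)" using \<kappa>(3) by simp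
  ultimately show ?thesis unfolding pt_def points_def \<kappa> by auto
qed

text \<open>A line is determined by its points at two different parameters. Hence planted copies
  from different cliques share no arc.\<close>

lemma pt_inj:
  assumes uv: "u \<in> V" "v \<in> V" "u \<noteq> v" and \<kappa>: "\<kappa> \<in> cliques" "\<kappa>' \<in> cliques"
    and eq: "pt u \<kappa> = pt u \<kappa>'" "pt v \<kappa> = pt v \<kappa>'"
  shows "\<kappa> = \<kappa>'"
proof -
  obtain x z y where k: "\<kappa> = (x, z, y)" "x \<in> vecs" "y \<in> vecs" using \<kappa>(1) by (auto simp: cliques_def)
  obtain x' z' y' where k': "\<kappa>' = (x', z', y')" "x' \<in> vecs" "y' \<in> vecs" using \<kappa>(2) by (auto simp: cliques_def)
  have lam: "int (lam u) - int (lam v) \<noteq> 0" using uv lam_inj by (auto simp: inj_on_def)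
  have d: "x d = x' d \<and> y d = y' d" if "d < D" for d
  proof -
    have eqs: "x d + lam u * y d = x' d + lam u * y' d" "x d + lam v * y d = x' d + lam v * y' d"
      using fun_cong[OF arg_cong[OF eq(1), of fst], of d] fun_cong[OF arg_cong[OF eq(2), of fst], of d] that
      by (simp_all add: pt_def k k')
    have "int (x d) + int (lam u) * int (y d) = int (x' d) + int (lam u) * int (y' d)"
      "int (x d) + int (lam v) * int (y d) = int (x' d) + int (lam v) * int (y' d)"
      using eqs by (metis of_nat_add of_nat_mult)+
    then have "(int (lam u) - int (lam v)) * (int (y d) - int (y' d)) = 0" by (simp add: algebra_simps)
    then have "y d = y' d" using lam by simp
    then show ?thesis using eqs by simp
  qed
  have "x = x'" using d by (intro PiE_ext[OF k(2)[unfolded vecs_def] k'(2)[unfolded vecs_def]]) auto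
  moreover have "y = y'" using d by (intro PiE_ext[OF k(3)[unfolded vecs_def] k'(3)[unfolded vecs_def]]) auto
  moreover have "z = z'" using arg_cong[OF eq(1), of snd] \<open>y = y'\<close> by (simp add: pt_def k k')
  ultimately show ?thesis by (simp add: k k')
qed

lemma flip_commute: "flip w w' \<longleftrightarrow> flip w' w"
  unfolding flip_def by blast

lemma tournament_T: "tournament n T"
  unfolding tournament_def T_def using flip_commute by auto

section \<open>Planted copies and the distance from being \<open>H\<close>-free\<close>

definition "copy \<kappa> g v = enc v (pt v \<kappa>) (g v)"

lemma copy_props:
  assumes "\<kappa> \<in> cliques" "g \<in> V \<rightarrow>\<^sub>E {..<b}" "v \<in> V"
  shows "copy \<kappa> g v < n" "ty (copy \<kappa> g v) = v" "ps (copy \<kappa> g v) = pt v \<kappa>" "copy \<kappa> g v mod b = g v"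
proof -
  have *: "g v < b" "pt v \<kappa> \<in> points" using assms pt_in by auto
  show "copy \<kappa> g v < n" "ty (copy \<kappa> g v) = v" "ps (copy \<kappa> g v) = pt v \<kappa>" "copy \<kappa> g v mod b = g v"
    unfolding copy_def using assms(3) * by (simp_all add: enc_less ty_enc ps_enc enc_mod)
qed

lemma copy_arc:
  assumes \<kappa>: "\<kappa> \<in> cliques" and g: "g \<in> V \<rightarrow>\<^sub>E {..<b}" and uv: "(u, v) \<in> E"
  shows "(copy \<kappa> g u, copy \<kappa> g v) \<in> T"
proof -
  have V: "u \<in> V" "v \<in> V" "u \<noteq> v" "(v, u) \<notin> E" using uv H by (auto simp: oriented_graph_def)
  note cu = copy_props[OF \<kappa> g V(1)] and cv = copy_props[OF \<kappa> g V(2)]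
  have ne: "copy \<kappa> g u \<noteq> copy \<kappa> g v" using cu(2) cv(2) V(3) by metis
  have order: "copy \<kappa> g a < copy \<kappa> g a'" if "p a < p a'" "a \<in> V" "a' \<in> V" for a a'
  proof (rule ccontr)
    assume "\<not> ?thesis"
    then have "r (ty (copy \<kappa> g a')) \<le> r (ty (copy \<kappa> g a))" using copy_props(1)[OF \<kappa> g that(2)] by (intro ty_mono) auto
    then show False using r_less_iff[OF that(2,3)] that copy_props(2)[OF \<kappa> g] by simp
  qed
  have flip: "flip (copy \<kappa> g u) (copy \<kappa> g v) \<longleftrightarrow> (u, v) \<in> back_arcs E p"
    unfolding flip_def cu cv using \<kappa> V(4) by (auto simp: back_arcs_def)
  have "p u \<noteq> p v" using p_inj V by (auto simp: inj_on_def)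
  then show ?thesis unfolding T_def using flip uv ne cu(1) cv(1) order V by (auto simp: back_arcs_def)
qed

lemma copy_inj: "\<kappa> \<in> cliques \<Longrightarrow> g \<in> V \<rightarrow>\<^sub>E {..<b} \<Longrightarrow> inj_on (copy \<kappa> g) V"
  by (rule inj_on_inverseI[where g = ty]) (rule copy_props)

text \<open>Each of the \<open>card cliques * b ^ card V\<close> planted copies must lose an arc. An
  arc determines the clique by \<open>pt_inj\<close> and fixes two of the blow-up indices, so a
  changed arc can be charged for at most a fraction 1/b^2 of the \<open>b ^ card V\<close> index
  choices.\<close>

lemma many_changes:
  assumes T': "tournament n T'" and free: "H_free V E n T'"
  shows "card cliques * b ^ 2 \<le> tdist T T'"
proof -
  define G where "G = V \<rightarrow>\<^sub>E {..<b}"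
  have finG: "finite G" and cG: "card G = b ^ card V" unfolding G_def using finV by (simp_all add: finite_PiE card_PiE)
  have ex: "\<exists>(u, v)\<in>E. (copy \<kappa> g u, copy \<kappa> g v) \<in> T - T'" if \<kappa>: "\<kappa> \<in> cliques" "g \<in> G" for \<kappa> g
  proof -
    have "\<not> embedding V E n T' (copy \<kappa> g)" using free unfolding H_free_iff by blast
    then have "\<exists>(u, v)\<in>E. (copy \<kappa> g u, copy \<kappa> g v) \<notin> T'"
      using copy_props(1)[of \<kappa> g] copy_inj[of \<kappa> g] \<kappa> unfolding embedding_def G_def by auto
    then show ?thesis using copy_arc[of \<kappa> g] \<kappa> unfolding G_def by blast
  qed
  have "\<forall>x\<in>cliques \<times> G. \<exists>w. w \<in> T - T' \<and> (\<exists>(u, v)\<in>E. w = (copy (fst x) (snd x) u, copy (fst x) (snd x) v))"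
  proof
    fix x assume "x \<in> cliques \<times> G"
    then have "fst x \<in> cliques" "snd x \<in> G" by auto
    from ex[OF this] show "\<exists>w. w \<in> T - T' \<and> (\<exists>(u, v)\<in>E. w = (copy (fst x) (snd x) u, copy (fst x) (snd x) v))" by blast
  qed
  then have "\<exists>F. \<forall>x\<in>cliques \<times> G. F x \<in> T - T' \<and> (\<exists>(u, v)\<in>E. F x = (copy (fst x) (snd x) u, copy (fst x) (snd x) v))"
    by (rule bchoice)
  then obtain F where F: "\<And>x. x \<in> cliques \<times> G \<Longrightarrow> F x \<in> T - T'"
    "\<And>x. x \<in> cliques \<times> G \<Longrightarrow> \<exists>(u, v)\<in>E. F x = (copy (fst x) (snd x) u, copy (fst x) (snd x) v)"
    by (elim exE) (rule that, (drule (1) bspec, erule conjunct1), drule (1) bspec, erule conjunct2)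
  have fib: "card {x \<in> cliques \<times> G. F x = ww} * b ^ 2 \<le> b ^ card V" if ww: "ww \<in> T - T'" for ww
  proof (cases "{x \<in> cliques \<times> G. F x = ww} = {}")
    case False
    then obtain x0 where x0: "x0 \<in> cliques \<times> G" "F x0 = ww" by blast
    obtain u v where uv: "(u, v) \<in> E" "ww = (copy (fst x0) (snd x0) u, copy (fst x0) (snd x0) v)" using F(2)[OF x0(1)] x0(2) by blast
    have V: "u \<in> V" "v \<in> V" "u \<noteq> v" using uv(1) H by (auto simp: oriented_graph_def)
    have c0: "fst x0 \<in> cliques" "snd x0 \<in> V \<rightarrow>\<^sub>E {..<b}" using x0 by (auto simp: G_def)
    have "{x \<in> cliques \<times> G. F x = ww} \<subseteq> {fst x0} \<times> {g \<in> G. \<forall>k\<in>{u, v}. g k \<in> {snd x0 k}}"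
    proof
      fix x assume x: "x \<in> {x \<in> cliques \<times> G. F x = ww}"
      then have cx: "fst x \<in> cliques" "snd x \<in> V \<rightarrow>\<^sub>E {..<b}" by (auto simp: G_def)
      obtain u' v' where uv': "(u', v') \<in> E" "ww = (copy (fst x) (snd x) u', copy (fst x) (snd x) v')" using F(2)[of x] x by blast
      have V': "u' \<in> V" "v' \<in> V" using uv'(1) EV by auto
      have eq: "copy (fst x0) (snd x0) u = copy (fst x) (snd x) u'" "copy (fst x0) (snd x0) v = copy (fst x) (snd x) v'"
        using uv(2) uv'(2) by simp_all
      have "u = u'" "v = v'" using eq copy_props(2)[OF c0] copy_props(2)[OF cx] V V' by metis+
      note eq = eq[folded this]
      have "pt u (fst x0) = pt u (fst x)" "pt v (fst x0) = pt v (fst x)"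
        using eq copy_props(3)[OF c0] copy_props(3)[OF cx] V by metis+
      then have "fst x = fst x0" using pt_inj[OF V c0(1) cx(1)] by simp
      moreover have "snd x u = snd x0 u" "snd x v = snd x0 v"
        using eq copy_props(4)[OF c0] copy_props(4)[OF cx] V by metis+
      ultimately show "x \<in> {fst x0} \<times> {g \<in> G. \<forall>k\<in>{u, v}. g k \<in> {snd x0 k}}" using cx by (cases x) (auto simp: G_def)
    qed
    then have "card {x \<in> cliques \<times> G. F x = ww} \<le> card ({fst x0} \<times> {g \<in> G. \<forall>k\<in>{u, v}. g k \<in> {snd x0 k}})"
      using finG by (intro card_mono) auto
    also have "\<dots> = card {g \<in> G. \<forall>k\<in>{u, v}. g k \<in> {snd x0 k}}" by (simp add: card_cartesian_product)
    finally have "card {x \<in> cliques \<times> G. F x = ww} * b ^ 2 \<le> card {g \<in> G. \<forall>k\<in>{u, v}. g k \<in> {snd x0 k}} * b ^ 2"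
      by (rule mult_le_mono1)
    also have "\<dots> \<le> b ^ card V"
      using card_PiE_constrained[of V "{u, v}" "\<lambda>_. {..<b}" "\<lambda>k. {snd x0 k}"] finV V by (simp add: G_def power2_eq_square)
    finally show ?thesis .
  next
    case True
    show ?thesis unfolding True by simp
  qed
  have finT: "finite (T - T')" using tournament_finite[OF tournament_T] by simp
  have "card (cliques \<times> G) = (\<Sum>ww\<in>T - T'. card {x \<in> cliques \<times> G. F x = ww})"
  proof -
    have "card (cliques \<times> G) = card (\<Union>ww\<in>T - T'. {x \<in> cliques \<times> G. F x = ww})"
      using F(1) by (intro arg_cong[of _ _ card]) blast
    also have "\<dots> = (\<Sum>ww\<in>T - T'. card {x \<in> cliques \<times> G. F x = ww})"
      using finT finG fin_cliques by (intro card_UN_disjoint) auto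
    finally show ?thesis .
  qed
  then have "card (cliques \<times> G) * b ^ 2 = (\<Sum>ww\<in>T - T'. card {x \<in> cliques \<times> G. F x = ww} * b ^ 2)"
    by (simp only: sum_distrib_right)
  also have "\<dots> \<le> (\<Sum>ww\<in>T - T'. b ^ card V)" using fib by (rule sum_mono)
  finally have "(card cliques * b ^ 2) * b ^ card V \<le> card (T - T') * b ^ card V"
    by (simp add: card_cartesian_product cG mult_ac)
  then show ?thesis using params(3) by (simp add: tdist_def)
qed

text \<open>An arc of \<open>T\<close> that points downwards has been flipped, so the types of its
  ends are joined by a back arc of \<open>p\<close>; the order of the parts decides the direction.
  Thus the types of any embedding form a homomorphism of back-arc graphs, to which the rigidity of
  the cycle applies.\<close>

lemma back_arcs_embedding:
  assumes \<phi>: "embedding V E n T \<phi>" and uv: "(u, v) \<in> back_arcs E \<phi>"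
  shows "flip (\<phi> u) (\<phi> v)" "(ty (\<phi> u), ty (\<phi> v)) \<in> back_arcs E p"
proof -
  have E: "(u, v) \<in> E" "\<phi> v < \<phi> u" using uv by (auto simp: back_arcs_def)
  then have V: "u \<in> V" "v \<in> V" using EV by auto
  have T: "(\<phi> u, \<phi> v) \<in> T" using \<phi> E(1) by (auto simp: embedding_def)
  then show flip: "flip (\<phi> u) (\<phi> v)" using E(2) by (auto simp: T_def split: if_splits)
  have lt: "\<phi> u < n" "\<phi> v < n" using T by (auto simp: T_def)
  have "(ty (\<phi> v), ty (\<phi> u)) \<notin> back_arcs E p"
  proof
    assume "(ty (\<phi> v), ty (\<phi> u)) \<in> back_arcs E p"
    then have "p (ty (\<phi> u)) < p (ty (\<phi> v))" by (simp add: back_arcs_def)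
    then have "r (ty (\<phi> u)) < r (ty (\<phi> v))" using r_less_iff ty_in lt by simp
    then show False using ty_mono[of "\<phi> v" "\<phi> u"] E(2) lt by simp
  qed
  then show "(ty (\<phi> u), ty (\<phi> v)) \<in> back_arcs E p" using flip unfolding flip_def by blast
qed

text \<open>Differences eliminate the base point (x, z) of the common line; only its direction
  remains.\<close>

lemma flip_coords:
  assumes "flip w w'"
  shows "\<exists>y. (\<forall>d<D. int (fst (ps w') d) - int (fst (ps w) d) = (int (lam (ty w')) - int (lam (ty w))) * y d) \<and>
    int (snd (ps w')) - int (snd (ps w)) = (int (lam (ty w')) - int (lam (ty w))) * (\<Sum>d<D. (y d)\<^sup>2)"
proof -
  obtain \<kappa> where "ps w = pt (ty w) \<kappa>" "ps w' = pt (ty w') \<kappa>" using assms unfolding flip_def by blast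
  then show ?thesis
    by (intro exI[of _ "\<lambda>d. int (snd (snd \<kappa>) d)"]) (simp add: pt_def nrm_def algebra_simps)
qed

text \<open>The point of \<open>w2\<close> lies on the line through those of \<open>w0\<close> and \<open>w1\<close>, at the parameter given by its type.\<close>
definition "collinear w0 w1 w2 \<longleftrightarrow>
  (\<forall>d<D. (int (lam (ty w1)) - int (lam (ty w0))) * (int (fst (ps w2) d) - int (fst (ps w1) d)) =
     (int (lam (ty w2)) - int (lam (ty w1))) * (int (fst (ps w1) d) - int (fst (ps w0) d))) \<and>
  (int (lam (ty w1)) - int (lam (ty w0))) * (int (snd (ps w2)) - int (snd (ps w1))) =
     (int (lam (ty w2)) - int (lam (ty w1))) * (int (snd (ps w1)) - int (snd (ps w0)))"

text \<open>With a nonzero factor on the left, the equations determine the position of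
  \<open>w\<close> from \<open>w0\<close>, \<open>w1\<close> and the type \<open>t\<close>. Only the
  blow-up index of \<open>w\<close> is free.\<close>

lemma card_collinear_le:
  assumes "lam (ty w0) \<noteq> lam (ty w1)"
  shows "card {w. w < n \<and> ty w = t \<and> collinear w0 w1 w} \<le> b"
proof -
  let ?S = "{w. w < n \<and> ty w = t \<and> collinear w0 w1 w}"
  have "inj_on (\<lambda>w. w mod b) ?S"
  proof (rule inj_onI)
    fix w w' assume w: "w \<in> ?S" "w' \<in> ?S" "w mod b = w' mod b"
    have ne: "int (lam (ty w1)) - int (lam (ty w0)) \<noteq> 0" using assms by simp
    have f: "fst (ps w) d = fst (ps w') d" if "d < D" for d
    proof -
      have "(int (lam (ty w1)) - int (lam (ty w0))) * (int (fst (ps w) d) - int (fst (ps w1) d)) =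
        (int (lam (ty w1)) - int (lam (ty w0))) * (int (fst (ps w') d) - int (fst (ps w1) d))"
        using w that by (simp add: collinear_def)
      then show ?thesis using ne by simp
    qed
    have P: "fst (ps w) \<in> {..<D} \<rightarrow>\<^sub>E {..<(Lam + 1) * Q}" for w
      using ps_in[of w] unfolding points_def by (simp only: mem_Times_iff)
    have "fst (ps w) = fst (ps w')" by (rule PiE_ext[OF P P f]) simp
    moreover have "snd (ps w) = snd (ps w')"
    proof -
      have "(int (lam (ty w1)) - int (lam (ty w0))) * (int (snd (ps w)) - int (snd (ps w1))) =
        (int (lam (ty w1)) - int (lam (ty w0))) * (int (snd (ps w')) - int (snd (ps w1)))"
        using w by (simp add: collinear_def)
      then show ?thesis using ne by simp
    qed
    ultimately have ps: "ps w = ps w'" by (simp add: prod_eq_iff)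
    have "w < n" "w' < n" "ty w = ty w'" using w by simp_all
    then show "w = w'" using enc_ty_ps[of w] enc_ty_ps[of w'] w(3) ps by metis
  qed
  moreover have "(\<lambda>w. w mod b) ` ?S \<subseteq> {..<b}" using params by auto
  ultimately show ?thesis using card_inj_on_le[of "\<lambda>w. w mod b" ?S "{..<b}"] by simp
qed

text \<open>The steps around the cycle are increments of \<open>lam\<close> times vectors (y_i,
  |y_i|^2), and they add up to the closing step, the total increment times (y', |y'|^2). Because
  \<open>lam\<close> increases along the cycle of the core, the weights are positive, and strict
  convexity forces all directions to coincide. Three consecutive positions on the resulting line
  already suffice for the count.\<close>

lemma embedding_collinear:
  fixes cs :: "'a list"
  assumes \<phi>: "embedding V E n T \<phi>"
    and cs: "3 \<le> length cs" "length us = length cs" "set us \<subseteq> V"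
    and lam_mono: "\<forall>v\<in>V. \<forall>w\<in>V. \<forall>i j. \<rho> v = cs ! i \<longrightarrow> \<rho> w = cs ! j \<longrightarrow> i < j \<longrightarrow> j < length cs \<longrightarrow> lam v < lam w"
    and us: "\<forall>i<length cs. \<rho> (ty (\<phi> (us ! i))) = cs ! i"
      "\<forall>i. Suc i < length us \<longrightarrow> (us ! i, us ! Suc i) \<in> back_arcs E \<phi> \<or> (us ! Suc i, us ! i) \<in> back_arcs E \<phi>"
      "(us ! 0, us ! (length us - 1)) \<in> back_arcs E \<phi> \<or> (us ! (length us - 1), us ! 0) \<in> back_arcs E \<phi>"
  shows "lam (ty (\<phi> (us ! 0))) < lam (ty (\<phi> (us ! 1)))" "lam (ty (\<phi> (us ! 1))) < lam (ty (\<phi> (us ! 2)))"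
    "collinear (\<phi> (us ! 0)) (\<phi> (us ! 1)) (\<phi> (us ! 2))"
proof -
  note lam_mono = lam_mono[rule_format] and us = us(1,2)[rule_format] us(3)
  define k where "k = length cs - 1"
  have k: "2 \<le> k" "length cs = Suc k" using cs(1) by (auto simp: k_def)
  define w where "w i = \<phi> (us ! i)" for i
  define L where "L i = int (lam (ty (w i)))" for i
  have wn: "w i < n" if "i \<le> k" for i
  proof -
    have "us ! i \<in> V" using that cs k nth_mem[of i us] by auto
    then show ?thesis using \<phi> by (auto simp: w_def embedding_def)
  qed
  have L_mono: "L i < L j" if "i < j" "j \<le> k" for i j
    unfolding L_def w_def
    using lam_mono[of "ty (\<phi> (us ! i))" "ty (\<phi> (us ! j))" i j] us(1)[of i] us(1)[of j] that k ty_in[OF wn[of i]] ty_in[OF wn[of j]]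
    by (simp add: w_def)
  have fl: "flip (w i) (w (Suc i))" if "i < k" for i
    using us(2)[of i] that k cs(2) back_arcs_embedding(1)[OF \<phi>] flip_commute by (auto simp: w_def)
  then have "\<forall>i\<in>{..<k}. \<exists>y. (\<forall>d<D. int (fst (ps (w (Suc i))) d) - int (fst (ps (w i)) d) = (L (Suc i) - L i) * y d) \<and>
    int (snd (ps (w (Suc i)))) - int (snd (ps (w i))) = (L (Suc i) - L i) * (\<Sum>d<D. (y d)\<^sup>2)"
    unfolding L_def using flip_coords by simp
  then have "\<exists>y. \<forall>i\<in>{..<k}. (\<forall>d<D. int (fst (ps (w (Suc i))) d) - int (fst (ps (w i)) d) = (L (Suc i) - L i) * y i d) \<and>
    int (snd (ps (w (Suc i)))) - int (snd (ps (w i))) = (L (Suc i) - L i) * (\<Sum>d<D. (y i d)\<^sup>2)" by (rule bchoice)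
  then obtain y where y: "\<And>i d. i < k \<Longrightarrow> d < D \<Longrightarrow> int (fst (ps (w (Suc i))) d) - int (fst (ps (w i)) d) = (L (Suc i) - L i) * y i d"
    "\<And>i. i < k \<Longrightarrow> int (snd (ps (w (Suc i)))) - int (snd (ps (w i))) = (L (Suc i) - L i) * (\<Sum>d<D. (y i d)\<^sup>2)"
    by auto
  have "flip (w 0) (w k)" using us(3) cs(2) back_arcs_embedding(1)[OF \<phi>] flip_commute unfolding k_def w_def by metis
  then obtain y' where y': "\<And>d. d < D \<Longrightarrow> int (fst (ps (w k)) d) - int (fst (ps (w 0)) d) = (L k - L 0) * y' d"
    "int (snd (ps (w k))) - int (snd (ps (w 0))) = (L k - L 0) * (\<Sum>d<D. (y' d)\<^sup>2)"
    using flip_coords[of "w 0" "w k"] unfolding L_def by blast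
  have Lsum: "(\<Sum>i<k. L (Suc i) - L i) = L k - L 0" by (rule sum_lessThan_telescope)
  have eq: "y i d = y' d" if "i < k" "d < D" for i d
  proof (rule convex_combination_rigid[where \<mu> = "\<lambda>i. L (Suc i) - L i", OF _ _ _ that])
    show "0 < L (Suc i) - L i" if "i < k" for i using L_mono[of i "Suc i"] that by simp
    show "(\<Sum>i<k. (L (Suc i) - L i) * y i d) = (\<Sum>i<k. L (Suc i) - L i) * y' d" if "d < D" for d
    proof -
      have "(\<Sum>i<k. (L (Suc i) - L i) * y i d) = (\<Sum>i<k. int (fst (ps (w (Suc i))) d) - int (fst (ps (w i)) d))"
        using y(1) that by (intro sum.cong) auto
      also have "\<dots> = int (fst (ps (w k)) d) - int (fst (ps (w 0)) d)" by (rule sum_lessThan_telescope)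
      finally show ?thesis using y'(1)[OF that] Lsum by simp
    qed
    have "(\<Sum>i<k. (L (Suc i) - L i) * (\<Sum>d<D. (y i d)\<^sup>2)) = (\<Sum>i<k. int (snd (ps (w (Suc i)))) - int (snd (ps (w i))))"
      using y(2) by (intro sum.cong) auto
    also have "\<dots> = int (snd (ps (w k))) - int (snd (ps (w 0)))" by (rule sum_lessThan_telescope)
    finally show "(\<Sum>i<k. (L (Suc i) - L i) * (\<Sum>d<D. (y i d)\<^sup>2)) = (\<Sum>i<k. L (Suc i) - L i) * (\<Sum>d<D. (y' d)\<^sup>2)"
      using y'(2) Lsum by simp
  qed
  show "lam (ty (\<phi> (us ! 0))) < lam (ty (\<phi> (us ! 1)))" "lam (ty (\<phi> (us ! 1))) < lam (ty (\<phi> (us ! 2)))"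
    using L_mono[of 0 1] L_mono[of 1 2] k(1) by (simp_all add: L_def w_def)
  have s: "Suc 0 = 1" "Suc 1 = 2" by simp_all
  have k01: "0 < k" "1 < k" using k(1) by auto
  have "(\<Sum>d<D. (y 0 d)\<^sup>2) = (\<Sum>d<D. (y 1 d)\<^sup>2)" using eq[OF k01(1)] eq[OF k01(2)] by (intro sum.cong) auto
  moreover have "y 0 d = y 1 d" if "d < D" for d using eq[OF k01(1) that] eq[OF k01(2) that] by simp
  ultimately have "collinear (w 0) (w 1) (w 2)"
    unfolding collinear_def L_def[symmetric] using y(1)[OF k01(1)] y(2)[OF k01(1)] y(1)[OF k01(2)] y(2)[OF k01(2)]
    unfolding s by simp
  then show "collinear (\<phi> (us ! 0)) (\<phi> (us ! 1)) (\<phi> (us ! 2))" by (simp add: w_def)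
qed

text \<open>There are at most (card V)^4 choices for u0, u1, u2 and the type of the image of
  \<open>u2\<close>. Once all other images are fixed, this image has at most \<open>b\<close>
  possibilities instead of \<open>n\<close>, a saving by the factor card V times m.\<close>

lemma card_embeddings_T_le:
  assumes ex: "\<And>\<phi>. embedding V E n T \<phi> \<Longrightarrow> \<exists>u0\<in>V. \<exists>u1\<in>V. \<exists>u2\<in>V. u0 \<noteq> u2 \<and> u1 \<noteq> u2 \<and>
    lam (ty (\<phi> u0)) \<noteq> lam (ty (\<phi> u1)) \<and> collinear (\<phi> u0) (\<phi> u1) (\<phi> u2)"
  shows "card (embeddings V E n T) * n \<le> card V ^ 4 * b * n ^ card V"
proof -
  define S where "S w0 w1 t = {w. w < n \<and> ty w = t \<and> collinear w0 w1 w \<and> lam (ty w0) \<noteq> lam (ty w1)}" for w0 w1 t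
  have finS: "finite (S w0 w1 t)" for w0 w1 t by (simp add: S_def)
  have cS: "card (S w0 w1 t) \<le> b" for w0 w1 t
    using card_collinear_le[of w0 w1 t] by (cases "lam (ty w0) = lam (ty w1)") (simp_all add: S_def)
  define Ix where "Ix = {(u0, u1, u2, t) \<in> V \<times> V \<times> V \<times> V. u0 \<noteq> u2 \<and> u1 \<noteq> u2}"
  define A where "A x = (case x of (u0, u1, u2, t) \<Rightarrow> {\<phi> \<in> V \<rightarrow>\<^sub>E {..<n}. \<phi> u2 \<in> S (\<phi> u0) (\<phi> u1) t})" for x
  have finIx: "finite Ix" unfolding Ix_def using finV by (auto intro: finite_subset[of _ "V \<times> V \<times> V \<times> V"])
  have cIx: "card Ix \<le> card V ^ 4"
  proof -
    have "card Ix \<le> card (V \<times> V \<times> V \<times> V)" unfolding Ix_def using finV by (intro card_mono) auto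
    then show ?thesis by (simp add: card_cartesian_product power4_eq_xxxx mult.assoc)
  qed
  have cA: "card (A x) * n \<le> b * n ^ card V" if x: "x \<in> Ix" for x
  proof -
    obtain u0 u1 u2 t where x': "x = (u0, u1, u2, t)" "u0 \<in> V" "u1 \<in> V" "u2 \<in> V" "u0 \<noteq> u2" "u1 \<noteq> u2"
      using x by (auto simp: Ix_def)
    define V' where "V' = V - {u2}"
    have fin': "finite V'" using finV by (simp add: V'_def)
    have cV: "card V = Suc (card V')" unfolding V'_def using card.remove[OF finV x'(4)] by simp
    have "A x \<subseteq> (\<lambda>(\<psi>, w). \<psi>(u2 := w)) ` (SIGMA \<psi>:V' \<rightarrow>\<^sub>E {..<n}. S (\<psi> u0) (\<psi> u1) t)"
    proof
      fix \<phi> assume \<phi>: "\<phi> \<in> A x"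
      then have "restrict \<phi> V' \<in> V' \<rightarrow>\<^sub>E {..<n}" "\<phi> u2 \<in> S (restrict \<phi> V' u0) (restrict \<phi> V' u1) t"
        using x' by (auto simp: A_def V'_def PiE_iff)
      moreover have "\<phi> = (restrict \<phi> V')(u2 := \<phi> u2)"
        using \<phi> x' by (auto simp: A_def V'_def fun_eq_iff PiE_iff extensional_def)
      ultimately show "\<phi> \<in> (\<lambda>(\<psi>, w). \<psi>(u2 := w)) ` (SIGMA \<psi>:V' \<rightarrow>\<^sub>E {..<n}. S (\<psi> u0) (\<psi> u1) t)"
        by (intro image_eqI[of _ _ "(restrict \<phi> V', \<phi> u2)"]) auto
    qed
    then have "card (A x) \<le> card (SIGMA \<psi>:V' \<rightarrow>\<^sub>E {..<n}. S (\<psi> u0) (\<psi> u1) t)"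
      using fin' finS by (intro surj_card_le[rotated]) (auto intro!: finite_SigmaI finite_PiE)
    also have "\<dots> = (\<Sum>\<psi>\<in>V' \<rightarrow>\<^sub>E {..<n}. card (S (\<psi> u0) (\<psi> u1) t))"
      using fin' finS by (intro card_SigmaI) (auto intro: finite_PiE)
    also have "\<dots> \<le> (\<Sum>\<psi>\<in>V' \<rightarrow>\<^sub>E {..<n}. b)" using cS by (intro sum_mono)
    also have "\<dots> = n ^ card V' * b" using fin' by (simp add: card_PiE)
    finally have "card (A x) * n \<le> n ^ card V' * b * n" by (rule mult_le_mono1)
    then show ?thesis by (simp add: cV mult_ac)
  qed
  have "embeddings V E n T \<subseteq> (\<Union>x\<in>Ix. A x)"
  proof
    fix \<phi> assume "\<phi> \<in> embeddings V E n T"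
    then have \<phi>: "\<phi> \<in> V \<rightarrow>\<^sub>E {..<n}" "embedding V E n T \<phi>" by (auto simp: embeddings_def)
    obtain u0 u1 u2 where u: "u0 \<in> V" "u1 \<in> V" "u2 \<in> V" "u0 \<noteq> u2" "u1 \<noteq> u2"
      "lam (ty (\<phi> u0)) \<noteq> lam (ty (\<phi> u1))" "collinear (\<phi> u0) (\<phi> u1) (\<phi> u2)" using ex[OF \<phi>(2)] by blast
    have "\<phi> u2 < n" using \<phi>(1) u(3) by auto
    then have "\<phi> \<in> A (u0, u1, u2, ty (\<phi> u2))" using u \<phi>(1) by (simp add: A_def S_def)
    moreover have "(u0, u1, u2, ty (\<phi> u2)) \<in> Ix" using u ty_in[OF \<open>\<phi> u2 < n\<close>] by (simp add: Ix_def)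
    ultimately show "\<phi> \<in> (\<Union>x\<in>Ix. A x)" by blast
  qed
  moreover have "finite (A x)" for x
  proof -
    have "A x \<subseteq> V \<rightarrow>\<^sub>E {..<n}" by (auto simp: A_def split: prod.splits)
    then show ?thesis using finV finite_PiE[of V "\<lambda>_. {..<n}"] finite_subset by blast
  qed
  ultimately have "card (embeddings V E n T) \<le> (\<Sum>x\<in>Ix. card (A x))"
    using finIx by (intro order.trans[OF card_mono card_UN_le]) auto
  then have "card (embeddings V E n T) * n \<le> (\<Sum>x\<in>Ix. card (A x)) * n" by (rule mult_le_mono1)
  also have "\<dots> = (\<Sum>x\<in>Ix. card (A x) * n)" by (rule sum_distrib_right)
  also have "\<dots> \<le> (\<Sum>x\<in>Ix. b * n ^ card V)" using cA by (rule sum_mono)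
  also have "\<dots> = card Ix * (b * n ^ card V)" by simp
  also have "\<dots> \<le> card V ^ 4 * (b * n ^ card V)" using cIx by (rule mult_le_mono1)
  finally show ?thesis by (simp add: mult.assoc)
qed

end

text \<open>This yields the value of \<epsilon>: for fixed \<open>D\<close> and \<open>Lam\<close>
  the cliques number a constant times m^2/Q^2, and each forces changes.\<close>

lemma (in rs_tournament) m_square: "real m ^ 2 = real (card cliques) * (real (Lam + 1) ^ (2 * D + 2) * real D * real Q ^ 2)"
proof -
  define l q d where "l = real (Lam + 1)" and "q = real Q" and "d = real D"
  have "real m = l ^ D * q ^ D * (l * (d * q ^ 2))"
    unfolding m_eq l_def q_def d_def by (simp only: of_nat_mult of_nat_power power_mult_distrib)
  moreover have "real (card cliques) = q ^ D * (d * q ^ 2 * q ^ D)"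
    unfolding card_cliques q_def d_def by (simp only: of_nat_mult of_nat_power)
  moreover have "l ^ (2 * D + 2) = (l ^ D) ^ 2 * l ^ 2" by (simp only: power_add power_mult[symmetric] mult.commute)
  ultimately show ?thesis unfolding l_def[symmetric] q_def[symmetric] d_def[symmetric]
    by (simp only: power2_eq_square mult_ac)
qed

lemma (in rs_tournament) power_le_m: "Q ^ D \<le> m"
proof -
  have "Q ^ D * 1 \<le> ((Lam + 1) * Q) ^ D * ((Lam + 1) * (D * Q ^ 2))"
    using params by (intro mult_le_mono power_mono) (auto simp: Suc_le_eq)
  then show ?thesis by (simp add: m_eq)
qed

text \<open>Copies have density at most h^3/m, hence at most h^3/Q^D, while \<epsilon> is a constant
  times 1/Q^2. Taking \<open>D\<close> above 2c makes copies rarer than \<epsilon>^c for large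
  \<open>Q\<close>. The blow-up by \<open>b\<close> makes \<open>n\<close> arbitrarily large with
  \<open>Q\<close> fixed, as \<open>admissible\<close> demands.\<close>

lemma not_two_colorable_imp_not_easy:
  fixes V :: "'a set"
  assumes H: "oriented_graph V E"
    and nc: "\<nexists>A B. A \<union> B = V \<and> A \<inter> B = {} \<and> acyclic (induced_arcs E A) \<and> acyclic (induced_arcs E B)"
  shows "\<not> easy V E"
proof
  assume "easy V E"
  then obtain c \<epsilon>0 :: real where \<epsilon>0: "\<epsilon>0 > 0" and easy: "\<And>\<epsilon>. 0 < \<epsilon> \<Longrightarrow> \<epsilon> < \<epsilon>0 \<Longrightarrow> fstar V E \<epsilon> \<ge> ereal (\<epsilon> powr c)"
    unfolding easy_def by blast
  define h where "h = card V"
  have finV: "finite V" and EV: "E \<subseteq> V \<times> V" using H by (auto simp: oriented_graph_def)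
  have V_ne: "V \<noteq> {}"
  proof
    assume "V = {}"
    then have "{} \<union> {} = V \<and> {} \<inter> {} = ({} :: 'a set) \<and> acyclic (induced_arcs E {}) \<and> acyclic (induced_arcs E {})"
      by (simp add: induced_arcs_def acyclic_def)
    then show False using nc by blast
  qed
  then have h: "h > 0" using finV by (simp add: h_def card_gt_0_iff)
  obtain p :: "'a \<Rightarrow> nat" and \<rho> and cs :: "'a list" where p: "inj_on p V" and cs: "3 \<le> length cs" "distinct cs"
    and rigid: "\<forall>\<phi> \<tau>. inj_on \<phi> V \<longrightarrow> \<tau> ` V \<subseteq> V \<longrightarrow> (\<forall>(u, v)\<in>back_arcs E \<phi>. (\<tau> u, \<tau> v) \<in> back_arcs E p) \<longrightarrow>
      (\<exists>us. length us = length cs \<and> set us \<subseteq> V \<and> (\<forall>i<length cs. \<rho> (\<tau> (us ! i)) = cs ! i) \<and>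
        (\<forall>i. Suc i < length us \<longrightarrow> (us ! i, us ! Suc i) \<in> back_arcs E \<phi> \<or> (us ! Suc i, us ! i) \<in> back_arcs E \<phi>) \<and>
        ((us ! 0, us ! (length us - 1)) \<in> back_arcs E \<phi> \<or> (us ! (length us - 1), us ! 0) \<in> back_arcs E \<phi>))"
    using ex_rigid_cycle[OF H nc] by (elim exE conjE) (rule that)
  obtain idx where idx: "bij_betw idx V {0..<h}" using ex_bij_betw_finite_nat[OF finV] unfolding h_def by blast
  have idx_less: "idx v < h" if "v \<in> V" for v using bij_betwE[OF idx] that by simp
  \<comment> \<open>Vertices off the cycle get the default \<open>length cs\<close>, beyond all
    positions on the cycle.\<close>
  define ix where "ix a = (if a \<in> set cs then inv_into {..<length cs} ((!) cs) a else length cs)" for a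
  have set_cs: "set cs = (!) cs ` {..<length cs}" by (auto simp: set_conv_nth)
  have ix_le: "ix a \<le> length cs" for a
    using inv_into_into[of a "(!) cs" "{..<length cs}"] unfolding ix_def set_cs by auto
  have "inj_on ((!) cs) {..<length cs}" using inj_on_nth[OF cs(2)] by blast
  then have ix_cs: "ix (cs ! i) = i" if "i < length cs" for i
    using that by (simp add: ix_def)
  \<comment> \<open>The position on the cycle dominates, so \<open>lam\<close> increases along every
    lift of the cycle through \<open>\<rho>\<close>, whichever preimages occur. The summand
    \<open>idx v\<close> makes \<open>lam\<close> injective.\<close>
  define lam where "lam v = ix (\<rho> v) * h + idx v" for v
  define Lam where "Lam = (length cs + 1) * h"
  have lam_inj: "inj_on lam V"
  proof (rule inj_onI)
    fix u v assume uv: "u \<in> V" "v \<in> V" "lam u = lam v"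
    have "idx u = lam u mod h" "idx v = lam v mod h" using idx_less uv(1,2) by (simp_all add: lam_def)
    then have "idx u = idx v" using uv(3) by simp
    then show "u = v" using uv idx by (auto simp: bij_betw_def inj_on_def)
  qed
  have lam_le: "lam v \<le> Lam" if "v \<in> V" for v
  proof -
    have "ix (\<rho> v) * h \<le> length cs * h" using ix_le by (rule mult_right_mono) simp
    then show ?thesis using idx_less[OF that] unfolding lam_def Lam_def distrib_right mult_1 by linarith
  qed
  have "lam v < lam w"
    if "v \<in> V" "w \<in> V" "\<rho> v = cs ! i" "\<rho> w = cs ! j" "i < j" "j < length cs" for v w i j
  proof -
    have "lam v < (i + 1) * h" using idx_less[OF that(1)] ix_cs[of i] that by (simp add: lam_def)
    also have "\<dots> \<le> j * h" using that(5) by (intro mult_right_mono) auto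
    also have "\<dots> \<le> lam w" using ix_cs[of j] that by (simp add: lam_def)
    finally show ?thesis .
  qed
  then have lam_mono: "\<forall>v\<in>V. \<forall>w\<in>V. \<forall>i j. \<rho> v = cs ! i \<longrightarrow> \<rho> w = cs ! j \<longrightarrow> i < j \<longrightarrow> j < length cs \<longrightarrow> lam v < lam w" by blast
  define D where "D = nat \<lceil>2 * c\<rceil> + 1"
  have D: "D > 0" "2 * c + 1 \<le> real D" by (simp_all add: D_def) linarith
  \<comment> \<open>Chosen by \<open>m_square\<close> so that \<epsilon> = \<kappa>/Q^2 turns
    \<epsilon> n^2 into exactly \<open>card cliques * b ^ 2\<close>, the number of forced
    changes.\<close>
  define \<kappa> where "\<kappa> = 1 / (real h ^ 2 * (real (Lam + 1) ^ (2 * D + 2) * real D))"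
  have \<kappa>: "\<kappa> > 0" using h D by (simp add: \<kappa>_def)
  \<comment> \<open>The bound by \<open>\<kappa> / \<epsilon>0\<close> puts \<epsilon> below
    \<open>\<epsilon>0\<close>. The last bound makes \<kappa>^c Q exceed 2 h^3, and \<open>D\<close>
    provides at least the one spare power of \<open>Q\<close> that this needs.\<close>
  obtain Q :: nat where "max 1 (max (\<kappa> / \<epsilon>0) (2 * real h ^ 3 / \<kappa> powr c)) < real Q" using reals_Archimedean2 by blast
  then have Q: "Q > 0" "1 \<le> real Q" "\<kappa> / \<epsilon>0 < real Q" "2 * real h ^ 3 / \<kappa> powr c < real Q" by auto
  define \<epsilon> where "\<epsilon> = \<kappa> / real Q ^ 2"
  have \<epsilon>: "\<epsilon> > 0" using \<kappa> Q(1) by (simp add: \<epsilon>_def)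
  have \<epsilon>1: "\<epsilon> < \<epsilon>0"
  proof -
    have "\<kappa> < \<epsilon>0 * real Q" using Q(3) \<epsilon>0 by (simp add: field_simps)
    also have "\<dots> \<le> \<epsilon>0 * real Q ^ 2" using \<epsilon>0 Q(2) by (intro mult_left_mono) (auto simp: power2_eq_square)
    finally show ?thesis using Q(1) by (simp add: \<epsilon>_def field_simps)
  qed
  \<comment> \<open>The supremum defining \<open>fstar\<close> need not be attained, so half of the
    bound is taken to obtain an admissible \<open>f\<close>.\<close>
  have "\<epsilon> powr c / 2 < \<epsilon> powr c" using \<epsilon> by simp
  then have "ereal (\<epsilon> powr c / 2) < ereal (\<epsilon> powr c)" by (simp only: ereal_less_eq less_ereal.simps)
  also have "\<dots> \<le> fstar V E \<epsilon>" using easy[OF \<epsilon> \<epsilon>1] .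
  finally have "\<exists>f. admissible V E \<epsilon> f \<and> \<epsilon> powr c / 2 < f" unfolding fstar_def less_Sup_iff by auto
  then obtain f where f: "admissible V E \<epsilon> f" "\<epsilon> powr c / 2 < f" by blast
  then obtain N where N: "\<And>n T. n \<ge> N \<Longrightarrow> tournament n T \<Longrightarrow> eps_far V E \<epsilon> n T \<Longrightarrow> f * real n ^ h \<le> real (num_copies V E n T)"
    unfolding admissible_def h_def by blast
  define b where "b = N + 1"
  have b: "b > 0" "N \<le> b" by (simp_all add: b_def)
  interpret rs_tournament V E p lam Lam D Q b
    using H V_ne p lam_inj lam_le D Q b by unfold_locales auto
  have n: "real n = real h * real m * real b" by (simp add: n_def h_def)
  have "N \<le> n"
  proof -
    have "1 * b \<le> h * m * b" using h m_pos by (intro mult_right_mono) auto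
    then have "N \<le> h * m * b" using b(2) by linarith
    then show ?thesis by (simp only: n_def h_def)
  qed
  moreover have "eps_far V E \<epsilon> n T"
    unfolding eps_far_def
  proof (intro allI impI, elim conjE)
    fix T' assume T': "tournament n T'" "H_free V E n T'"
    have "\<epsilon> * (real h * real m) ^ 2 = real (card cliques)"
    proof -
      define c1 where "c1 = real (Lam + 1) ^ (2 * D + 2) * real D"
      have c1: "c1 > 0" using D(1) by (simp add: c1_def)
      have "\<epsilon> = 1 / (real h ^ 2 * c1) / real Q ^ 2" by (simp only: \<epsilon>_def \<kappa>_def c1_def)
      moreover have "real m ^ 2 = real (card cliques) * (c1 * real Q ^ 2)" using m_square by (simp only: c1_def)
      ultimately show ?thesis using h c1 Q(1) by (simp add: power_mult_distrib)
    qed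
    then have "\<epsilon> * real n ^ 2 = real (card cliques) * real b ^ 2"
      unfolding n power_mult_distrib[of "real h * real m" "real b"] mult.assoc[symmetric] by simp
    also have "\<dots> = real (card cliques * b ^ 2)" by simp
    also have "\<dots> \<le> real (tdist T T')" using many_changes[OF T'] by (simp only: of_nat_le_iff)
    finally show "\<epsilon> * real n ^ 2 \<le> real (tdist T T')" .
  qed
  ultimately have "f * real n ^ h \<le> real (num_copies V E n T)" using N tournament_T by blast
  also have "\<dots> \<le> real (card (embeddings V E n T))"
    using num_copies_le_card_embeddings[OF finV EV] by (simp only: of_nat_le_iff)
  finally have 1: "f * real n ^ h \<le> real (card (embeddings V E n T))" .
  have "card (embeddings V E n T) * n \<le> h ^ 4 * b * n ^ h"
    unfolding h_def
  proof (rule card_embeddings_T_le)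
    fix \<phi> assume \<phi>: "embedding V E n T \<phi>"
    have "ty (\<phi> u) \<in> V" if "u \<in> V" for u using \<phi> that by (intro ty_in) (auto simp: embedding_def)
    moreover have "inj_on \<phi> V" using \<phi> by (simp add: embedding_def)
    ultimately obtain us where us: "length us = length cs" "set us \<subseteq> V" "\<forall>i<length cs. \<rho> (ty (\<phi> (us ! i))) = cs ! i"
      "\<forall>i. Suc i < length us \<longrightarrow> (us ! i, us ! Suc i) \<in> back_arcs E \<phi> \<or> (us ! Suc i, us ! i) \<in> back_arcs E \<phi>"
      "(us ! 0, us ! (length us - 1)) \<in> back_arcs E \<phi> \<or> (us ! (length us - 1), us ! 0) \<in> back_arcs E \<phi>"
      using rigid[rule_format, of \<phi> "\<lambda>u. ty (\<phi> u)"] back_arcs_embedding(2)[OF \<phi>] by blast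
    note col = embedding_collinear[OF \<phi> cs(1) us(1,2) lam_mono us(3-5)]
    have "us ! 0 \<in> V" "us ! 1 \<in> V" "us ! 2 \<in> V" using us(1,2) cs(1) by (auto intro!: subsetD[OF us(2)] nth_mem)
    moreover have "us ! 0 \<noteq> us ! 2" "us ! 1 \<noteq> us ! 2" using col(1,2) by auto
    ultimately show "\<exists>u0\<in>V. \<exists>u1\<in>V. \<exists>u2\<in>V. u0 \<noteq> u2 \<and> u1 \<noteq> u2 \<and>
      lam (ty (\<phi> u0)) \<noteq> lam (ty (\<phi> u1)) \<and> collinear (\<phi> u0) (\<phi> u1) (\<phi> u2)"
      using col(1,3) less_imp_neq[OF col(1)] by blast
  qed
  then have "real (card (embeddings V E n T) * n) \<le> real (h ^ 4 * b * n ^ h)" by (simp only: of_nat_le_iff)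
  then have "real (card (embeddings V E n T)) * real n \<le> real h ^ 4 * real b * real n ^ h" by simp
  moreover have "(f * real n ^ h) * real n \<le> real (card (embeddings V E n T)) * real n" using 1 by (rule mult_right_mono) simp
  ultimately have "(f * real n ^ h) * real n \<le> real h ^ 4 * real b * real n ^ h" by linarith
  then have "(f * real m) * (real h * real b * real n ^ h) \<le> real h ^ 3 * (real h * real b * real n ^ h)"
  proof -
    assume *: "(f * real n ^ h) * real n \<le> real h ^ 4 * real b * real n ^ h"
    have "(f * real m) * (real h * real b * real n ^ h) = (f * real n ^ h) * (real h * real m * real b)" by (simp only: mult_ac)
    also have "\<dots> = (f * real n ^ h) * real n" by (simp only: n)
    also have "\<dots> \<le> real h ^ 4 * real b * real n ^ h" by (rule *)
    also have "\<dots> = real h ^ 3 * (real h * real b * real n ^ h)" by (simp add: power3_eq_cube power4_eq_xxxx mult_ac)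
    finally show ?thesis .
  qed
  moreover have "real h * real b * real n ^ h > 0" using h n_pos b by simp
  ultimately have fm: "f * real m \<le> real h ^ 3" by (rule mult_right_le_imp_le)
  have "real h ^ 3 < (\<epsilon> powr c / 2) * real m"
  proof -
    have "2 * real h ^ 3 < \<kappa> powr c * real Q" using Q(4) \<kappa> by (simp add: pos_divide_less_eq mult.commute)
    also have "\<dots> \<le> \<kappa> powr c * real Q powr (real D - 2 * c)"
    proof (rule mult_left_mono)
      have "real Q powr 1 \<le> real Q powr (real D - 2 * c)" using D(2) Q(2) by (intro powr_mono) auto
      then show "real Q \<le> real Q powr (real D - 2 * c)" using Q(1) by simp
    qed simp
    also have "real Q powr (real D - 2 * c) = real Q ^ D / (real Q ^ 2) powr c"
    proof -
      have "(real Q ^ 2) powr c = real Q powr (2 * c)"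
      proof -
        have "real Q powr (2 * c) = (real Q powr 2) powr c" by (simp only: powr_powr)
        then show ?thesis using Q(1) by (simp add: powr_numeral)
      qed
      then show ?thesis using Q(1) by (simp add: powr_diff powr_realpow del: of_nat_power)
    qed
    also have "\<kappa> powr c * (real Q ^ D / (real Q ^ 2) powr c) = \<epsilon> powr c * real Q ^ D"
      using \<kappa> by (simp add: \<epsilon>_def powr_divide)
    also have "\<dots> \<le> \<epsilon> powr c * real m"
    proof (rule mult_left_mono)
      have "real (Q ^ D) \<le> real m" using power_le_m by (simp only: of_nat_le_iff)
      then show "real Q ^ D \<le> real m" by simp
    qed simp
    finally show ?thesis by simp
  qed
  also have "\<dots> < f * real m" using f(2) m_pos by (intro mult_strict_right_mono) auto
  finally show False using fm by simp
qed

theorem theorem1p1: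
  fixes V :: "'a set" and E :: "('a \<times> 'a) set"
  assumes "oriented_graph V E"
  shows "easy V E \<longleftrightarrow>
    (\<exists>A B. A \<union> B = V \<and> A \<inter> B = {} \<and>
           acyclic (induced_arcs E A) \<and> acyclic (induced_arcs E B))"
  using two_colorable_imp_easy[OF assms] not_two_colorable_imp_not_easy[OF assms] by blast

end
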